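(* Let $N\in\{2,3\}$ and let $K$ be a compact set in $\mathbb{R}^{N}$. Let $\mathcal{V}$ and $\Omega$ be two bounded open sets in $\mathbb{R}^N$ such that $K \subset \mathcal{V}$, $\overline{\mathcal{V}} \subset \Omega$, and each connected component of $\mathbb{R}^{N} \setminus K$ contains an interior point of $\mathbb{R}^{N} \setminus \Omega$. Then for any $(u,p) \in C^{\infty}(\mathcal{V};\mathbb{R}^{N+1})$ solving the Stokes equation in $\mathcal{V}$, \[ -\Delta u + \nabla p = 0, \qquad \operatorname{div} u = 0 \quad\text{in } \mathcal{V}, \] for any $k \in \mathbb{N}$ and any $\varepsilon>0$ there exists $(\overline{u},\overline{p}) \in C_{c}^{\infty}(\mathbb{R}^{N}; \mathbb{R}^{N+1})$ solving the Stokes equation in $\Omega$, \[ -\Delta \overline{u} + \nabla \overline{p} = 0, \qquad \operatorname{div} \overline{u} = 0 \quad\text{in } \Omega, \] and such that \[ \| \overline{u} - u \|_{C^{k}(K)} \leq \varepsilon. \] *)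

theory Defs
  imports "HOL-Analysis.Analysis"
begin

definition pd :: "'n::finite \<Rightarrow> (real^'n \<Rightarrow> 'b::real_normed_vector) \<Rightarrow> real^'n \<Rightarrow> 'b" where
  "pd i f x = vector_derivative (\<lambda>t. f (x + t *\<^sub>R axis i 1)) (at 0)"

fun pds :: "'n::finite list \<Rightarrow> (real^'n \<Rightarrow> 'b::real_normed_vector) \<Rightarrow> real^'n \<Rightarrow> 'b" where
  "pds [] f = f"
| "pds (i # is) f = pd i (pds is f)"

definition smooth_on :: "(real^'n::finite \<Rightarrow> 'b::real_normed_vector) \<Rightarrow> (real^'n) set \<Rightarrow> bool" where
  "smooth_on f S \<longleftrightarrow>
     (\<forall>js. continuous_on S (pds js f)) \<and>
     (\<forall>js i. \<forall>x\<in>S. (\<lambda>t. pds js f (x + t *\<^sub>R axis i 1)) differentiable (at 0))"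

definition smooth_compact_support :: "(real^'n::finite \<Rightarrow> 'b::real_normed_vector) \<Rightarrow> bool" where
  "smooth_compact_support f \<longleftrightarrow> smooth_on f UNIV \<and> compact (closure {x. f x \<noteq> 0})"

definition laplacian :: "(real^'n::finite \<Rightarrow> real) \<Rightarrow> real^'n \<Rightarrow> real" where
  "laplacian f x = (\<Sum>j\<in>UNIV. pds [j, j] f x)"

definition divergence :: "(real^'n::finite \<Rightarrow> real^'n) \<Rightarrow> real^'n \<Rightarrow> real" where
  "divergence u x = (\<Sum>i\<in>UNIV. pd i (\<lambda>y. u y $ i) x)"

definition stokes_on :: "(real^'n::finite \<Rightarrow> real^'n) \<Rightarrow> (real^'n \<Rightarrow> real) \<Rightarrow> (real^'n) set \<Rightarrow> bool" where
  "stokes_on u p S \<longleftrightarrow>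
     (\<forall>x\<in>S. \<forall>i. - laplacian (\<lambda>y. u y $ i) x + pd i p x = 0) \<and>
     (\<forall>x\<in>S. divergence u x = 0)"

definition Ck_norm :: "nat \<Rightarrow> (real^'n::finite) set \<Rightarrow> (real^'n \<Rightarrow> 'b::real_normed_vector) \<Rightarrow> real" where
  "Ck_norm k K f = Sup ({norm (pds js f x) | js x. length js \<le> k \<and> x \<in> K} \<union> {0})"

end

theory Submission
  imports Defs "HOL-Complex_Analysis.Complex_Analysis"
begin

text \<open>The proof is Runge's pole-pushing argument. Cut \<open>(u, p)\<close> off outside a neighbourhood of \<open>K\<close>. The resulting
  pair has force and divergence supported in a compact set \<open>L\<close> disjoint from \<open>K\<close>, so on \<open>K\<close> the velocity is an
  integral over \<open>L\<close> of the Stokes kernels against this force and divergence; the kernels are obtained by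
  differentiating a fundamental solution \<open>B\<close> of the bilaplacian, \<open>\<bar>z\<bar>\<close> for \<open>N = 3\<close> and \<open>\<bar>z\<bar>\<^sup>2 ln \<bar>z\<bar>\<^sup>2\<close> for \<open>N = 2\<close> up
  to constants. Riemann sums reduce the claim to a single kernel with pole \<open>y \<notin> K\<close>. Poles in the interior of the
  complement of \<open>\<Omega>\<close> are harmless, by a second cutoff. The set of good poles is closed in the complement of \<open>K\<close>
  because moving a pole along a straight line expands the kernel in a power series, uniformly on \<open>K\<close>, so it contains
  every component of that complement that meets the interior of the complement of \<open>\<Omega>\<close>.\<close>

section \<open>Calculus of iterated partial derivatives\<close>

text \<open>The kernels are singular at their pole, and no singular integral is ever differentiated.
  The representation is needed only at points where the bilaplacian of the cut-off field vanishes.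
  It comes from replacing |z|^2 by |z|^2 + a in the fundamental solution: the result is smooth
  everywhere, and its bilaplacian is a rescaled copy of one integrable bump, so a -> 0 recovers the
  value at the point up to a nonzero constant whose size does not matter. Derivatives of the
  velocity on \<open>K\<close> are represented by applying the formula to the differentiated field,
  not by differentiating under the integral. The bilaplacian is the right operator because it
  eliminates the pressure.

  Approximation must hold for all derivatives up to order \<open>k\<close> at once, and the
  coefficients of a power series in the pole are not known to be derivatives of anything.
  Approximability is therefore a property of arbitrary tables of numbers indexed by derivative,
  point and component.

  Moving the pole along a line turns the expansion into a one-variable matter: |z - t e|^2 is
  continued to complex t, and Cauchy's inequality bounds the coefficients uniformly in z.\<close>

definition has_pd :: "'n::finite \<Rightarrow> (real^'n \<Rightarrow> 'b::real_normed_vector) \<Rightarrow> 'b \<Rightarrow> real^'n \<Rightarrow> bool" where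
  "has_pd i f d x \<longleftrightarrow> ((\<lambda>t. f (x + t *\<^sub>R axis i 1)) has_vector_derivative d) (at 0)"

lemma has_pd_imp_pd: "has_pd i f d x \<Longrightarrow> pd i f x = d"
  unfolding has_pd_def pd_def by (rule vector_derivative_at)

lemma smooth_on_has_pd:
  assumes "smooth_on f S" "x \<in> S"
  shows "has_pd i (pds js f) (pds (i # js) f x) x"
  using assms unfolding smooth_on_def has_pd_def pd_def pds.simps
  by (simp add: vector_derivative_works[symmetric])

lemma smooth_on_continuous: "smooth_on f S \<Longrightarrow> continuous_on S (pds js f)"
  by (simp add: smooth_on_def)

lemma smooth_on_continuous0: "smooth_on f S \<Longrightarrow> continuous_on S f"
  using smooth_on_continuous[of f S "[]"] by simp

lemma smooth_on_subset: "smooth_on f S \<Longrightarrow> T \<subseteq> S \<Longrightarrow> smooth_on f T"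
  unfolding smooth_on_def using continuous_on_subset by blast

lemma eventually_line:
  assumes "open S" "x \<in> S"
  shows "\<forall>\<^sub>F t in nhds 0. x + t *\<^sub>R (v::'a::real_normed_vector) \<in> S"
proof -
  have "isCont (\<lambda>t. x + t *\<^sub>R v) 0" by (intro continuous_intros)
  then have "((\<lambda>t. x + t *\<^sub>R v) \<longlongrightarrow> x) (nhds 0)"
    by (simp add: isCont_def tendsto_nhds_iff)
  then show ?thesis using assms by (simp add: topological_tendstoD)
qed

lemma has_pd_cong:
  assumes "open S" "x \<in> S" "\<And>y. y \<in> S \<Longrightarrow> f y = g y"
  shows "has_pd i f d x \<longleftrightarrow> has_pd i g d x"
proof -
  have ev: "\<forall>\<^sub>F t in nhds 0. f (x + t *\<^sub>R axis i 1) = g (x + t *\<^sub>R axis i 1)"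
    by (rule eventually_mono[OF eventually_line[OF assms(1,2)]]) (use assms(3) in auto)
  show ?thesis unfolding has_pd_def
    by (rule has_vector_derivative_cong_ev) (use ev assms in \<open>auto simp: eventually_nhds_conv_at\<close>)
qed

lemma pd_cong:
  assumes "open S" "x \<in> S" "\<And>y. y \<in> S \<Longrightarrow> f y = g y"
  shows "pd i f x = pd i g x"
  \<comment> \<open>\<open>vector_derivative\<close> is a choice over all derivatives, so the
    equivalence gives equal values even where no derivative exists.\<close>
  using has_pd_cong[of S x f g i, OF assms] unfolding pd_def has_pd_def vector_derivative_def by simp

lemma pds_cong:
  assumes "open S" "x \<in> S" "\<And>y. y \<in> S \<Longrightarrow> f y = g y"
  shows "pds js f x = pds js g x"
  using assms(2)
proof (induction js arbitrary: x)
  case (Cons i js)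
  then show ?case by (auto intro: pd_cong[OF assms(1)])
qed (use assms in auto)

lemma pds_append: "pds (js @ ls) f = pds js (pds ls f)"
  by (induction js) auto

lemma smooth_on_pds: "smooth_on f S \<Longrightarrow> smooth_on (pds ls f) S"
  unfolding smooth_on_def pds_append[symmetric] by blast

lemma smooth_on_cong:
  assumes "open S" "\<And>y. y \<in> S \<Longrightarrow> f y = g y" "smooth_on f S"
  shows "smooth_on g S"
proof -
  have eq: "pds js f x = pds js g x" if "x \<in> S" for js x
    by (rule pds_cong[OF assms(1) that assms(2)])
  have "has_pd i (pds js g) (pds (i#js) f x) x" if "x \<in> S" for i js x
    using has_pd_cong[OF assms(1) that, of "pds js f" "pds js g"] eq smooth_on_has_pd[OF assms(3) that] by blast
  moreover have "continuous_on S (pds js g)" for js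
    using smooth_on_continuous[OF assms(3), of js] eq by (simp cong: continuous_on_cong)
  ultimately show ?thesis unfolding smooth_on_def has_pd_def
    using differentiableI_vector by blast
qed

lemma smooth_on_Un:
  assumes "open S" "open T" "smooth_on f S" "smooth_on f T"
  shows "smooth_on f (S \<union> T)"
  using assms unfolding smooth_on_def by (auto intro: continuous_on_open_Un)

text \<open>Smoothness is coinductive: a function is smooth as soon as it lies in some class of
  continuous functions that is closed under partial derivatives.\<close>

lemma smooth_on_coinduct:
  fixes f :: "real^'n::finite \<Rightarrow> 'b::real_normed_vector"
  assumes S: "open S" and f: "f \<in> C"
    and cont: "\<And>g. g \<in> C \<Longrightarrow> continuous_on S g"
    and step: "\<And>g i. g \<in> C \<Longrightarrow> \<exists>g'\<in>C. \<forall>x\<in>S. has_pd i g (g' x) x"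
  shows "smooth_on f S"
proof -
  have key: "\<exists>g\<in>C. \<forall>x\<in>S. pds js f x = g x" for js
  proof (induction js)
    case (Cons i js)
    then obtain g where g: "g \<in> C" "\<forall>x\<in>S. pds js f x = g x" by blast
    obtain g' where g': "g' \<in> C" "\<forall>x\<in>S. has_pd i g (g' x) x" using step[OF g(1)] by blast
    have "pds (i # js) f x = g' x" if "x \<in> S" for x
      using pd_cong[OF S that, of "pds js f" g i] g g'(2) has_pd_imp_pd[of i g "g' x" x] that by auto
    then show ?case using g' by blast
  qed (use f in auto)
  show ?thesis unfolding smooth_on_def
  proof (intro conjI allI ballI)
    fix js
    show "continuous_on S (pds js f)" using key[of js] cont by (metis continuous_on_cong)
  next
    fix js i x assume x: "x \<in> S"
    obtain g where g: "g \<in> C" "\<forall>x\<in>S. pds js f x = g x" using key by blast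
    obtain g' where g': "g' \<in> C" "\<forall>x\<in>S. has_pd i g (g' x) x" using step[OF g(1)] by blast
    have "has_pd i (pds js f) (g' x) x" using has_pd_cong[OF S x, of "pds js f" g i] g g' x by auto
    then show "(\<lambda>t. pds js f (x + t *\<^sub>R axis i 1)) differentiable at 0"
      unfolding has_pd_def using differentiableI_vector by blast
  qed
qed

section \<open>Differentiation rules and closure properties of smooth functions\<close>

lemma has_pd_const: "has_pd i (\<lambda>_. c) 0 x"
  unfolding has_pd_def by (rule has_vector_derivative_const)

lemma has_pd_add: "has_pd i f a x \<Longrightarrow> has_pd i g b x \<Longrightarrow> has_pd i (\<lambda>y. f y + g y) (a + b) x"
  unfolding has_pd_def by (rule has_vector_derivative_add)

lemma has_pd_mult:
  fixes f g :: "real^'n::finite \<Rightarrow> real"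
  shows "has_pd i f a x \<Longrightarrow> has_pd i g b x \<Longrightarrow> has_pd i (\<lambda>y. f y * g y) (f x * b + a * g x) x"
  unfolding has_pd_def by (drule (1) has_vector_derivative_mult) simp

lemma has_pd_coord: "has_pd i (\<lambda>y. y $ j) (if i = j then 1 else 0) (x::real^'n::finite)"
  unfolding has_pd_def has_real_derivative_iff_has_vector_derivative[symmetric]
  by (auto intro!: derivative_eq_intros simp: axis_def)

lemma has_pd_compose:
  fixes f :: "real^'n::finite \<Rightarrow> real" and h :: "real \<Rightarrow> real"
  assumes "has_pd i f a x" "(h has_real_derivative b) (at (f x))"
  shows "has_pd i (\<lambda>y. h (f y)) (b * a) x"
  using DERIV_chain2[of h b "\<lambda>t. f (x + t *\<^sub>R axis i 1)" 0 a UNIV] assms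
  unfolding has_pd_def has_real_derivative_iff_has_vector_derivative[symmetric] by simp

lemma has_pd_linear:
  assumes "bounded_linear L" "has_pd i f a x"
  shows "has_pd i (\<lambda>y. L (f y)) (L a) x"
  using bounded_linear.has_vector_derivative[OF assms(1), of "\<lambda>t. f (x + t *\<^sub>R axis i 1)" a "at 0"] assms
  unfolding has_pd_def by simp

lemma pds_zero [simp]: "pds js (\<lambda>_::real^'n::finite. 0::'b::real_normed_vector) = (\<lambda>_. 0)"
  by (induction js) (auto simp: pd_def fun_eq_iff)

lemma smooth_on_const: "open S \<Longrightarrow> smooth_on (\<lambda>_. c) S"
  by (rule smooth_on_coinduct[where C="range (\<lambda>c x. c)"]) (auto intro: has_pd_const)

text \<open>A guessed table of all iterated derivatives, checked one derivative at a time, yields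
  smoothness and the values of \<open>pds\<close> together. It serves the operations whose higher
  derivatives have a closed form.\<close>

lemma smooth_on_table:
  fixes F :: "'n::finite list \<Rightarrow> real^'n \<Rightarrow> 'b::real_normed_vector"
  assumes S: "open S"
    and cont: "\<And>js. continuous_on S (F js)"
    and step: "\<And>i js x. x \<in> S \<Longrightarrow> has_pd i (F js) (F (i # js) x) x"
  shows "smooth_on (F []) S" and "x \<in> S \<Longrightarrow> pds js (F []) x = F js x"
proof -
  show "smooth_on (F []) S"
    by (rule smooth_on_coinduct[OF S, where C="range F"]) (use cont step in blast)+
  show "x \<in> S \<Longrightarrow> pds js (F []) x = F js x" for x
  proof (induction js arbitrary: x)
    case (Cons i js)
    then show ?case using pd_cong[OF S, of x "pds js (F [])" "F js" i] step[of x i js] has_pd_imp_pd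
      by fastforce
  qed auto
qed

lemma
  assumes "open S" "smooth_on f S" "smooth_on g S"
  shows smooth_on_add: "smooth_on (\<lambda>x. f x + g x) S"
    and pds_add: "x \<in> S \<Longrightarrow> pds js (\<lambda>x. f x + g x) x = pds js f x + pds js g x"
proof -
  note * = smooth_on_table[OF assms(1), of "\<lambda>js x. pds js f x + pds js g x",
      OF continuous_on_add[OF smooth_on_continuous[OF assms(2)] smooth_on_continuous[OF assms(3)]]
        has_pd_add[OF smooth_on_has_pd[OF assms(2)] smooth_on_has_pd[OF assms(3)]], simplified]
  show "smooth_on (\<lambda>x. f x + g x) S" by (rule *(1))
  show "x \<in> S \<Longrightarrow> pds js (\<lambda>x. f x + g x) x = pds js f x + pds js g x" by (rule *(2))
qed

lemma
  assumes "open S" "bounded_linear L" "smooth_on f S"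
  shows smooth_on_linear: "smooth_on (\<lambda>x. L (f x)) S"
    and pds_linear: "x \<in> S \<Longrightarrow> pds js (\<lambda>x. L (f x)) x = L (pds js f x)"
proof -
  note * = smooth_on_table[OF assms(1), of "\<lambda>js x. L (pds js f x)",
      OF bounded_linear.continuous_on[OF assms(2) smooth_on_continuous[OF assms(3)]]
        has_pd_linear[OF assms(2) smooth_on_has_pd[OF assms(3)]], simplified]
  show "smooth_on (\<lambda>x. L (f x)) S" by (rule *(1))
  show "x \<in> S \<Longrightarrow> pds js (\<lambda>x. L (f x)) x = L (pds js f x)" by (rule *(2))
qed

lemma
  fixes f :: "real^'n::finite \<Rightarrow> real"
  assumes "open S" "smooth_on f S"
  shows smooth_on_cmult: "smooth_on (\<lambda>x. c * f x) S"
    and pds_cmult: "x \<in> S \<Longrightarrow> pds js (\<lambda>x. c * f x) x = c * pds js f x"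
  using smooth_on_linear[OF assms(1) bounded_linear_mult_right assms(2)]
    pds_linear[OF assms(1) bounded_linear_mult_right assms(2)] by auto

lemma
  assumes "open S" "smooth_on f S"
  shows smooth_on_minus: "smooth_on (\<lambda>x. - f x) S"
    and pds_minus: "x \<in> S \<Longrightarrow> pds js (\<lambda>x. - f x) x = - pds js f x"
  using smooth_on_linear[OF assms(1) bounded_linear_minus[OF bounded_linear_ident] assms(2)]
    pds_linear[OF assms(1) bounded_linear_minus[OF bounded_linear_ident] assms(2)] by auto

lemma
  assumes S: "open S" and "finite I" "\<And>i. i \<in> I \<Longrightarrow> smooth_on (f i) S"
  shows smooth_on_sum: "smooth_on (\<lambda>x. \<Sum>i\<in>I. f i x) S"
    and pds_sum: "x \<in> S \<Longrightarrow> pds js (\<lambda>x. \<Sum>i\<in>I. f i x) x = (\<Sum>i\<in>I. pds js (f i) x)"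
proof -
  have "smooth_on (\<lambda>x. \<Sum>i\<in>I. f i x) S \<and> (\<forall>x\<in>S. pds js (\<lambda>x. \<Sum>i\<in>I. f i x) x = (\<Sum>i\<in>I. pds js (f i) x))"
    using assms(2,3)
  proof (induction I)
    case (insert a I)
    have 1: "smooth_on (f a) S" "smooth_on (\<lambda>x. \<Sum>i\<in>I. f i x) S" using insert by auto
    show ?case using insert smooth_on_add[OF S 1] pds_add[OF S 1] by simp
  qed (simp add: smooth_on_const[OF S])
  then show "smooth_on (\<lambda>x. \<Sum>i\<in>I. f i x) S"
    and "x \<in> S \<Longrightarrow> pds js (\<lambda>x. \<Sum>i\<in>I. f i x) x = (\<Sum>i\<in>I. pds js (f i) x)" by auto
qed

text \<open>By the Leibniz rule single products are not closed under differentiation, but finite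
  sums of products are. Coinduction over this class replaces the higher Leibniz and chain rule
  formulas.\<close>

inductive_set bilin_class :: "(real^'n::finite \<Rightarrow> real) set \<Rightarrow> (real^'n \<Rightarrow> real) set \<Rightarrow> (real^'n \<Rightarrow> real) set"
  for A B where
  prod: "f \<in> A \<Longrightarrow> g \<in> B \<Longrightarrow> (\<lambda>x. f x * g x) \<in> bilin_class A B"
| add: "f \<in> bilin_class A B \<Longrightarrow> g \<in> bilin_class A B \<Longrightarrow> (\<lambda>x. f x + g x) \<in> bilin_class A B"

lemma smooth_on_mult:
  fixes f g :: "real^'n::finite \<Rightarrow> real"
  assumes S: "open S" and "smooth_on f S" "smooth_on g S"
  shows "smooth_on (\<lambda>x. f x * g x) S"
proof (rule smooth_on_coinduct[OF S, where C="bilin_class {f. smooth_on f S} {f. smooth_on f S}"])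
  show "(\<lambda>x. f x * g x) \<in> bilin_class {f. smooth_on f S} {f. smooth_on f S}"
    by (rule bilin_class.prod) (use assms in auto)
next
  fix h assume "h \<in> bilin_class {f. smooth_on f S} {f. smooth_on f S}"
  then show "continuous_on S h"
    by induction (auto intro: continuous_on_mult continuous_on_add smooth_on_continuous0)
next
  fix h i assume "h \<in> bilin_class {f. smooth_on f S} {f. smooth_on f S}"
  then show "\<exists>h'\<in>bilin_class {f. smooth_on f S} {f. smooth_on f S}. \<forall>x\<in>S. has_pd i h (h' x) x"
  proof induction
    case (prod f g)
    then have sm: "smooth_on f S" "smooth_on g S" by auto
    have "(\<lambda>x. f x * pds [i] g x + pds [i] f x * g x) \<in> bilin_class {f. smooth_on f S} {f. smooth_on f S}"
      by (intro bilin_class.intros CollectI smooth_on_pds sm)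
    moreover have "has_pd i (\<lambda>x. f x * g x) (f x * pds [i] g x + pds [i] f x * g x) x" if "x \<in> S" for x
      using has_pd_mult smooth_on_has_pd[OF sm(1) that, of i "[]"] smooth_on_has_pd[OF sm(2) that, of i "[]"]
      by fastforce
    ultimately show ?case by (intro bexI ballI)
  next
    case (add f g)
    then obtain f' g' where fg: "f' \<in> bilin_class {f. smooth_on f S} {f. smooth_on f S}" "g' \<in> bilin_class {f. smooth_on f S} {f. smooth_on f S}"
      "\<forall>x\<in>S. has_pd i f (f' x) x" "\<forall>x\<in>S. has_pd i g (g' x) x" by blast
    show ?case
      by (rule bexI[OF _ bilin_class.add[OF fg(1,2)]]) (use fg(3,4) in \<open>auto intro: has_pd_add\<close>)
  qed
qed

text \<open>Here \<open>h n\<close> is the n-th derivative of \<open>h 0\<close>. The chain rule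
  keeps sums of terms \<open>h n (f x) * g x\<close> with smooth \<open>g\<close> within the same
  shape, so coinduction applies.\<close>

lemma smooth_on_compose:
  fixes f :: "real^'n::finite \<Rightarrow> real" and h :: "nat \<Rightarrow> real \<Rightarrow> real"
  assumes S: "open S" and f: "smooth_on f S" and T: "f ` S \<subseteq> T"
    and h: "\<And>n t. t \<in> T \<Longrightarrow> (h n has_real_derivative h (Suc n) t) (at t)"
  shows "smooth_on (\<lambda>x. h 0 (f x)) S"
proof -
  let ?A = "range (\<lambda>n x. h n (f x))" and ?B = "{f. smooth_on f S}"
  have hd: "has_pd i (\<lambda>x. h n (f x)) (h (Suc n) (f x) * pds [i] f x) x" if "x \<in> S" for i n x
    using has_pd_compose[OF smooth_on_has_pd[OF f that, of i "[]", unfolded pds.simps(1)] h[of "f x" n]] T that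
    by auto
  have cont: "continuous_on S (\<lambda>x. h n (f x))" for n
  proof -
    have "continuous_on T (h n)"
      using h by (meson DERIV_isCont continuous_at_imp_continuous_on)
    then show ?thesis by (rule continuous_on_compose2[OF _ smooth_on_continuous0[OF f] T])
  qed
  \<comment> \<open>The factor 1 puts the composition into the class of products.\<close>
  have "smooth_on (\<lambda>x. h 0 (f x) * 1) S"
  proof (rule smooth_on_coinduct[OF S, where C="bilin_class ?A ?B"])
    show "(\<lambda>x. h 0 (f x) * 1) \<in> bilin_class ?A ?B"
      by (rule bilin_class.prod) (auto intro: smooth_on_const[OF S])
  next
    fix g assume "g \<in> bilin_class ?A ?B"
    then show "continuous_on S g"
      by induction (auto intro: continuous_on_mult continuous_on_add smooth_on_continuous0 cont)
  next
    fix g i assume "g \<in> bilin_class ?A ?B"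
    then show "\<exists>g'\<in>bilin_class ?A ?B. \<forall>x\<in>S. has_pd i g (g' x) x"
    proof induction
      case (prod a g)
      then obtain n where a: "a = (\<lambda>x. h n (f x))" by auto
      have g: "smooth_on g S" using prod by simp
      have "(\<lambda>x. h n (f x) * pds [i] g x + h (Suc n) (f x) * (pds [i] f x * g x)) \<in> bilin_class ?A ?B"
        using smooth_on_pds[OF g] smooth_on_mult[OF S smooth_on_pds[OF f] g]
        by (intro bilin_class.add bilin_class.prod) blast+
      moreover have "has_pd i (\<lambda>x. a x * g x) (h n (f x) * pds [i] g x + h (Suc n) (f x) * (pds [i] f x * g x)) x"
        if "x \<in> S" for x
        using has_pd_mult[OF hd[OF that, of i n] smooth_on_has_pd[OF g that, of i "[]", unfolded pds.simps(1)]]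
        by (simp add: a mult.assoc)
      ultimately show ?case by (intro bexI ballI)
    next
      case (add f g)
      then obtain f' g' where fg: "f' \<in> bilin_class ?A ?B" "g' \<in> bilin_class ?A ?B"
        "\<forall>x\<in>S. has_pd i f (f' x) x" "\<forall>x\<in>S. has_pd i g (g' x) x" by blast
      show ?case
        by (rule bexI[OF _ bilin_class.add[OF fg(1,2)]]) (use fg(3,4) in \<open>auto intro: has_pd_add\<close>)
    qed
  qed
  then show ?thesis by simp
qed

lemma smooth_on_coord: "open S \<Longrightarrow> smooth_on (\<lambda>x. x $ i) S"
  by (rule smooth_on_coinduct[where C="insert (\<lambda>x. x $ i) (range (\<lambda>c x. c))"])
    (auto intro!: continuous_intros has_pd_const has_pd_coord)

lemma pds_translate: "pds js (\<lambda>x. f (x - a)) x = pds js f (x - a)"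
  by (induction js arbitrary: x) (auto simp: pd_def algebra_simps)

lemma smooth_on_translate:
  assumes "smooth_on f S" "\<And>x. x \<in> T \<Longrightarrow> x - a \<in> S"
  shows "smooth_on (\<lambda>x. f (x - a)) T"
proof -
  have "continuous_on T (\<lambda>x. pds js f (x - a))" for js
    by (rule continuous_on_compose2[OF smooth_on_continuous[OF assms(1)]])
      (use assms in \<open>auto intro!: continuous_intros\<close>)
  moreover have "(\<lambda>t. pds js f (x + t *\<^sub>R axis i 1 - a)) differentiable at 0" if "x \<in> T" for js i x
  proof -
    have "x + t *\<^sub>R axis i 1 - a = x - a + t *\<^sub>R axis i 1" for t by (simp add: algebra_simps)
    then show ?thesis using assms(1) assms(2)[OF that] unfolding smooth_on_def by presburger
  qed
  moreover have "pds js (\<lambda>x. f (x - a)) = (\<lambda>x. pds js f (x - a))" for js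
    using pds_translate by blast
  ultimately show ?thesis unfolding smooth_on_def by simp
qed

section \<open>Symmetry of iterated partial derivatives\<close>

lemma line_has_real_derivative:
  fixes f :: "real^'n::finite \<Rightarrow> real"
  assumes "smooth_on f S" "x + s *\<^sub>R axis i 1 \<in> S"
  shows "((\<lambda>t. pds js f (x + t *\<^sub>R axis i 1)) has_real_derivative pds (i # js) f (x + s *\<^sub>R axis i 1)) (at s)"
proof -
  have "has_pd i (pds js f) (pds (i # js) f (x + s *\<^sub>R axis i 1)) (x + s *\<^sub>R axis i 1)"
    by (rule smooth_on_has_pd[OF assms])
  then have "((\<lambda>t. pds js f (x + (t + s) *\<^sub>R axis i 1)) has_real_derivative pds (i # js) f (x + s *\<^sub>R axis i 1)) (at 0)"
    unfolding has_pd_def has_real_derivative_iff_has_vector_derivative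
    by (simp add: algebra_simps)
  then show ?thesis
    using DERIV_shift[of "\<lambda>t. pds js f (x + t *\<^sub>R axis i 1)" _ 0 s] by simp
qed

text \<open>Two applications of the mean value theorem, first in direction \<open>i\<close> to the
  increment in direction \<open>j\<close>, then in direction \<open>j\<close> to the partial
  derivative so obtained.\<close>

lemma mixed_difference:
  fixes f :: "real^'n::finite \<Rightarrow> real"
  assumes f: "smooth_on f S" and h: "h > 0" and S: "cball x (2*h) \<subseteq> S"
  shows "\<exists>z\<in>cball x (2*h). f (x + h *\<^sub>R axis i 1 + h *\<^sub>R axis j 1) - f (x + h *\<^sub>R axis i 1)
    - f (x + h *\<^sub>R axis j 1) + f x = h * h * pds [j, i] f z"
proof -
  have in_ball: "x + s *\<^sub>R axis i 1 + t *\<^sub>R axis j 1 \<in> cball x (2*h)" if "\<bar>s\<bar> \<le> h" "\<bar>t\<bar> \<le> h" for s t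
  proof -
    have "norm (s *\<^sub>R axis i (1::real) + t *\<^sub>R axis j 1) \<le> \<bar>s\<bar> + \<bar>t\<bar>"
      by (rule order_trans[OF norm_triangle_ineq]) (simp add: norm_axis_1)
    moreover have "dist (x + s *\<^sub>R axis i 1 + t *\<^sub>R axis j 1) x = norm (s *\<^sub>R axis i (1::real) + t *\<^sub>R axis j 1)"
      by (simp add: dist_norm)
    ultimately show ?thesis using that by (simp add: dist_commute)
  qed
  let ?\<phi> = "\<lambda>s. f (x + h *\<^sub>R axis j 1 + s *\<^sub>R axis i 1) - f (x + s *\<^sub>R axis i 1)"
  have m: "x + h *\<^sub>R axis j 1 + s *\<^sub>R axis i 1 \<in> S" "x + s *\<^sub>R axis i 1 \<in> S" if "0 \<le> s" "s \<le> h" for s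
    using in_ball[of s h] in_ball[of s 0] that h S by (auto simp: add_ac)
  have "\<exists>s>0. s < h \<and> ?\<phi> h - ?\<phi> 0 = (h - 0) * (pds [i] f (x + h *\<^sub>R axis j 1 + s *\<^sub>R axis i 1) - pds [i] f (x + s *\<^sub>R axis i 1))"
    by (rule MVT2[OF h]) (use m line_has_real_derivative[OF f, of _ _ _ "[]"] in \<open>auto intro!: derivative_intros\<close>)
  then obtain s where s: "0 < s" "s < h"
    "?\<phi> h - ?\<phi> 0 = h * (pds [i] f (x + h *\<^sub>R axis j 1 + s *\<^sub>R axis i 1) - pds [i] f (x + s *\<^sub>R axis i 1))"
    by auto
  have m2: "x + s *\<^sub>R axis i 1 + t *\<^sub>R axis j 1 \<in> S" if "0 \<le> t" "t \<le> h" for t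
    using in_ball[of s t] that h S s by auto
  have "\<exists>t>0. t < h \<and> pds [i] f (x + s *\<^sub>R axis i 1 + h *\<^sub>R axis j 1) - pds [i] f (x + s *\<^sub>R axis i 1 + 0 *\<^sub>R axis j 1)
     = (h - 0) * pds [j, i] f (x + s *\<^sub>R axis i 1 + t *\<^sub>R axis j 1)"
    by (rule MVT2[OF h]) (use m2 line_has_real_derivative[OF f, of _ _ _ "[i]"] in auto)
  then obtain t where t: "0 < t" "t < h" "pds [i] f (x + s *\<^sub>R axis i 1 + h *\<^sub>R axis j 1) - pds [i] f (x + s *\<^sub>R axis i 1)
     = h * pds [j, i] f (x + s *\<^sub>R axis i 1 + t *\<^sub>R axis j 1)" by auto
  have "?\<phi> h - ?\<phi> 0 = h * h * pds [j, i] f (x + s *\<^sub>R axis i 1 + t *\<^sub>R axis j 1)"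
    using s(3) t(3) by (simp only: add_ac mult_ac)
  moreover have "x + s *\<^sub>R axis i 1 + t *\<^sub>R axis j 1 \<in> cball x (2*h)"
    using in_ball[of s t] s t by auto
  ultimately show ?thesis by (auto simp: add_ac intro!: bexI)
qed

text \<open>The second difference is symmetric in the two directions, so the two mixed derivatives
  agree at some pair of points within \<open>2*h\<close> of \<open>x\<close>. Continuity would
  separate these values if the derivatives at \<open>x\<close> differed, \<open>e\<close> being half
  their distance.\<close>

lemma pds_swap:
  fixes f :: "real^'n::finite \<Rightarrow> real"
  assumes f: "smooth_on f S" and S: "open S" "x \<in> S"
  shows "pds [i, j] f x = pds [j, i] f x"
proof (rule ccontr)
  assume ne: "pds [i, j] f x \<noteq> pds [j, i] f x"
  define e where "e = \<bar>pds [i, j] f x - pds [j, i] f x\<bar> / 2"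
  have e: "e > 0" using ne by (simp add: e_def)
  have "\<exists>d>0. \<forall>y\<in>S. dist y x < d \<longrightarrow> dist (pds [i, j] f y) (pds [i, j] f x) < e"
    "\<exists>d>0. \<forall>y\<in>S. dist y x < d \<longrightarrow> dist (pds [j, i] f y) (pds [j, i] f x) < e"
    using smooth_on_continuous[OF f] S e unfolding continuous_on_iff by blast+
  then obtain d1 d2 where d: "d1 > 0" "d2 > 0"
    "\<And>y. y \<in> S \<Longrightarrow> dist y x < d1 \<Longrightarrow> dist (pds [i, j] f y) (pds [i, j] f x) < e"
    "\<And>y. y \<in> S \<Longrightarrow> dist y x < d2 \<Longrightarrow> dist (pds [j, i] f y) (pds [j, i] f x) < e" by blast
  obtain r where r: "r > 0" "cball x r \<subseteq> S" using S open_contains_cball by blast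
  define h where "h = min r (min d1 d2) / 4"
  have h: "h > 0" "2*h < d1" "2*h < d2" "cball x (2*h) \<subseteq> S"
    using d r by (auto simp: h_def subset_iff)
  obtain z where z: "z \<in> cball x (2*h)" "f (x + h *\<^sub>R axis i 1 + h *\<^sub>R axis j 1) - f (x + h *\<^sub>R axis i 1)
    - f (x + h *\<^sub>R axis j 1) + f x = h * h * pds [j, i] f z"
    using mixed_difference[OF f h(1,4)] by blast
  obtain y where y: "y \<in> cball x (2*h)" "f (x + h *\<^sub>R axis j 1 + h *\<^sub>R axis i 1) - f (x + h *\<^sub>R axis j 1)
    - f (x + h *\<^sub>R axis i 1) + f x = h * h * pds [i, j] f y"
    using mixed_difference[OF f h(1,4)] by blast
  have "h * h * pds [j, i] f z = h * h * pds [i, j] f y"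
    using z(2) y(2) by (simp only: add_ac diff_diff_eq)
  then have "pds [j, i] f z = pds [i, j] f y" using h(1) by (metis less_irrefl mult_cancel_left mult_eq_0_iff)
  moreover have "dist (pds [j, i] f z) (pds [j, i] f x) < e" "dist (pds [i, j] f y) (pds [i, j] f x) < e"
    using d(3)[of y] d(4)[of z] z(1) y(1) h by (auto simp: dist_commute)
  ultimately show False unfolding e_def dist_real_def by (auto simp: abs_if split: if_splits)
qed

lemma pds_shift:
  fixes f :: "real^'n::finite \<Rightarrow> real"
  assumes f: "smooth_on f S" and S: "open S" "x \<in> S"
  shows "pds (i # js) f x = pds (js @ [i]) f x"
  using S(2)
proof (induction js arbitrary: x)
  case (Cons j js)
  have "pds (i # j # js) f x = pds [i, j] (pds js f) x" by simp
  also have "\<dots> = pds [j, i] (pds js f) x"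
    by (rule pds_swap[OF smooth_on_pds[OF f] S(1) Cons.prems])
  also have "\<dots> = pd j (pds (i # js) f) x" by simp
  also have "\<dots> = pd j (pds (js @ [i]) f) x" by (rule pd_cong[OF S(1) Cons.prems Cons.IH])
  finally show ?case by simp
qed simp

lemma pds_comm:
  fixes f :: "real^'n::finite \<Rightarrow> real"
  assumes f: "smooth_on f S" and S: "open S" "x \<in> S"
  shows "pds (is @ js) f x = pds (js @ is) f x"
  using S(2)
proof (induction "is" arbitrary: js x)
  case (Cons i "is")
  have "pds ((i # is) @ js) f x = pd i (pds (is @ js) f) x" by simp
  also have "\<dots> = pd i (pds (js @ is) f) x" by (rule pd_cong[OF S(1) Cons.prems Cons.IH])
  also have "\<dots> = pds (i # js) (pds is f) x" by (simp add: pds_append)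
  also have "\<dots> = pds (js @ [i]) (pds is f) x" by (rule pds_shift[OF smooth_on_pds[OF f] S(1) Cons.prems])
  finally show ?case by (simp add: pds_append)
qed simp

lemma pds_cong_mset:
  fixes f :: "real^'n::finite \<Rightarrow> real"
  assumes f: "smooth_on f S" and S: "open S" "x \<in> S" and m: "mset is = mset js"
  shows "pds is f x = pds js f x"
  using S(2) m
proof (induction "is" arbitrary: js x)
  case (Cons i "is")
  then have "i \<in> set js" by (metis list.set_intros(1) set_mset_mset)
  then obtain as bs where js: "js = as @ i # bs" by (meson split_list)
  have m: "mset is = mset (as @ bs)" using Cons.prems js by simp
  have "pds (i # is) f x = pd i (pds (as @ bs) f) x"
    using pd_cong[OF S(1) Cons.prems(1) Cons.IH[OF _ m]] by simp
  also have "\<dots> = pds (i # as) (pds bs f) x" by (simp add: pds_append)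
  also have "\<dots> = pds (as @ [i]) (pds bs f) x" by (rule pds_shift[OF smooth_on_pds[OF f] S(1) Cons.prems(1)])
  finally show ?case by (simp add: js pds_append)
qed simp

section \<open>Smooth cutoff functions\<close>

text \<open>With y = 1/t, the derivative of p(y) exp(-y) with respect to t is y^2 (p(y) - p'(y))
  exp(-y). Hence \<open>flat n\<close> is the n-th derivative of the classical function exp(-1/t)
  extended by 0.\<close>

fun flat_poly :: "nat \<Rightarrow> real poly" where
  "flat_poly 0 = 1"
| "flat_poly (Suc n) = [:0, 0, 1:] * (flat_poly n - pderiv (flat_poly n))"

definition flat :: "nat \<Rightarrow> real \<Rightarrow> real" where
  "flat n t = (if t > 0 then poly (flat_poly n) (1 / t) * exp (- (1 / t)) else 0)"

lemma poly_exp_tendsto_0: "((\<lambda>y::real. poly p y / exp y) \<longlongrightarrow> 0) at_top"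
proof -
  have "((\<lambda>y. \<Sum>i\<le>degree p. coeff p i * (y ^ i / exp y)) \<longlongrightarrow> (\<Sum>i\<le>degree p. coeff p i * 0)) at_top"
    by (intro tendsto_sum tendsto_mult tendsto_const tendsto_power_div_exp_0)
  then show ?thesis by (simp add: poly_altdef sum_divide_distrib)
qed

lemma flat_has_derivative: "(flat n has_real_derivative flat (Suc n) t) (at t)"
proof -
  consider "t > 0" | "t < 0" | "t = 0" by linarith
  then show ?thesis
  proof cases
    case 1
    have "((\<lambda>t. - (1 / t)) has_real_derivative (1 / t) * (1 / t)) (at t)"
      "((\<lambda>t. 1 / t) has_real_derivative - ((1 / t) * (1 / t))) (at t)"
      using 1 by (auto intro!: derivative_eq_intros)
    note d = DERIV_mult[OF DERIV_chain2[OF poly_DERIV[of "flat_poly n"] this(2)] DERIV_chain2[OF DERIV_exp this(1)]]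
    have "((\<lambda>t. poly (flat_poly n) (1 / t) * exp (- (1 / t))) has_real_derivative flat (Suc n) t) (at t)"
      by (rule DERIV_cong[OF d]) (use 1 in \<open>simp add: flat_def algebra_simps\<close>)
    then show ?thesis
      by (rule has_field_derivative_transform_within_open[where S="{0<..}"]) (use 1 in \<open>auto simp: flat_def\<close>)
  next
    case 2
    have "((\<lambda>t. 0) has_real_derivative flat (Suc n) t) (at t)" using 2 by (simp add: flat_def)
    then show ?thesis
      by (rule has_field_derivative_transform_within_open[where S="{..<0}"]) (use 2 in \<open>auto simp: flat_def\<close>)
  next
    case 3
    \<comment> \<open>The difference quotient at 0 is \<open>flat n h / h\<close>; in y = 1/h the
      division by h becomes the extra polynomial factor y.\<close>
    have "((\<lambda>y. poly ([:0, 1:] * flat_poly n) y / exp y) \<longlongrightarrow> 0) at_top" by (rule poly_exp_tendsto_0)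
    then have "((\<lambda>h. poly ([:0, 1:] * flat_poly n) (inverse h) / exp (inverse h)) \<longlongrightarrow> 0) (at_right 0)"
      by (rule filterlim_compose[OF _ filterlim_inverse_at_top_right])
    then have "((\<lambda>h. flat n h / h) \<longlongrightarrow> 0) (at_right 0)"
      by (rule Lim_transform_eventually)
        (auto simp: eventually_at_filter flat_def field_simps exp_minus)
    moreover have "((\<lambda>h. flat n h / h) \<longlongrightarrow> 0) (at_left 0)"
      by (rule Lim_transform_eventually[OF tendsto_const]) (auto simp: eventually_at_filter flat_def)
    ultimately have "((\<lambda>h. flat n h / h) \<longlongrightarrow> 0) (at 0)" by (rule filterlim_split_at[rotated])
    then show ?thesis using 3 by (simp add: DERIV_def flat_def)
  qed
qed

lemma flat_pos: "t > 0 \<Longrightarrow> flat 0 t > 0"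
  and flat_zero: "t \<le> 0 \<Longrightarrow> flat n t = 0"
  by (auto simp: flat_def)

lemma smooth_on_flat:
  fixes f :: "real^'n::finite \<Rightarrow> real"
  shows "open S \<Longrightarrow> smooth_on f S \<Longrightarrow> smooth_on (\<lambda>x. flat 0 (f x)) S"
  by (rule smooth_on_compose[where T=UNIV]) (auto intro: flat_has_derivative)

lemma smooth_on_inverse:
  fixes f :: "real^'n::finite \<Rightarrow> real"
  assumes "open S" "smooth_on f S" "\<And>x. x \<in> S \<Longrightarrow> f x \<noteq> 0"
  shows "smooth_on (\<lambda>x. inverse (f x)) S"
proof -
  have "smooth_on (\<lambda>x. (-1) ^ 0 * fact 0 * inverse (f x) ^ Suc 0) S"
  proof (rule smooth_on_compose[OF assms(1,2), where T="- {0}" and h="\<lambda>n t. (-1) ^ n * fact n * inverse t ^ Suc n"])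
    fix n and t :: real assume "t \<in> - {0}"
    then show "((\<lambda>t. (-1) ^ n * fact n * inverse t ^ Suc n) has_real_derivative
      (-1) ^ Suc n * fact (Suc n) * inverse t ^ Suc (Suc n)) (at t)"
      by (auto intro!: derivative_eq_intros simp: field_simps simp del: power_Suc) (simp add: field_simps)
  qed (use assms in auto)
  then show ?thesis by simp
qed

lemma smooth_on_dist_square: "smooth_on (\<lambda>x::real^'n::finite. (x - a) \<bullet> (x - a)) UNIV"
proof -
  have "smooth_on (\<lambda>x::real^'n. \<Sum>i\<in>UNIV. (x $ i + - (a $ i)) * (x $ i + - (a $ i))) UNIV"
    by (intro smooth_on_sum smooth_on_mult smooth_on_add smooth_on_coord smooth_on_const) auto
  then show ?thesis by (simp add: inner_vec_def)
qed

text \<open>The quotient \<open>\<psi>1 / (\<psi>1 + \<psi>2)\<close>, where \<open>\<psi>1\<close>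
  is positive exactly inside radius \<open>r\<close> and \<open>\<psi>2\<close> exactly outside
  radius \<open>r/2\<close>. The denominator never vanishes because these two regions cover the
  space.\<close>

lemma smooth_step:
  fixes a :: "real^'n::finite"
  assumes r: "r > 0"
  shows "\<exists>\<theta>::real^'n \<Rightarrow> real. smooth_on \<theta> UNIV \<and> (\<forall>x\<in>ball a (r/2). \<theta> x = 1) \<and> (\<forall>x. x \<notin> cball a r \<longrightarrow> \<theta> x = 0)"
proof -
  define \<psi>1 where "\<psi>1 = (\<lambda>x. flat 0 (r\<^sup>2 + - ((x - a) \<bullet> (x - a))))"
  define \<psi>2 where "\<psi>2 = (\<lambda>x. flat 0 ((x - a) \<bullet> (x - a) + - ((r/2)\<^sup>2)))"
  have sm: "smooth_on \<psi>1 UNIV" "smooth_on \<psi>2 UNIV" unfolding \<psi>1_def \<psi>2_def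
    by (intro smooth_on_flat smooth_on_add smooth_on_minus smooth_on_dist_square smooth_on_const; simp)+
  have nonneg: "flat 0 t \<ge> 0" for t by (simp add: flat_def)
  have pos: "\<psi>1 x + \<psi>2 x > 0" for x
  proof (cases "(x - a) \<bullet> (x - a) < r\<^sup>2")
    case True
    then show ?thesis using flat_pos[of "r\<^sup>2 + - ((x - a) \<bullet> (x - a))"] nonneg unfolding \<psi>1_def \<psi>2_def
      by (simp add: add_pos_nonneg)
  next
    case False
    moreover have "(r/2)\<^sup>2 < r\<^sup>2" using r by (simp add: power2_eq_square)
    ultimately show ?thesis using flat_pos[of "(x - a) \<bullet> (x - a) + - ((r/2)\<^sup>2)"] nonneg unfolding \<psi>1_def \<psi>2_def
      by (simp add: add_nonneg_pos)
  qed
  have d: "(x - a) \<bullet> (x - a) = (dist a x)\<^sup>2" for x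
    by (metis dist_commute dist_norm power2_norm_eq_inner)
  have "smooth_on (\<lambda>x. \<psi>1 x * inverse (\<psi>1 x + \<psi>2 x)) UNIV"
    by (intro smooth_on_mult smooth_on_inverse smooth_on_add sm) (use pos in \<open>auto simp: less_imp_neq[symmetric]\<close>)
  moreover have "\<psi>1 x * inverse (\<psi>1 x + \<psi>2 x) = 1" if "x \<in> ball a (r/2)" for x
  proof -
    have "(dist a x)\<^sup>2 \<le> (r/2)\<^sup>2" using that by (intro power_mono) auto
    then have "\<psi>2 x = 0" unfolding \<psi>2_def d by (intro flat_zero) auto
    then show ?thesis using pos[of x] by simp
  qed
  moreover have "\<psi>1 x * inverse (\<psi>1 x + \<psi>2 x) = 0" if "x \<notin> cball a r" for x
  proof -
    have "r\<^sup>2 \<le> (dist a x)\<^sup>2" using that r by (intro power_mono) auto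
    then show ?thesis unfolding \<psi>1_def d by (simp add: flat_zero)
  qed
  ultimately show ?thesis by blast
qed

text \<open>Finitely many steps around points of \<open>A\<close> are glued as 1 minus the product
  of \<open>1 - \<theta> a\<close>, which equals 1 wherever one step does. Being 1 on an open
  \<open>U\<close>, and not merely on \<open>A\<close>, preserves all derivatives on
  \<open>A\<close>.\<close>

lemma smooth_cutoff:
  fixes A :: "(real^'n::finite) set"
  assumes A: "compact A" and W: "open W" "A \<subseteq> W"
  obtains \<eta> U C where "smooth_on \<eta> UNIV" "compact C" "C \<subseteq> W" "\<And>x. x \<notin> C \<Longrightarrow> \<eta> x = (0::real)"
    "open U" "A \<subseteq> U" "\<And>x. x \<in> U \<Longrightarrow> \<eta> x = 1"
proof -
  have "\<exists>r>0. cball a r \<subseteq> W" if "a \<in> A" for a using W that open_contains_cball by blast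
  then obtain r where r: "\<And>a. a \<in> A \<Longrightarrow> r a > 0 \<and> cball a (r a) \<subseteq> W" by metis
  have "A \<subseteq> (\<Union>a\<in>A. ball a (r a / 2))" using r by force
  then obtain F where F: "F \<subseteq> A" "finite F" "A \<subseteq> (\<Union>a\<in>F. ball a (r a / 2))"
    using compactE_image[OF A, of A "\<lambda>a. ball a (r a / 2)"] by auto
  have "\<forall>a\<in>F. \<exists>\<theta>::real^'n \<Rightarrow> real. smooth_on \<theta> UNIV \<and> (\<forall>x\<in>ball a (r a/2). \<theta> x = 1) \<and> (\<forall>x. x \<notin> cball a (r a) \<longrightarrow> \<theta> x = 0)"
    using smooth_step r F by blast
  then obtain \<theta> where \<theta>: "\<And>a. a \<in> F \<Longrightarrow> smooth_on (\<theta> a) UNIV \<and> (\<forall>x\<in>ball a (r a/2). \<theta> a x = 1) \<and> (\<forall>x. x \<notin> cball a (r a) \<longrightarrow> \<theta> a x = (0::real))"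
    by metis
  have "smooth_on (\<lambda>x. \<Prod>a\<in>F. 1 + - \<theta> a x) UNIV"
    using F(2) \<theta>
  proof (induction F)
    case (insert a F)
    have "smooth_on (\<lambda>x. (1 + - \<theta> a x) * (\<Prod>a\<in>F. 1 + - \<theta> a x)) UNIV"
      by (intro smooth_on_mult smooth_on_add smooth_on_minus smooth_on_const insert.IH) (use insert.prems in auto)
    then show ?case using insert by simp
  qed (simp add: smooth_on_const)
  then have sm: "smooth_on (\<lambda>x. 1 + - (\<Prod>a\<in>F. 1 + - \<theta> a x)) UNIV"
    by (intro smooth_on_add smooth_on_minus smooth_on_const) auto
  show thesis
  proof (rule that[OF sm, of "\<Union>a\<in>F. cball a (r a)" "\<Union>a\<in>F. ball a (r a / 2)"])
    show "compact (\<Union>a\<in>F. cball a (r a))" using F by (intro compact_UN) auto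
    show "(\<Union>a\<in>F. cball a (r a)) \<subseteq> W" using r F by blast
    show "1 + - (\<Prod>a\<in>F. 1 + - \<theta> a x) = 0" if "x \<notin> (\<Union>a\<in>F. cball a (r a))" for x
      using \<theta> that by (subst prod.neutral) auto
    show "1 + - (\<Prod>a\<in>F. 1 + - \<theta> a x) = 1" if x: "x \<in> (\<Union>a\<in>F. ball a (r a / 2))" for x
    proof -
      have "\<exists>a\<in>F. 1 + - \<theta> a x = 0" using x \<theta> by fastforce
      then show ?thesis using F(2) by simp
    qed
  qed (use F in auto)
qed

text \<open>\<open>f\<close> may be arbitrary outside \<open>W\<close>: the product is smooth on
  \<open>W\<close> and zero on the complement of \<open>C\<close>, and these two open sets cover the
  space.\<close>

lemma smooth_on_cutoff_mult:
  fixes f :: "real^'n::finite \<Rightarrow> real"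
  assumes "open W" "smooth_on f W" "smooth_on \<eta> UNIV" "closed C" "C \<subseteq> W" "\<And>x. x \<notin> C \<Longrightarrow> \<eta> x = 0"
  shows "smooth_on (\<lambda>x. \<eta> x * f x) UNIV"
proof -
  have "smooth_on (\<lambda>x. \<eta> x * f x) W"
    by (intro smooth_on_mult smooth_on_subset[OF assms(3)] assms) auto
  moreover have "smooth_on (\<lambda>x. \<eta> x * f x) (- C)"
    by (rule smooth_on_cong[OF _ _ smooth_on_const[of _ 0]]) (use assms in auto)
  ultimately have "smooth_on (\<lambda>x. \<eta> x * f x) (W \<union> - C)"
    using assms by (intro smooth_on_Un) auto
  moreover have "W \<union> - C = UNIV" using assms by auto
  ultimately show ?thesis by simp
qed

lemma smooth_compact_supportI:
  assumes "smooth_on f UNIV" "compact C" "\<And>x. x \<notin> C \<Longrightarrow> f x = 0"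
  shows "smooth_compact_support f"
proof -
  have "closure {x. f x \<noteq> 0} \<subseteq> C"
    by (rule closure_minimal) (use assms compact_imp_closed in auto)
  then have "compact (closure {x. f x \<noteq> 0})"
    using assms(2) by (meson bounded_subset compact_eq_bounded_closed closed_closure)
  then show ?thesis using assms by (simp add: smooth_compact_support_def)
qed

lemma smooth_compact_supportE:
  assumes "smooth_compact_support f"
  obtains C where "smooth_on f UNIV" "compact C" "\<And>x. x \<notin> C \<Longrightarrow> f x = 0"
  using assms unfolding smooth_compact_support_def
  by (metis (mono_tags, lifting) closure_subset mem_Collect_eq subsetD)

lemma pds_eq_0:
  assumes "open S" "x \<in> S" "\<And>y. y \<in> S \<Longrightarrow> f y = 0"
  shows "pds js f x = 0"
  using pds_cong[OF assms(1,2), of f "\<lambda>_. 0"] assms(3) by simp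

lemma pds_support:
  assumes "compact C" "\<And>x. x \<notin> C \<Longrightarrow> f x = 0" "x \<notin> C"
  shows "pds js f x = 0"
  by (rule pds_eq_0[of "- C"]) (use assms compact_imp_closed in auto)

section \<open>Integration by parts against compactly supported functions\<close>

lemma lborel_affine_integral:
  fixes f :: "'a::euclidean_space \<Rightarrow> real"
  assumes [measurable]: "f \<in> borel_measurable borel" and c: "c \<noteq> 0"
  shows "(LINT x|lborel. f x) = \<bar>c\<bar> ^ DIM('a) * (LINT x|lborel. f (t + c *\<^sub>R x))"
  by (subst lborel_affine[OF c, of t])
    (simp add: integral_density integral_distr)

lemma integrable_compact_support:
  fixes f :: "'a::euclidean_space \<Rightarrow> real"
  assumes "continuous_on UNIV f" "compact C" "\<And>x. x \<notin> C \<Longrightarrow> f x = 0"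
  shows "integrable lborel f"
proof -
  have "integrable lborel (\<lambda>x. indicator C x *\<^sub>R f x)"
    using borel_integrable_compact[OF assms(2)] assms(1) continuous_on_subset by blast
  also have "(\<lambda>x. indicator C x *\<^sub>R f x) = f" using assms(3) by (auto simp: indicator_def fun_eq_iff)
  finally show ?thesis .
qed

lemma scs_integrable:
  fixes f :: "real^'n::finite \<Rightarrow> real"
  assumes "smooth_compact_support f"
  shows "integrable lborel f"
  using assms by (elim smooth_compact_supportE) (auto intro: integrable_compact_support smooth_on_continuous0)

lemma scs_smooth: "smooth_compact_support f \<Longrightarrow> smooth_on f UNIV"
  by (simp add: smooth_compact_support_def)

lemma scs_pds: "smooth_compact_support f \<Longrightarrow> smooth_compact_support (pds js f)"
  by (elim smooth_compact_supportE) (auto intro: smooth_compact_supportI smooth_on_pds pds_support)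

lemma scs_sum:
  assumes "finite I" "\<And>i. i \<in> I \<Longrightarrow> smooth_compact_support (f i)"
  shows "smooth_compact_support (\<lambda>x. \<Sum>i\<in>I. f i x)"
proof -
  have "\<forall>i\<in>I. \<exists>C. compact C \<and> (\<forall>x. x \<notin> C \<longrightarrow> f i x = 0)"
    using assms(2) smooth_compact_supportE by metis
  then obtain C where C: "\<And>i. i \<in> I \<Longrightarrow> compact (C i) \<and> (\<forall>x. x \<notin> C i \<longrightarrow> f i x = 0)" by metis
  show ?thesis
  proof (rule smooth_compact_supportI[where C="\<Union>i\<in>I. C i"])
    show "smooth_on (\<lambda>x. \<Sum>i\<in>I. f i x) UNIV" by (intro smooth_on_sum assms scs_smooth) auto
    show "compact (\<Union>i\<in>I. C i)" using C assms(1) by (intro compact_UN) auto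
  qed (use C in \<open>auto intro!: sum.neutral\<close>)
qed

lemma scs_add:
  assumes "smooth_compact_support f" "smooth_compact_support g"
  shows "smooth_compact_support (\<lambda>x. f x + g x)"
proof -
  obtain C where "compact C" "\<And>x. x \<notin> C \<Longrightarrow> f x = 0" using assms(1) by (metis smooth_compact_supportE)
  moreover obtain D where "compact D" "\<And>x. x \<notin> D \<Longrightarrow> g x = 0" using assms(2) by (metis smooth_compact_supportE)
  ultimately show ?thesis using assms
    by (intro smooth_compact_supportI[where C="C \<union> D"]) (auto intro: smooth_on_add scs_smooth)
qed

lemma scs_cmult:
  fixes f :: "real^'n::finite \<Rightarrow> real"
  assumes "smooth_compact_support f"
  shows "smooth_compact_support (\<lambda>x. c * f x)"
proof -
  obtain C where C: "smooth_on f UNIV" "compact C" "\<And>x. x \<notin> C \<Longrightarrow> f x = 0"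
    using assms by (metis smooth_compact_supportE)
  show ?thesis
    by (rule smooth_compact_supportI[OF smooth_on_cmult[OF open_UNIV C(1)] C(2)]) (simp add: C(3))
qed

text \<open>Difference quotients have integral 0 by translation invariance of Lebesgue measure;
  dominated convergence carries this to the derivative.\<close>

lemma integral_pd_zero:
  fixes f :: "real^'n::finite \<Rightarrow> real"
  assumes "smooth_compact_support f"
  shows "(LINT x|lborel. pd i f x) = 0"
proof -
  obtain C where f: "smooth_on f UNIV" and C: "compact C" "\<And>x. x \<notin> C \<Longrightarrow> f x = 0"
    using assms by (metis smooth_compact_supportE)
  let ?e = "axis i (1::real)"
  \<comment> \<open>All points from which a step of length at most 1 in direction \<open>i\<close>
    can reach \<open>C\<close>: one compact set that carries every difference quotient
    \<open>s n\<close>.\<close>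
  define D where "D = (\<lambda>(x, t). x - t *\<^sub>R ?e) ` (C \<times> {0..1::real})"
  have D: "compact D" unfolding D_def
    by (intro compact_continuous_image compact_Times C) (auto intro!: continuous_intros simp: case_prod_unfold)
  have out: "f (x + t *\<^sub>R ?e) = 0" if "x \<notin> D" "0 \<le> t" "t \<le> 1" for x t
  proof (rule C(2), rule notI)
    assume "x + t *\<^sub>R ?e \<in> C"
    then have "x \<in> D" unfolding D_def using that by (intro image_eqI[where x="(x + t *\<^sub>R ?e, t)"]) auto
    then show False using that by simp
  qed
  have cont: "continuous_on UNIV f" "continuous_on UNIV (pds [i] f)"
    using smooth_on_continuous[OF f, of "[]"] smooth_on_continuous[OF f, of "[i]"] by auto
  have meas: "f \<in> borel_measurable borel" "pd i f \<in> borel_measurable borel"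
    using cont by (auto intro: borel_measurable_continuous_onI)
  have supp: "pds [i] f x = 0" if "x \<notin> C" for x using pds_support[OF C that] .
  obtain M where M: "\<And>x. \<bar>pd i f x\<bar> \<le> M"
  proof -
    have "bounded (pds [i] f ` C)"
      by (intro compact_imp_bounded compact_continuous_image C continuous_on_subset[OF cont(2)]) auto
    then obtain M where "M > 0" "\<And>x. x \<in> C \<Longrightarrow> \<bar>pd i f x\<bar> \<le> M"
      unfolding bounded_pos by auto
    then show thesis using supp that[of M] by (metis abs_zero less_imp_le pds.simps)
  qed
  define s where "s = (\<lambda>n x. (f (x + (1 / Suc n) *\<^sub>R ?e) - f x) / (1 / Suc n))"
  have int_f: "integrable lborel f" by (rule scs_integrable[OF assms])
  have shift: "(LINT x|lborel. f (x + v)) = (LINT x|lborel. f x)" "integrable lborel (\<lambda>x. f (x + v))" for v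
  proof -
    show "(LINT x|lborel. f (x + v)) = (LINT x|lborel. f x)"
      using lborel_affine_integral[OF meas(1), of 1 v] by (simp add: add.commute)
    have "compact ((\<lambda>x. x - v) ` C)" by (intro compact_continuous_image C continuous_intros)
    moreover have "f (x + v) = 0" if "x \<notin> (\<lambda>x. x - v) ` C" for x
      using that by (intro C(2)) (auto simp: image_iff algebra_simps)
    moreover have "continuous_on UNIV (\<lambda>x. f (x + v))"
      by (rule continuous_on_compose2[OF cont(1)]) (auto intro!: continuous_intros)
    ultimately show "integrable lborel (\<lambda>x. f (x + v))" by (rule integrable_compact_support[rotated])
  qed
  have "(\<lambda>n. LINT x|lborel. s n x) \<longlonglongrightarrow> (LINT x|lborel. pd i f x)"
  proof (rule integral_dominated_convergence[where w="\<lambda>x. M * indicator D x"])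
    show "pd i f \<in> borel_measurable lborel" using meas by simp
    show "s n \<in> borel_measurable lborel" for n unfolding s_def using meas by measurable
    show "integrable lborel (\<lambda>x. M * indicator D x)"
      using D by (intro integrable_mult_right integrable_real_indicator)
        (use emeasure_compact_finite[OF D] in \<open>auto simp: compact_imp_closed borel_closed\<close>)
    show "AE x in lborel. (\<lambda>n. s n x) \<longlonglongrightarrow> pd i f x"
    proof (rule AE_I2)
      fix x
      have "((\<lambda>t. f (x + t *\<^sub>R ?e)) has_real_derivative pd i f x) (at 0)"
        using line_has_real_derivative[OF f, of x 0 i "[]"] by simp
      then have "((\<lambda>h. (f (x + h *\<^sub>R ?e) - f x) / h) \<longlongrightarrow> pd i f x) (at 0)"
        by (simp add: DERIV_def)
      moreover have "filterlim (\<lambda>n. 1 / real (Suc n)) (at 0) sequentially"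
        by (rule filterlim_atI) (auto intro: lim_1_over_real_power[of 1, simplified] LIMSEQ_Suc simp del: of_nat_Suc)
      ultimately show "(\<lambda>n. s n x) \<longlonglongrightarrow> pd i f x"
        unfolding s_def by (rule filterlim_compose)
    qed
    show "AE x in lborel. norm (s n x) \<le> M * indicator D x" for n
    proof (rule AE_I2)
      fix x
      let ?h = "1 / real (Suc n)"
      have h: "0 < ?h" "?h \<le> 1" by auto
      \<comment> \<open>The mean value theorem bounds every quotient by the bound \<open>M\<close>
        of the derivative, which gives the majorant.\<close>
      have "\<exists>t>0. t < ?h \<and> f (x + ?h *\<^sub>R ?e) - f (x + 0 *\<^sub>R ?e) = (?h - 0) * pds [i] f (x + t *\<^sub>R ?e)"
        by (rule MVT2[OF h(1)]) (use line_has_real_derivative[OF f, of _ _ _ "[]"] in auto)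
      then obtain t where t: "f (x + ?h *\<^sub>R ?e) - f x = ?h * pd i f (x + t *\<^sub>R ?e)" by auto
      have "s n x = pd i f (x + t *\<^sub>R ?e)" unfolding s_def t using h by simp
      then have "\<bar>s n x\<bar> \<le> M" using M by simp
      moreover have "s n x = 0" if "x \<notin> D"
        using out[OF that, of ?h] out[OF that, of 0] h unfolding s_def by simp
      ultimately show "norm (s n x) \<le> M * indicator D x" by (cases "x \<in> D") auto
    qed
  qed
  moreover have "(LINT x|lborel. s n x) = 0" for n
    unfolding s_def by (simp add: shift int_f del: of_nat_Suc)
  ultimately show ?thesis by (simp add: LIMSEQ_const_iff)
qed

lemma has_pd_reflect:
  assumes "has_pd i f d (a - x)"
  shows "has_pd i (\<lambda>y. f (a - y)) (- d) x"
proof -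
  have "((\<lambda>t. f (a - x + t *\<^sub>R axis i 1)) has_vector_derivative d) (at (- 0))"
    using assms by (simp add: has_pd_def)
  moreover have "((\<lambda>t::real. - t) has_vector_derivative -1) (at 0)" by (auto intro!: derivative_eq_intros)
  ultimately have "((\<lambda>t. f (a - x + t *\<^sub>R axis i 1)) \<circ> (\<lambda>t. - t) has_vector_derivative (-1) *\<^sub>R d) (at 0)"
    by (intro vector_diff_chain_at) auto
  moreover have "((\<lambda>t. f (a - x + t *\<^sub>R axis i 1)) \<circ> (\<lambda>t. - t)) = (\<lambda>t. f (a - (x + t *\<^sub>R axis i 1)))"
    by (auto simp: fun_eq_iff algebra_simps)
  ultimately show ?thesis by (simp add: has_pd_def)
qed

lemma open_reflect:
  fixes S :: "'a::real_normed_vector set"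
  assumes "open S"
  shows "open {y. a - y \<in> S}"
  using open_vimage[OF assms, of "\<lambda>y. a - y"] by (simp add: vimage_def continuous_intros)

lemma smooth_on_reflect:
  fixes f :: "real^'n::finite \<Rightarrow> real"
  assumes f: "smooth_on f S" and S: "open S"
  shows "smooth_on (\<lambda>y. f (a - y)) {y. a - y \<in> S}"
proof -
  let ?F = "\<lambda>js y. (-1) ^ length js * pds js f (a - y)"
  have "continuous_on {y. a - y \<in> S} (\<lambda>y. pds js f (a - y))" for js
    by (rule continuous_on_compose2[OF smooth_on_continuous[OF f]]) (auto intro!: continuous_intros)
  then have 1: "continuous_on {y. a - y \<in> S} (?F js)" for js by (intro continuous_intros)
  have "has_pd i (?F js) (?F (i # js) x) x" if "x \<in> {y. a - y \<in> S}" for i js x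
  proof -
    have "has_pd i (pds js f) (pds (i # js) f (a - x)) (a - x)" using smooth_on_has_pd[OF f] that by blast
    from has_pd_linear[OF bounded_linear_mult_right has_pd_reflect[OF this], of "(-1) ^ length js"]
    show ?thesis by simp
  qed
  from smooth_on_table(1)[where F="?F", OF open_reflect[OF S] 1 this]
  show ?thesis by simp
qed

text \<open>A possible singularity of \<open>F\<close> is harmless as long as \<open>x - y\<close>
  stays in its domain of smoothness for all \<open>y\<close> in the support of
  \<open>g\<close>.\<close>

lemma scs_reflect_mult:
  fixes F g :: "real^'n::finite \<Rightarrow> real"
  assumes F: "smooth_on F S" "open S" and g: "smooth_on g UNIV"
    and C: "compact C" "\<And>y. y \<notin> C \<Longrightarrow> g y = 0" "\<And>y. y \<in> C \<Longrightarrow> x - y \<in> S"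
  shows "smooth_compact_support (\<lambda>y. F (x - y) * g y)"
proof -
  have "smooth_on (\<lambda>y. g y * F (x - y)) UNIV"
    by (rule smooth_on_cutoff_mult[OF open_reflect[OF F(2)] smooth_on_reflect[OF F] g, of C])
      (use C compact_imp_closed in auto)
  then show ?thesis
    by (intro smooth_compact_supportI[where C=C]) (use C in \<open>auto simp: mult.commute\<close>)
qed

text \<open>No sign appears: the minus of integration by parts cancels against the minus from
  differentiating \<open>F (x - y)\<close> in \<open>y\<close>.\<close>

lemma integration_by_parts_pd:
  fixes F g :: "real^'n::finite \<Rightarrow> real"
  assumes F: "smooth_on F S" "open S" and g: "smooth_on g UNIV"
    and C: "compact C" "\<And>y. y \<notin> C \<Longrightarrow> g y = 0" "\<And>y. y \<in> C \<Longrightarrow> x - y \<in> S"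
  shows "(LINT y|lborel. F (x - y) * pd i g y) = (LINT y|lborel. pd i F (x - y) * g y)"
proof -
  note scs = scs_reflect_mult[where x=x]
  have g': "smooth_on (pd i g) UNIV" "\<And>y. y \<notin> C \<Longrightarrow> pd i g y = 0"
    using smooth_on_pds[OF g, of "[i]"] pds_support[OF C(1,2), where js="[i]"] by auto
  have F': "smooth_on (pd i F) S" using smooth_on_pds[OF F(1), of "[i]"] by simp
  have eq: "pd i (\<lambda>y. F (x - y) * g y) y = F (x - y) * pd i g y - pd i F (x - y) * g y" for y
  proof (cases "y \<in> C")
    case True
    have "has_pd i F (pd i F (x - y)) (x - y)"
      using smooth_on_has_pd[OF F(1), of "x - y" i "[]"] C(3)[OF True] by simp
    from has_pd_mult[OF has_pd_reflect[OF this] smooth_on_has_pd[OF g, of y i "[]", unfolded pds.simps, OF UNIV_I]]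
    have "has_pd i (\<lambda>y. F (x - y) * g y) (F (x - y) * pd i g y + - pd i F (x - y) * g y) y" by simp
    then show ?thesis using has_pd_imp_pd by fastforce
  next
    case False
    then show ?thesis using pds_support[of C "\<lambda>y. F (x - y) * g y" y "[i]", OF C(1)] C(2) g'(2) by simp
  qed
  have "0 = (LINT y|lborel. pd i (\<lambda>y. F (x - y) * g y) y)"
    using integral_pd_zero[OF scs[OF F g C]] by simp
  also have "\<dots> = (LINT y|lborel. F (x - y) * pd i g y) - (LINT y|lborel. pd i F (x - y) * g y)"
    unfolding eq
    by (rule Bochner_Integration.integral_diff)
      (rule scs_integrable[OF scs[OF F g'(1) C(1) g'(2) C(3)]] scs_integrable[OF scs[OF F' F(2) g C]]; assumption)+
  finally show ?thesis by simp
qed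

lemma integration_by_parts_pds:
  fixes F g :: "real^'n::finite \<Rightarrow> real"
  assumes F: "smooth_on F S" and S: "open S" and g: "smooth_on g UNIV"
    and C: "compact C" "\<And>y. y \<notin> C \<Longrightarrow> g y = 0" "\<And>y. y \<in> C \<Longrightarrow> x - y \<in> S"
  shows "(LINT y|lborel. F (x - y) * pds js g y) = (LINT y|lborel. pds js F (x - y) * g y)"
  using F
proof (induction js arbitrary: F)
  case (Cons i js)
  have "(LINT y|lborel. F (x - y) * pds (i # js) g y) = (LINT y|lborel. pd i F (x - y) * pds js g y)"
    using integration_by_parts_pd[OF Cons.prems S smooth_on_pds[OF g] C(1) pds_support[OF C(1,2)] C(3)] by simp
  also have "\<dots> = (LINT y|lborel. pds js (pd i F) (x - y) * g y)"
    using Cons.IH[of "pd i F"] smooth_on_pds[OF Cons.prems, of "[i]"] by simp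
  \<comment> \<open>Derivatives leave \<open>g\<close> outermost first and land on \<open>F\<close>
    innermost first, so their order has to be restored by symmetry.\<close>
  also have "\<dots> = (LINT y|lborel. pds (i # js) F (x - y) * g y)"
  proof (rule Bochner_Integration.integral_cong[OF refl])
    fix y
    show "pds js (pd i F) (x - y) * g y = pds (i # js) F (x - y) * g y"
      using pds_shift[OF Cons.prems S, of "x - y" i js] C(2,3) by (cases "y \<in> C") (auto simp: pds_append)
  qed
  finally show ?case .
qed simp

lemma smooth_on_laplacian: "open S \<Longrightarrow> smooth_on f S \<Longrightarrow> smooth_on (laplacian f) S"
  unfolding laplacian_def[abs_def] by (intro smooth_on_sum smooth_on_pds) auto

lemma scs_laplacian: "smooth_compact_support f \<Longrightarrow> smooth_compact_support (laplacian f)"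
  unfolding laplacian_def[abs_def] by (intro scs_sum scs_pds) auto

lemma integration_by_parts_laplacian:
  fixes F g :: "real^'n::finite \<Rightarrow> real"
  assumes F: "smooth_on F UNIV" and g: "smooth_compact_support g"
  shows "(LINT y|lborel. F (x - y) * laplacian g y) = (LINT y|lborel. laplacian F (x - y) * g y)"
proof -
  obtain C where C: "smooth_on g UNIV" "compact C" "\<And>x. x \<notin> C \<Longrightarrow> g x = 0"
    using g by (metis smooth_compact_supportE)
  have i1: "integrable lborel (\<lambda>y. F (x - y) * pds [j, j] g y)" for j
    by (rule scs_integrable[OF scs_reflect_mult[OF F open_UNIV smooth_on_pds[OF C(1)] C(2) pds_support[OF C(2,3)]]]) auto
  have i2: "integrable lborel (\<lambda>y. pds [j, j] F (x - y) * g y)" for j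
    by (rule scs_integrable[OF scs_reflect_mult[OF smooth_on_pds[OF F] open_UNIV C]]) auto
  show ?thesis
    unfolding laplacian_def sum_distrib_left sum_distrib_right
    by (simp add: Bochner_Integration.integral_sum[OF i1] Bochner_Integration.integral_sum[OF i2]
        integration_by_parts_pds[OF F open_UNIV C] del: pds.simps)
qed

section \<open>A biharmonic fundamental solution and its regularisation\<close>

text \<open>With \<open>a > 0\<close> these functions are smooth everywhere, with \<open>a = 0\<close> away from the origin.\<close>

inductive radial :: "real \<Rightarrow> (real^'n::finite \<Rightarrow> real) \<Rightarrow> bool" for a where
  const: "radial a (\<lambda>z. c)"
| coord: "radial a (\<lambda>z. z $ i)"
| powr: "radial a (\<lambda>z. (z \<bullet> z + a) powr b)"
| ln: "radial a (\<lambda>z. ln (z \<bullet> z + a))"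
| add: "radial a f \<Longrightarrow> radial a g \<Longrightarrow> radial a (\<lambda>z. f z + g z)"
| mult: "radial a f \<Longrightarrow> radial a g \<Longrightarrow> radial a (\<lambda>z. f z * g z)"

definition radial_dom :: "real \<Rightarrow> (real^'n::finite) set" where
  "radial_dom a = {z. z \<bullet> z + a > 0}"

lemma open_radial_dom: "open (radial_dom a)"
  unfolding radial_dom_def by (intro open_Collect_less continuous_intros)

lemma radial_dom_pos: "a > 0 \<Longrightarrow> radial_dom a = UNIV"
  by (auto simp: radial_dom_def add_nonneg_pos)

lemma radial_dom_0: "radial_dom 0 = - {0}"
  by (auto simp: radial_dom_def)

lemma has_pd_square: "has_pd i (\<lambda>z. z \<bullet> z + a) (2 * z $ i) (z::real^'n::finite)"
proof -
  have "((\<lambda>t. (z + t *\<^sub>R axis i 1) \<bullet> (z + t *\<^sub>R axis i 1) + a) has_real_derivative 2 * z $ i) (at 0)"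
    by (auto simp: inner_simps inner_axis inner_axis' intro!: derivative_eq_intros)
  then show ?thesis by (simp add: has_pd_def has_real_derivative_iff_has_vector_derivative)
qed

lemma has_pd_powr:
  assumes "z \<in> radial_dom a"
  shows "has_pd i (\<lambda>z. (z \<bullet> z + a) powr b) (2 * b * (z $ i * (z \<bullet> z + a) powr (b - 1))) z"
proof -
  have "((\<lambda>t. t powr b) has_real_derivative b * (z \<bullet> z + a) powr (b - 1)) (at (z \<bullet> z + a))"
    using assms by (auto simp: radial_dom_def intro!: has_real_derivative_powr)
  from has_pd_compose[OF has_pd_square this, of i] show ?thesis by (simp add: ac_simps)
qed

lemma has_pd_ln:
  assumes "z \<in> radial_dom a"
  shows "has_pd i (\<lambda>z. ln (z \<bullet> z + a)) (2 * (z $ i * (z \<bullet> z + a) powr (- 1))) z"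
proof -
  have "(ln has_real_derivative inverse (z \<bullet> z + a)) (at (z \<bullet> z + a))"
    using assms by (auto simp: radial_dom_def intro!: DERIV_ln)
  from has_pd_compose[OF has_pd_square this, of i] show ?thesis
    using assms by (simp add: ac_simps powr_minus radial_dom_def)
qed

lemma radial_continuous: "radial a f \<Longrightarrow> continuous_on (radial_dom a) f"
  by (induction rule: radial.induct)
    (auto intro!: continuous_intros simp: radial_dom_def)

text \<open>Arbitrary real exponents are what closes the class: differentiation lowers an exponent
  by 1 and turns the logarithm into a power.\<close>

lemma radial_has_pd: "radial a f \<Longrightarrow> \<exists>f'. radial a f' \<and> (\<forall>z\<in>radial_dom a. has_pd i f (f' z) z)"
proof (induction rule: radial.induct)
  case (const c)
  then show ?case using radial.const[of a 0] has_pd_const by blast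
next
  case (coord j)
  then show ?case using radial.const[of a "if i = j then 1 else 0"] has_pd_coord by blast
next
  case (powr b)
  have "radial a (\<lambda>z. 2 * b * (z $ i * (z \<bullet> z + a) powr (b - 1)))"
    by (rule radial.mult[OF radial.const radial.mult[OF radial.coord radial.powr]])
  then show ?case using has_pd_powr by blast
next
  case ln
  have "radial a (\<lambda>z. 2 * (z $ i * (z \<bullet> z + a) powr (- 1)))"
    by (rule radial.mult[OF radial.const radial.mult[OF radial.coord radial.powr]])
  then show ?case using has_pd_ln by blast
next
  case (add f g)
  then obtain f' g' where fg: "radial a f'" "radial a g'"
    "\<forall>z\<in>radial_dom a. has_pd i f (f' z) z" "\<forall>z\<in>radial_dom a. has_pd i g (g' z) z" by blast
  show ?case
    by (rule exI[where x="\<lambda>z. f' z + g' z"]) (use fg in \<open>auto intro: radial.add has_pd_add\<close>)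
next
  case (mult f g)
  then obtain f' g' where fg: "radial a f'" "radial a g'"
    "\<forall>z\<in>radial_dom a. has_pd i f (f' z) z" "\<forall>z\<in>radial_dom a. has_pd i g (g' z) z" by blast
  show ?case
    by (rule exI[where x="\<lambda>z. f z * g' z + f' z * g z"])
      (use fg mult.hyps in \<open>auto intro: radial.add radial.mult has_pd_mult\<close>)
qed

lemma radial_smooth_on:
  assumes "radial a f"
  shows "smooth_on f (radial_dom a)"
  by (rule smooth_on_coinduct[OF open_radial_dom, where C="Collect (radial a)"])
    (use assms radial_continuous radial_has_pd in auto)

text \<open>Brings every derivative of a member back into the class, so that facts proved by
  induction on the class, in particular the expansion along lines, hold for all derivatives.\<close>

lemma radial_pds:
  assumes "radial a f"
  shows "\<exists>g. radial a g \<and> (\<forall>z\<in>radial_dom a. pds js f z = g z)"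
proof (induction js)
  case (Cons i js)
  then obtain g where g: "radial a g" "\<forall>z\<in>radial_dom a. pds js f z = g z" by blast
  obtain g' where g': "radial a g'" "\<forall>z\<in>radial_dom a. has_pd i g (g' z) z" using radial_has_pd[OF g(1)] by blast
  have "pds (i # js) f z = g' z" if "z \<in> radial_dom a" for z
    using pd_cong[OF open_radial_dom that, of "pds js f" g i] g(2) g'(2) that has_pd_imp_pd[of i g "g' z" z] by auto
  then show ?case using g' by blast
qed (use assms in auto)

section \<open>Laplacians of powers and logarithms of |z|^2 + a\<close>

lemma laplacian_cong:
  assumes "open S" "x \<in> S" "\<And>y. y \<in> S \<Longrightarrow> f y = g y"
  shows "laplacian f x = laplacian g x"
  unfolding laplacian_def using pds_cong[of S x f g, OF assms] by (simp del: pds.simps)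

lemma laplacian_add:
  assumes "open S" "smooth_on f S" "smooth_on g S" "x \<in> S"
  shows "laplacian (\<lambda>y. f y + g y) x = laplacian f x + laplacian g x"
  unfolding laplacian_def using pds_add[OF assms(1-3,4)] by (simp add: sum.distrib del: pds.simps)

lemma laplacian_cmult:
  assumes "open S" "smooth_on f S" "x \<in> S"
  shows "laplacian (\<lambda>y. c * f y) x = c * laplacian f x"
  unfolding laplacian_def using pds_cmult[OF assms(1,2,3)] by (simp add: sum_distrib_left del: pds.simps)

lemma laplacian_const: "laplacian (\<lambda>y. c) x = 0"
  unfolding laplacian_def using has_pd_imp_pd[OF has_pd_const]
  by (simp add: has_pd_imp_pd[OF has_pd_const] fun_eq_iff cong: sum.cong) (simp add: pd_def)

lemma laplacianI:
  assumes S: "open S" "x \<in> S" and 1: "\<And>i y. y \<in> S \<Longrightarrow> has_pd i f (f' i y) y"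
    and 2: "\<And>i. has_pd i (f' i) (f'' i) x"
  shows "laplacian f x = (\<Sum>i\<in>UNIV. f'' i)"
proof -
  have "pds [i, i] f x = f'' i" for i
    using pd_cong[OF S, of "pd i f" "f' i" i] has_pd_imp_pd[OF 1] has_pd_imp_pd[OF 2] by auto
  then show ?thesis unfolding laplacian_def by (simp del: pds.simps)
qed

lemma sum_coord_square: "(\<Sum>i\<in>UNIV. z $ i * z $ i) = (z::real^'n::finite) \<bullet> z"
  by (simp add: inner_vec_def)

text \<open>The summand, including the factor 1, is exactly what the product rule leaves behind for
  the second derivative of a radial function.\<close>

lemma sum_radial:
  fixes z :: "real^'n::finite"
  shows "(\<Sum>i\<in>UNIV. k * (z $ i * (l * (z $ i * P)) + 1 * Q)) = k * l * (z \<bullet> z) * P + k * CARD('n) * Q"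
proof -
  have "k * (z $ i * (l * (z $ i * P)) + 1 * Q) = k * l * P * (z $ i * z $ i) + k * Q" for i
    by (simp add: algebra_simps)
  then show ?thesis by (simp add: sum.distrib sum_distrib_left[symmetric] sum_coord_square)
qed

text \<open>With q = |z|^2 + a the direct computation leaves |z|^2 times
  \<open>q powr (b - 2)\<close>; writing |z|^2 = q - a splits it into the homogeneous term and a
  correction proportional to \<open>a\<close>.\<close>

lemma laplacian_powr:
  fixes z :: "real^'n::finite" and b :: real
  assumes z: "z \<in> radial_dom a"
  shows "laplacian (\<lambda>z. (z \<bullet> z + a) powr b) z =
    2 * b * (CARD('n) + 2 * b - 2) * (z \<bullet> z + a) powr (b - 1) - 4 * b * (b - 1) * a * (z \<bullet> z + a) powr (b - 2)"
proof -
  define q where "q = z \<bullet> z + a"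
  have q: "q > 0" using z by (simp add: q_def radial_dom_def)
  have "laplacian (\<lambda>z. (z \<bullet> z + a) powr b) z = (\<Sum>i\<in>UNIV. 2 * b * (z $ i * (2 * (b - 1) * (z $ i * (z \<bullet> z + a) powr (b - 1 - 1))) + 1 * (z \<bullet> z + a) powr (b - 1)))"
  proof (rule laplacianI[OF open_radial_dom z has_pd_powr])
    fix i
    show "has_pd i (\<lambda>z. 2 * b * (z $ i * (z \<bullet> z + a) powr (b - 1)))
      (2 * b * (z $ i * (2 * (b - 1) * (z $ i * (z \<bullet> z + a) powr (b - 1 - 1))) + 1 * (z \<bullet> z + a) powr (b - 1))) z"
      using has_pd_linear[OF bounded_linear_mult_right has_pd_mult[OF has_pd_coord has_pd_powr[OF z]], of i "2 * b" i "b - 1"]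
      by simp
  qed
  also have "\<dots> = 4 * b * (b - 1) * (\<Sum>i\<in>UNIV. z $ i * z $ i) * q powr (b - 2) + 2 * b * CARD('n) * q powr (b - 1)"
    unfolding sum_radial by (simp add: sum_coord_square q_def algebra_simps)
  also have "(\<Sum>i\<in>UNIV. z $ i * z $ i) = q - a" by (simp add: sum_coord_square q_def)
  also have "4 * b * (b - 1) * (q - a) * q powr (b - 2) = 4 * b * (b - 1) * q powr (b - 1) - 4 * b * (b - 1) * a * q powr (b - 2)"
  proof -
    have "q powr (b - 1) = q powr (1 + (b - 2))" by (rule arg_cong[where f="\<lambda>t. q powr t"]) simp
    then have "q powr (b - 1) = q * q powr (b - 2)" using q by (simp only: powr_add powr_one)
    then show ?thesis by (simp add: algebra_simps)
  qed
  finally show ?thesis unfolding q_def[symmetric] by (simp add: algebra_simps)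
qed

lemma laplacian_ln:
  fixes z :: "real^'n::finite"
  assumes z: "z \<in> radial_dom a"
  shows "laplacian (\<lambda>z. ln (z \<bullet> z + a)) z =
    (2 * real CARD('n) - 4) * (z \<bullet> z + a) powr (- 1) + 4 * a * (z \<bullet> z + a) powr (- 2)"
proof -
  define q where "q = z \<bullet> z + a"
  have q: "q > 0" using z by (simp add: q_def radial_dom_def)
  have "laplacian (\<lambda>z. ln (z \<bullet> z + a)) z = (\<Sum>i\<in>UNIV. 2 * (z $ i * (2 * (- 1) * (z $ i * (z \<bullet> z + a) powr (- 1 - 1))) + 1 * (z \<bullet> z + a) powr (- 1)))"
  proof (rule laplacianI[OF open_radial_dom z has_pd_ln])
    fix i
    show "has_pd i (\<lambda>z. 2 * (z $ i * (z \<bullet> z + a) powr (- 1)))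
      (2 * (z $ i * (2 * (- 1) * (z $ i * (z \<bullet> z + a) powr (- 1 - 1))) + 1 * (z \<bullet> z + a) powr (- 1))) z"
      using has_pd_linear[OF bounded_linear_mult_right has_pd_mult[OF has_pd_coord has_pd_powr[OF z]], of i "2" i "- 1"]
      by simp
  qed
  also have "\<dots> = - 4 * (\<Sum>i\<in>UNIV. z $ i * z $ i) * q powr (- 2) + 2 * CARD('n) * q powr (- 1)"
    unfolding sum_radial sum_coord_square q_def by simp
  also have "(\<Sum>i\<in>UNIV. z $ i * z $ i) = q - a" by (simp add: sum_coord_square q_def)
  also have "- 4 * (q - a) * q powr (- 2) = - 4 * q powr (- 1) + 4 * a * q powr (- 2)"
  proof -
    have "q powr (- 1) = q powr (1 + - 2)" by (rule arg_cong[where f="\<lambda>t. q powr t"]) simp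
    then have "q powr (- 1) = q * q powr (- 2)" using q by (simp only: powr_add powr_one)
    then show ?thesis by (simp add: algebra_simps)
  qed
  finally show ?thesis unfolding q_def[symmetric] by (simp add: algebra_simps)
qed

lemma laplacian_q_ln:
  fixes z :: "real^'n::finite"
  assumes z: "z \<in> radial_dom a"
  shows "laplacian (\<lambda>z. (z \<bullet> z + a) * ln (z \<bullet> z + a)) z =
    2 * CARD('n) * ln (z \<bullet> z + a) + (2 * CARD('n) + 4) + - 4 * a * (z \<bullet> z + a) powr (- 1)"
proof -
  define q where "q = z \<bullet> z + a"
  have q: "q > 0" using z by (simp add: q_def radial_dom_def)
  have "laplacian (\<lambda>z. (z \<bullet> z + a) * ln (z \<bullet> z + a)) z = (\<Sum>i\<in>UNIV. 2 * (z $ i * (2 * (z $ i * (z \<bullet> z + a) powr (- 1))) + 1 * (ln (z \<bullet> z + a) + 1)))"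
  proof (rule laplacianI[OF open_radial_dom z])
    fix i and y :: "real^'n" assume y: "y \<in> radial_dom a"
    then have "(y \<bullet> y + a) * (y \<bullet> y + a) powr (- 1) = 1"
      by (simp add: powr_minus radial_dom_def)
    then have "(y \<bullet> y + a) * (2 * (y $ i * (y \<bullet> y + a) powr (- 1))) = 2 * y $ i"
      by (metis mult.assoc mult.commute mult.right_neutral)
    then show "has_pd i (\<lambda>z. (z \<bullet> z + a) * ln (z \<bullet> z + a)) (2 * (y $ i * (ln (y \<bullet> y + a) + 1))) y"
      using has_pd_mult[OF has_pd_square[where i=i and z=y and a=a] has_pd_ln[OF y, of i]] by (simp add: algebra_simps)
  next
    fix i
    show "has_pd i (\<lambda>z. 2 * (z $ i * (ln (z \<bullet> z + a) + 1)))
      (2 * (z $ i * (2 * (z $ i * (z \<bullet> z + a) powr (- 1))) + 1 * (ln (z \<bullet> z + a) + 1))) z"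
      using has_pd_linear[OF bounded_linear_mult_right[of 2]
          has_pd_mult[OF has_pd_coord[of i i z] has_pd_add[OF has_pd_ln[OF z, of i] has_pd_const[of i 1 z]]]]
      by simp
  qed
  also have "\<dots> = 4 * (\<Sum>i\<in>UNIV. z $ i * z $ i) * q powr (- 1) + 2 * CARD('n) * (ln q + 1)"
    unfolding sum_radial by (simp add: sum_coord_square q_def algebra_simps)
  also have "(\<Sum>i\<in>UNIV. z $ i * z $ i) = q - a" by (simp add: sum_coord_square q_def)
  also have "4 * (q - a) * q powr (- 1) = 4 - 4 * a * q powr (- 1)"
    using q by (simp add: powr_minus field_simps)
  finally show ?thesis unfolding q_def[symmetric] by (simp add: algebra_simps)
qed

lemma abs_ln_bound:
  fixes q :: real
  assumes "q > 0" shows "\<bar>q * ln q\<bar> \<le> 1 + q\<^sup>2"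
proof (cases "q \<ge> 1")
  case True
  then have "q * ln q \<le> q * (q - 1)" using ln_le_minus_one[of q] by (intro mult_left_mono) auto
  then show ?thesis using True by (simp add: power2_eq_square algebra_simps)
next
  case False
  have "ln (1 / q) \<le> 1 / q - 1" using assms by (intro ln_le_minus_one) auto
  then have "q * - ln q \<le> q * (1 / q - 1)" using assms by (intro mult_left_mono) (auto simp: ln_div)
  then show ?thesis using assms False by (simp add: algebra_simps abs_mult)
      (smt (verit) mult_nonneg_nonneg zero_le_power2 ln_less_zero)
qed

text \<open>The exponent N/2 + 2 and the factor \<open>a\<^sup>2\<close> make the bilaplacian an
  approximate identity at length scale sqrt a, up to a constant; for a = 0 it is zero away from the
  origin. The quadratic bound is uniform for bounded \<open>a\<close> and \<open>z\<close> and
  serves as majorant when a tends to 0.\<close>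

lemma biharmonic_family:
  assumes dim: "CARD('n::finite) \<in> {2, 3}"
  obtains B :: "real \<Rightarrow> real^'n \<Rightarrow> real" and c :: real where "c \<noteq> 0" "\<And>a. a \<ge> 0 \<Longrightarrow> radial a (B a)"
    "\<And>a z. a \<ge> 0 \<Longrightarrow> z \<in> radial_dom a \<Longrightarrow>
      laplacian (laplacian (B a)) z = c * a\<^sup>2 * (z \<bullet> z + a) powr - (CARD('n) / 2 + 2)"
    "\<And>a z. a > 0 \<Longrightarrow> \<bar>B a z\<bar> \<le> 1 + (z \<bullet> z + a)\<^sup>2"
    "\<And>z. z \<noteq> 0 \<Longrightarrow> ((\<lambda>a. B a z) \<longlongrightarrow> B 0 z) (at_right 0)"
proof (cases "CARD('n) = 3")
  case True
  let ?B = "\<lambda>a z::real^'n. (z \<bullet> z + a) powr (1/2)"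
  show thesis
  \<comment> \<open>For N = 3 the Laplacian is \<open>2 q powr (-1/2) + a q powr (-3/2)\<close>. In
    the second Laplacian the terms -6a and +6a in \<open>q powr (-5/2)\<close> cancel, leaving
    -15.\<close>
  proof (rule that[of "-15" ?B])
    fix a :: real and z :: "real^'n" assume z: "z \<in> radial_dom a"
    have l1: "laplacian (?B a) y = 2 * (y \<bullet> y + a) powr (-1/2) + a * (y \<bullet> y + a) powr (-3/2)"
      if "y \<in> radial_dom a" for y :: "real^'n"
      using laplacian_powr[OF that, of "1/2"] True by simp
    note sm = radial_smooth_on[OF radial.powr]
    have "laplacian (laplacian (?B a)) z = laplacian (\<lambda>y. 2 * (y \<bullet> y + a) powr (-1/2) + a * (y \<bullet> y + a) powr (-3/2)) z"
      by (rule laplacian_cong[OF open_radial_dom z l1])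
    also have "\<dots> = 2 * laplacian (\<lambda>y. (y \<bullet> y + a) powr (-1/2)) z + a * laplacian (\<lambda>y. (y \<bullet> y + a) powr (-3/2)) z"
      by (simp only: laplacian_add[OF open_radial_dom smooth_on_cmult[OF open_radial_dom sm] smooth_on_cmult[OF open_radial_dom sm] z]
          laplacian_cmult[OF open_radial_dom sm z])
    also have "\<dots> = -15 * a\<^sup>2 * (z \<bullet> z + a) powr - (CARD('n) / 2 + 2)"
      unfolding laplacian_powr[OF z] using True by (simp add: power2_eq_square algebra_simps)
    finally show "laplacian (laplacian (?B a)) z = -15 * a\<^sup>2 * (z \<bullet> z + a) powr - (CARD('n) / 2 + 2)" .
  next
    fix a :: real and z :: "real^'n" assume a: "a > 0"
    define q where "q = z \<bullet> z + a"
    have "q > 0" using a by (simp add: q_def add_nonneg_pos)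
    have "sqrt q \<le> 1 + q\<^sup>2"
    proof (cases "q \<ge> 1")
      case True
      then have "sqrt q \<le> q" by (simp add: real_sqrt_le_iff' power2_eq_square sqrt_le_D real_le_lsqrt)
      also have "q \<le> q\<^sup>2" using True by (simp add: power2_eq_square)
      finally show ?thesis by simp
    next
      case False
      then have "sqrt q \<le> 1" using real_sqrt_le_mono[of q 1] by simp
      then show ?thesis using zero_le_power2[of q] by linarith
    qed
    then show "\<bar>?B a z\<bar> \<le> 1 + (z \<bullet> z + a)\<^sup>2"
      using \<open>q > 0\<close> by (simp add: q_def[symmetric] powr_half_sqrt)
  next
    fix z :: "real^'n" assume "z \<noteq> 0"
    then have "isCont (\<lambda>a. ?B a z) 0" by (intro continuous_intros) auto
    then show "((\<lambda>a. ?B a z) \<longlongrightarrow> ?B 0 z) (at_right 0)"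
      unfolding isCont_def by (rule tendsto_mono[rotated]) (simp add: at_le)
  qed (auto intro: radial.powr)
next
  case False
  then have N: "CARD('n) = 2" using dim by auto
  let ?B = "\<lambda>a z::real^'n. (z \<bullet> z + a) * ln (z \<bullet> z + a)"
  have q: "radial a (\<lambda>z::real^'n. z \<bullet> z + a)" for a
  proof -
    have "radial a (\<lambda>z::real^'n. (\<Sum>i\<in>I. z $ i * z $ i) + a)" if "finite I" for I
      using that
    proof (induction I)
      case (insert x F)
      have "radial a (\<lambda>z::real^'n. z $ x * z $ x + ((\<Sum>i\<in>F. z $ i * z $ i) + a))"
        by (intro radial.add radial.mult radial.coord insert.IH)
      then show ?case using insert by (simp add: add.assoc)
    qed (simp add: radial.const)
    from this[of UNIV] show ?thesis by (simp add: sum_coord_square)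
  qed
  show thesis
  \<comment> \<open>For N = 2 the terms of first order in \<open>a\<close> are +16a and -16a times
    \<open>q powr (-2)\<close>; they cancel and 32 remains. The prefactor of the logarithm has to be
    regularised together with its argument.\<close>
  proof (rule that[of "32" ?B])
    fix a :: real and z :: "real^'n" assume z: "z \<in> radial_dom a"
    have l1: "laplacian (?B a) y = 4 * ln (y \<bullet> y + a) + (8 + - 4 * a * (y \<bullet> y + a) powr (- 1))"
      if "y \<in> radial_dom a" for y :: "real^'n"
      using laplacian_q_ln[OF that] N by simp
    note sm = radial_smooth_on[OF radial.powr] radial_smooth_on[OF radial.ln] smooth_on_const[OF open_radial_dom]
    note sm2 = smooth_on_cmult[OF open_radial_dom sm(1)] smooth_on_cmult[OF open_radial_dom sm(2)]
    have "laplacian (laplacian (?B a)) z = laplacian (\<lambda>y. 4 * ln (y \<bullet> y + a) + (8 + - 4 * a * (y \<bullet> y + a) powr (- 1))) z"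
      by (rule laplacian_cong[OF open_radial_dom z l1])
    also have "\<dots> = 4 * laplacian (\<lambda>y. ln (y \<bullet> y + a)) z + (0 + - 4 * a * laplacian (\<lambda>y. (y \<bullet> y + a) powr (- 1)) z)"
      by (simp only: laplacian_add[OF open_radial_dom sm2(2) smooth_on_add[OF open_radial_dom sm(3) sm2(1)] z]
         laplacian_add[OF open_radial_dom sm(3) sm2(1) z]
          laplacian_cmult[OF open_radial_dom sm(1) z] laplacian_cmult[OF open_radial_dom sm(2) z] laplacian_const)
    also have "\<dots> = 32 * a\<^sup>2 * (z \<bullet> z + a) powr - (CARD('n) / 2 + 2)"
      unfolding laplacian_powr[OF z] laplacian_ln[OF z] using N by (simp add: power2_eq_square algebra_simps)
    finally show "laplacian (laplacian (?B a)) z = 32 * a\<^sup>2 * (z \<bullet> z + a) powr - (CARD('n) / 2 + 2)" .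
  next
    fix a :: real and z :: "real^'n" assume a: "a > 0"
    show "\<bar>?B a z\<bar> \<le> 1 + (z \<bullet> z + a)\<^sup>2"
      by (rule abs_ln_bound) (use a in \<open>simp add: add_nonneg_pos\<close>)
  next
    fix z :: "real^'n" assume "z \<noteq> 0"
    then have "isCont (\<lambda>a. ?B a z) 0" by (intro continuous_intros) auto
    then show "((\<lambda>a. ?B a z) \<longlongrightarrow> ?B 0 z) (at_right 0)"
      unfolding isCont_def by (rule tendsto_mono[rotated]) (simp add: at_le)
  qed (auto intro: radial.mult radial.ln q)
qed

section \<open>The bump and the representation formula obtained from it\<close>

lemma nn_integral_inverse_square: "(\<integral>\<^sup>+x. ennreal (1 / (1 + (x::real)\<^sup>2)) \<partial>lborel) < \<infinity>"
proof -
  let ?f = "\<lambda>x::real. ennreal (1 / (1 + x\<^sup>2))"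
  have 1: "(\<integral>\<^sup>+x. ?f x * indicator {0..} x \<partial>lborel) = ennreal (pi / 2 - arctan 0)"
  proof (rule nn_integral_FTC_atLeast)
    show "(\<lambda>x::real. 1 / (1 + x\<^sup>2)) \<in> borel_measurable borel" by measurable
    show "(arctan has_real_derivative 1 / (1 + x\<^sup>2)) (at x)" for x
      using DERIV_arctan[of x] by (simp only: divide_inverse mult_1_left)
    show "0 \<le> 1 / (1 + x\<^sup>2)" for x :: real by simp
  qed (rule tendsto_arctan_at_top)
  have 2: "(\<integral>\<^sup>+x. ?f x * indicator {0..} x \<partial>lborel) = (\<integral>\<^sup>+x. ?f x * indicator {0..} (- x) \<partial>lborel)"
    using nn_integral_real_affine[of "\<lambda>x. ?f x * indicator {0..} x" "-1" 0] by simp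
  have "(\<integral>\<^sup>+x. ?f x \<partial>lborel) \<le> (\<integral>\<^sup>+x. ?f x * indicator {0..} x + ?f x * indicator {0..} (- x) \<partial>lborel)"
    by (intro nn_integral_mono) (auto simp: indicator_def)
  also have "\<dots> = ennreal (pi / 2 - arctan 0) + ennreal (pi / 2 - arctan 0)"
    using 1 2 by (subst nn_integral_add) auto
  also have "\<dots> < \<infinity>" by simp
  finally show ?thesis .
qed

text \<open>Each 1 + z_b^2 is at most 1 + |z|^2, so the product of N one-dimensional functions 1/(1
  + x^2) is a majorant once \<open>p\<close> is at least N. The exponent N/2 + 2 used later
  satisfies this for N = 2 and N = 3.\<close>

lemma integrable_bump:
  fixes p :: real
  assumes p: "CARD('n::finite) \<le> p"
  shows "integrable lborel (\<lambda>z::real^'n. (z \<bullet> z + 1) powr - p)"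
proof (rule Bochner_Integration.integrable_bound)
  let ?g = "\<lambda>z::real^'n. \<Prod>b\<in>Basis. 1 / (1 + (z \<bullet> b)\<^sup>2)"
  show "integrable lborel ?g"
  proof (rule integrableI_nonneg)
    have "(\<integral>\<^sup>+z. ennreal (?g z) \<partial>lborel) = (\<integral>\<^sup>+z. (\<Prod>b\<in>Basis. ennreal (1 / (1 + ((z::real^'n) \<bullet> b)\<^sup>2))) \<partial>lborel)"
      by (simp add: prod_ennreal)
    also have "\<dots> = (\<Prod>b\<in>(Basis::(real^'n) set). (\<integral>\<^sup>+x. ennreal (1 / (1 + x\<^sup>2)) \<partial>lborel))"
      by (rule nn_integral_lborel_prod) auto
    also have "\<dots> < \<infinity>" using nn_integral_inverse_square by (simp add: power_less_top_ennreal)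
    finally show "(\<integral>\<^sup>+z. ennreal (?g z) \<partial>lborel) < \<infinity>" .
  qed (auto intro!: prod_nonneg)
  show "(\<lambda>z::real^'n. (z \<bullet> z + 1) powr - p) \<in> borel_measurable lborel" by measurable
  show "AE z in lborel. norm ((z \<bullet> z + 1) powr - p) \<le> norm (?g z)"
  proof (rule AE_I2)
    fix z :: "real^'n"
    have q: "z \<bullet> z + 1 \<ge> 1" by simp
    have "(\<Prod>b\<in>Basis. 1 + (z \<bullet> b)\<^sup>2) \<le> (\<Prod>b\<in>(Basis::(real^'n) set). z \<bullet> z + 1)"
    proof (rule prod_mono, intro conjI)
      fix b :: "real^'n" assume b: "b \<in> Basis"
      have "(z \<bullet> b)\<^sup>2 \<le> (norm z)\<^sup>2"
        using Basis_le_norm[OF b, of z] by (simp add: abs_le_square_iff[symmetric])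
      then show "1 + (z \<bullet> b)\<^sup>2 \<le> z \<bullet> z + 1" by (simp add: power2_norm_eq_inner)
    qed simp
    also have "\<dots> = (z \<bullet> z + 1) powr CARD('n)"
    proof -
      have "0 < z \<bullet> z + 1" using q by linarith
      then show ?thesis by (simp add: powr_realpow)
    qed
    also have "\<dots> \<le> (z \<bullet> z + 1) powr p" using p q by (intro powr_mono) auto
    finally have le: "(\<Prod>b\<in>Basis. 1 + (z \<bullet> b)\<^sup>2) \<le> (z \<bullet> z + 1) powr p" .
    have pos: "(\<Prod>b\<in>(Basis::(real^'n) set). 1 + (z \<bullet> b)\<^sup>2) > 0" by (intro prod_pos) (auto simp: add_pos_nonneg)
    have "(z \<bullet> z + 1) powr - p = 1 / (z \<bullet> z + 1) powr p" by (simp add: powr_minus divide_inverse)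
    also have "\<dots> \<le> 1 / (\<Prod>b\<in>Basis. 1 + (z \<bullet> b)\<^sup>2)"
      using le pos by (intro divide_left_mono mult_pos_pos) (auto intro: order_less_le_trans)
    also have "\<dots> = ?g z" by (simp add: prod_dividef)
    finally show "norm ((z \<bullet> z + 1) powr - p) \<le> norm (?g z)" by simp
  qed
qed

lemma bump_integral_pos:
  fixes p :: real
  assumes p: "CARD('n::finite) \<le> p"
  shows "(LINT z|lborel. ((z::real^'n) \<bullet> z + 1) powr - p) > 0"
proof -
  let ?f = "\<lambda>z::real^'n. (z \<bullet> z + 1) powr - p"
  have "(LINT z|lborel. ?f z) \<noteq> 0"
  proof
    assume "(LINT z|lborel. ?f z) = 0"
    then have "AE z in lborel. ?f z = 0"
      using integral_nonneg_eq_0_iff_AE[OF integrable_bump[OF p]] by simp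
    then have "AE (z::real^'n) in lborel. False"
      by (rule AE_mp) (rule AE_I2, simp add: add_nonneg_eq_0_iff)
    then have "emeasure lborel (UNIV :: (real^'n) set) = 0" using ae_filter_eq_bot_iff[of "lborel :: (real^'n) measure"]
      by (simp add: trivial_limit_def)
    then show False by (simp add: emeasure_lborel_UNIV)
  qed
  moreover have "(LINT z|lborel. ?f z) \<ge> 0" by (rule integral_nonneg_AE) simp
  ultimately show ?thesis by (simp add: order_less_le)
qed

text \<open>For a > 0 integration by parts against the smooth \<open>B a\<close> meets no
  singularity. The substitution y = x + h z with a = h^2 turns its bilaplacian into a fixed bump
  multiplied by \<open>w (x + h z)\<close>, and h -> 0 gives \<open>w x\<close> times the integral
  of the bump.\<close>

lemma biharmonic_representation:
  assumes dim: "CARD('n::finite) \<in> {2, 3}"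
  obtains B :: "real^'n \<Rightarrow> real" and c :: real where "c \<noteq> 0" "radial 0 B"
    "\<And>z. z \<noteq> 0 \<Longrightarrow> laplacian (laplacian B) z = 0"
    "\<And>w x. smooth_compact_support w \<Longrightarrow> laplacian (laplacian w) x = 0 \<Longrightarrow>
       c * w x = (LINT y|lborel. B (x - y) * laplacian (laplacian w) y)"
proof (rule biharmonic_family[OF dim])
  fix B :: "real \<Rightarrow> real^'n \<Rightarrow> real" and c :: real assume c: "c \<noteq> 0" and rad: "\<And>a. a \<ge> 0 \<Longrightarrow> radial a (B a)"
    and LL: "\<And>a z. a \<ge> 0 \<Longrightarrow> z \<in> radial_dom a \<Longrightarrow>
      laplacian (laplacian (B a)) z = c * a\<^sup>2 * (z \<bullet> z + a) powr - (CARD('n) / 2 + 2)"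
    and bound: "\<And>a z. a > 0 \<Longrightarrow> \<bar>B a z\<bar> \<le> 1 + (z \<bullet> z + a)\<^sup>2"
    and lim: "\<And>z. z \<noteq> 0 \<Longrightarrow> ((\<lambda>a. B a z) \<longlongrightarrow> B 0 z) (at_right 0)"
  define p where "p = CARD('n) / 2 + 2"
  have p: "real CARD('n) \<le> p" using dim by (auto simp: p_def)
  let ?f = "\<lambda>z::real^'n. (z \<bullet> z + 1) powr - p"
  define J where "J = (LINT z|lborel. ?f z)"
  have J: "J > 0" unfolding J_def by (rule bump_integral_pos[OF p])
  have main: "(c * J) * w x = (LINT y|lborel. B 0 (x - y) * laplacian (laplacian w) y)"
    if w: "smooth_compact_support w" and w0: "laplacian (laplacian w) x = 0" for w x
  proof -
    define h where "h = (\<lambda>n::nat. 1 / real (Suc n))"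
    have h: "h n > 0" "h n \<le> 1" for n by (auto simp: h_def)
    have hlim: "h \<longlonglongrightarrow> 0" unfolding h_def
      by (auto intro: lim_1_over_real_power[of 1, simplified] LIMSEQ_Suc simp del: of_nat_Suc)
    let ?W = "laplacian (laplacian w)"
    obtain C where C: "compact C" "\<And>y. y \<notin> C \<Longrightarrow> w y = 0" using w by (metis smooth_compact_supportE)
    obtain D where D: "compact D" "\<And>y. y \<notin> D \<Longrightarrow> ?W y = 0"
      using scs_laplacian[OF scs_laplacian[OF w]] by (metis smooth_compact_supportE)
    have cw: "continuous_on UNIV w" using smooth_on_continuous0[OF scs_smooth[OF w]] .
    have cW: "continuous_on UNIV ?W"
      using smooth_on_continuous0[OF scs_smooth[OF scs_laplacian[OF scs_laplacian[OF w]]]] .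
    have [measurable]: "w \<in> borel_measurable borel" "?W \<in> borel_measurable borel"
      using cw cW by (auto intro: borel_measurable_continuous_onI)
    have B_smooth: "smooth_on (B ((h n)\<^sup>2)) UNIV" for n
      using radial_smooth_on[OF rad, of "(h n)\<^sup>2"] h[of n] by (simp add: radial_dom_pos)
    have scaled: "(LINT y|lborel. B ((h n)\<^sup>2) (x - y) * ?W y) = c * (LINT z|lborel. ?f z * w (x + h n *\<^sub>R z))" for n
    proof -
      let ?h = "h n"
      have "(LINT y|lborel. B (?h\<^sup>2) (x - y) * ?W y) = (LINT y|lborel. laplacian (laplacian (B (?h\<^sup>2))) (x - y) * w y)"
        using integration_by_parts_laplacian[OF B_smooth scs_laplacian[OF w]]
          integration_by_parts_laplacian[OF smooth_on_laplacian[OF open_UNIV B_smooth] w] by simp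
      also have "\<dots> = (LINT y|lborel. c * (?h\<^sup>2)\<^sup>2 * ((x - y) \<bullet> (x - y) + ?h\<^sup>2) powr - p * w y)"
        using LL[of "?h\<^sup>2"] h[of n] by (simp add: p_def radial_dom_pos)
      also have "\<dots> = \<bar>?h\<bar> ^ DIM(real^'n) * (LINT z|lborel. c * (?h\<^sup>2)\<^sup>2 * ((x - (x + ?h *\<^sub>R z)) \<bullet> (x - (x + ?h *\<^sub>R z)) + ?h\<^sup>2) powr - p * w (x + ?h *\<^sub>R z))"
        by (rule lborel_affine_integral) (use h[of n] in auto)
      also have "\<dots> = (LINT z|lborel. c * (?f z * w (x + ?h *\<^sub>R z)))"
        unfolding Bochner_Integration.integral_mult_right_zero[symmetric]
      proof (rule Bochner_Integration.integral_cong[OF refl])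
        fix z :: "real^'n"
        have e1: "(x - (x + ?h *\<^sub>R z)) \<bullet> (x - (x + ?h *\<^sub>R z)) + ?h\<^sup>2 = ?h\<^sup>2 * (z \<bullet> z + 1)"
          by (simp add: power2_eq_square algebra_simps)
        have e2: "(?h\<^sup>2 * (z \<bullet> z + 1)) powr - p = (?h\<^sup>2) powr - p * ?f z"
          by (rule powr_mult)
        \<comment> \<open>The powers of \<open>h\<close> balance: N from the volume, 4 from
          \<open>a\<^sup>2\<close>, and -2p from the bump, with p = N/2 + 2.\<close>
        have e3: "\<bar>?h\<bar> ^ DIM(real^'n) * (?h\<^sup>2)\<^sup>2 * (?h\<^sup>2) powr - p = 1"
        proof -
          have "(?h\<^sup>2) powr - p = ?h powr (2 * - p)"
          proof -
            have "?h\<^sup>2 = ?h powr 2" using h[of n] by simp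
            then show ?thesis by (simp only: powr_powr)
          qed
          moreover have "\<bar>?h\<bar> ^ DIM(real^'n) = ?h powr CARD('n)" "(?h\<^sup>2)\<^sup>2 = ?h powr 4"
            using h[of n] by (simp_all add: powr_realpow)
          ultimately have "\<bar>?h\<bar> ^ DIM(real^'n) * (?h\<^sup>2)\<^sup>2 * (?h\<^sup>2) powr - p = ?h powr (real CARD('n) + 4 + 2 * - p)"
            by (simp only: powr_add)
          also have "real CARD('n) + 4 + 2 * - p = 0" by (simp add: p_def)
          finally show ?thesis using h[of n] by simp
        qed
        have "\<bar>?h\<bar> ^ DIM(real^'n) * (c * (?h\<^sup>2)\<^sup>2 * ((x - (x + ?h *\<^sub>R z)) \<bullet> (x - (x + ?h *\<^sub>R z)) + ?h\<^sup>2) powr - p * w (x + ?h *\<^sub>R z))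
          = \<bar>?h\<bar> ^ DIM(real^'n) * (?h\<^sup>2)\<^sup>2 * (?h\<^sup>2) powr - p * (c * (?f z * w (x + ?h *\<^sub>R z)))"
          unfolding e1 e2 by (simp only: mult_ac)
        then show "\<bar>?h\<bar> ^ DIM(real^'n) * (c * (?h\<^sup>2)\<^sup>2 * ((x - (x + ?h *\<^sub>R z)) \<bullet> (x - (x + ?h *\<^sub>R z)) + ?h\<^sup>2) powr - p * w (x + ?h *\<^sub>R z))
          = c * (?f z * w (x + ?h *\<^sub>R z))"
          by (simp only: e3 mult_1_left)
      qed
      finally show ?thesis by simp
    qed
    have lhs: "(\<lambda>n. LINT y|lborel. B ((h n)\<^sup>2) (x - y) * ?W y) \<longlonglongrightarrow> (LINT y|lborel. B 0 (x - y) * ?W y)"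
    proof (rule integral_dominated_convergence)
      obtain M where M: "\<And>y. \<bar>?W y\<bar> \<le> M"
      proof -
        have "bounded (?W ` D)"
          by (intro compact_imp_bounded compact_continuous_image D continuous_on_subset[OF cW]) auto
        then obtain M where "M > 0" "\<And>y. y \<in> D \<Longrightarrow> \<bar>?W y\<bar> \<le> M" unfolding bounded_pos by auto
        then show thesis using D that[of M] by (metis abs_zero less_imp_le)
      qed
      \<comment> \<open>The bound on \<open>B a\<close> with a = h^2 replaced by its upper limit 1,
        so that one majorant serves all \<open>n\<close>.\<close>
      define w' where "w' = (\<lambda>y. (1 + ((x - y) \<bullet> (x - y) + 1)\<^sup>2) * \<bar>?W y\<bar>)"
      show "integrable lborel w'" unfolding w'_def
        by (rule integrable_compact_support[OF _ D(1)]) (auto intro!: continuous_intros cW simp: D(2))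
      have Bmeas: "(\<lambda>y. B ((h n)\<^sup>2) (x - y)) \<in> borel_measurable borel" for n
        by (rule borel_measurable_continuous_onI, rule continuous_on_compose2[OF smooth_on_continuous0[OF B_smooth]])
          (auto intro!: continuous_intros)
      then show "(\<lambda>y. B ((h n)\<^sup>2) (x - y) * ?W y) \<in> borel_measurable lborel" for n by measurable
      \<comment> \<open>Convergence of \<open>B a\<close> is available only off the origin. At y = x
        the assumption that the bilaplacian of \<open>w\<close> vanishes at \<open>x\<close> makes
        both sides 0.\<close>
      have ptw: "(\<lambda>n. B ((h n)\<^sup>2) (x - y) * ?W y) \<longlonglongrightarrow> B 0 (x - y) * ?W y" for y
      proof (cases "y = x")
        case True
        then show ?thesis using w0 by simp
      next
        case False
        have "filterlim (\<lambda>n. (h n)\<^sup>2) (at_right 0) sequentially"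
        proof (rule tendsto_imp_filterlim_at_right)
          show "(\<lambda>n. (h n)\<^sup>2) \<longlonglongrightarrow> 0" using tendsto_power[OF hlim, of 2] by simp
          show "\<forall>\<^sub>F n in sequentially. 0 < (h n)\<^sup>2" by (rule always_eventually) (use h in \<open>auto simp: less_imp_neq[symmetric]\<close>)
        qed
        from filterlim_compose[OF lim this] False show ?thesis by (intro tendsto_mult tendsto_const) auto
      qed
      \<comment> \<open>Measurability is inherited from the pointwise limit, so the behaviour of
        \<open>B 0\<close> at the origin is not examined.\<close>
      show "(\<lambda>y. B 0 (x - y) * ?W y) \<in> borel_measurable lborel"
        by (rule borel_measurable_LIMSEQ_real[OF ptw]) (use Bmeas in measurable)
      show "AE y in lborel. (\<lambda>n. B ((h n)\<^sup>2) (x - y) * ?W y) \<longlonglongrightarrow> B 0 (x - y) * ?W y"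
        using ptw by simp
      show "AE y in lborel. norm (B ((h n)\<^sup>2) (x - y) * ?W y) \<le> w' y" for n
      proof (rule AE_I2)
        fix y
        have "\<bar>B ((h n)\<^sup>2) (x - y)\<bar> \<le> 1 + ((x - y) \<bullet> (x - y) + (h n)\<^sup>2)\<^sup>2"
          using bound[of "(h n)\<^sup>2"] h[of n] by auto
        also have "\<dots> \<le> 1 + ((x - y) \<bullet> (x - y) + 1)\<^sup>2"
          using h[of n] by (intro add_left_mono power_mono) (auto simp: power_le_one)
        finally show "norm (B ((h n)\<^sup>2) (x - y) * ?W y) \<le> w' y"
          unfolding w'_def by (auto simp: abs_mult intro: mult_right_mono)
      qed
    qed
    have "(\<lambda>n. LINT z|lborel. ?f z * w (x + h n *\<^sub>R z)) \<longlonglongrightarrow> (LINT z|lborel. ?f z * w x)"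
    proof -
      obtain M where M: "\<And>y. \<bar>w y\<bar> \<le> M"
      proof -
        have "bounded (w ` C)"
          by (intro compact_imp_bounded compact_continuous_image C continuous_on_subset[OF cw]) auto
        then obtain M where "M > 0" "\<And>y. y \<in> C \<Longrightarrow> \<bar>w y\<bar> \<le> M" unfolding bounded_pos by auto
        then show thesis using C that[of M] by (metis abs_zero less_imp_le)
      qed
      show ?thesis
      proof (rule integral_dominated_convergence)
        show "integrable lborel (\<lambda>z. ?f z * M)" by (rule integrable_mult_left[OF integrable_bump[OF p]])
        show "AE z in lborel. norm (?f z * w (x + h n *\<^sub>R z)) \<le> ?f z * M" for n
          using M by (auto simp: abs_mult intro!: AE_I2 mult_left_mono)
        show "AE z in lborel. (\<lambda>n. ?f z * w (x + h n *\<^sub>R z)) \<longlonglongrightarrow> ?f z * w x"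
        proof (rule AE_I2, rule tendsto_mult[OF tendsto_const])
          fix z
          have "(\<lambda>n. x + h n *\<^sub>R z) \<longlonglongrightarrow> x + 0 *\<^sub>R z" by (intro tendsto_intros hlim)
          moreover have "isCont w x" using cw by (simp add: continuous_on_eq_continuous_at)
          ultimately show "(\<lambda>n. w (x + h n *\<^sub>R z)) \<longlonglongrightarrow> w x"
            using isCont_tendsto_compose[of x w "\<lambda>n. x + h n *\<^sub>R z"] by simp
        qed
      qed measurable
    qed
    from tendsto_mult_left[OF this, of c] have "(\<lambda>n. LINT y|lborel. B ((h n)\<^sup>2) (x - y) * ?W y) \<longlonglongrightarrow> c * (J * w x)"
      unfolding scaled by (simp add: J_def)
    from LIMSEQ_unique[OF lhs this] show ?thesis by simp
  qed
  show thesis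
  proof (rule that[of "c * J" "B 0"])
    show "c * J \<noteq> 0" using c J by simp
    show "radial 0 (B 0)" by (rule rad) simp
    show "laplacian (laplacian (B 0)) z = 0" if "z \<noteq> 0" for z
      using LL[of 0 z] that by (simp add: radial_dom_0)
  qed (rule main)
qed

section \<open>Holomorphic extension along lines\<close>

text \<open>For a unit vector \<open>e\<close> the real part of \<open>(z - t e) \<bullet> (z - t e)\<close>, continued to complex \<open>t\<close>,
  stays positive for \<open>\<bar>t\<bar> < \<bar>z\<bar> / 3\<close>, so that logarithm and powers extend holomorphically to that disc.\<close>

definition line_extends :: "(real^'n::finite \<Rightarrow> real) \<Rightarrow> (real^'n \<Rightarrow> real^'n \<Rightarrow> complex \<Rightarrow> complex) \<Rightarrow> bool" where
  "line_extends f F \<longleftrightarrow>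
    (\<forall>z e. z \<noteq> 0 \<longrightarrow> norm e = 1 \<longrightarrow> F z e holomorphic_on ball 0 (norm z / 3) \<and>
      (\<forall>t. \<bar>t\<bar> < norm z / 3 \<longrightarrow> F z e (of_real t) = of_real (f (z - t *\<^sub>R e)))) \<and>
    (\<forall>r R. 0 < r \<longrightarrow> (\<exists>M. \<forall>z e t. r \<le> norm z \<longrightarrow> norm z \<le> R \<longrightarrow> norm e = 1 \<longrightarrow> cmod t < norm z / 3 \<longrightarrow>
      cmod (F z e t) \<le> M))"

lemma line_extends_op:
  fixes op :: "complex \<Rightarrow> complex \<Rightarrow> complex"
  assumes f: "line_extends f F" and g: "line_extends g G"
    and hol: "\<And>S u v. u holomorphic_on S \<Longrightarrow> v holomorphic_on S \<Longrightarrow> (\<lambda>t. op (u t) (v t)) holomorphic_on S"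
    and re: "\<And>x y. op (of_real x) (of_real y) = of_real (opr x y)"
    and bd: "\<And>u v M N. cmod u \<le> M \<Longrightarrow> cmod v \<le> N \<Longrightarrow> cmod (op u v) \<le> opb M N"
  shows "line_extends (\<lambda>z. opr (f z) (g z)) (\<lambda>z e t. op (F z e t) (G z e t))"
  unfolding line_extends_def
proof (intro conjI allI impI)
  fix z e :: "real^'a" assume *: "z \<noteq> 0" "norm e = 1"
  show "(\<lambda>t. op (F z e t) (G z e t)) holomorphic_on ball 0 (norm z / 3)"
    using f g * by (intro hol) (auto simp: line_extends_def)
  show "op (F z e (of_real t)) (G z e (of_real t)) = of_real (opr (f (z - t *\<^sub>R e)) (g (z - t *\<^sub>R e)))"
    if "\<bar>t\<bar> < norm z / 3" for t
    using f g * that re by (simp add: line_extends_def)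
next
  fix r R :: real assume r: "0 < r"
  obtain M where M: "\<And>z e t. r \<le> norm z \<Longrightarrow> norm z \<le> R \<Longrightarrow> norm e = 1 \<Longrightarrow> cmod t < norm z / 3 \<Longrightarrow> cmod (F z e t) \<le> M"
    using f r unfolding line_extends_def by blast
  obtain N where N: "\<And>z e t. r \<le> norm z \<Longrightarrow> norm z \<le> R \<Longrightarrow> norm e = 1 \<Longrightarrow> cmod t < norm z / 3 \<Longrightarrow> cmod (G z e t) \<le> N"
    using g r unfolding line_extends_def by blast
  show "\<exists>M. \<forall>z e t. r \<le> norm z \<longrightarrow> norm z \<le> R \<longrightarrow> norm e = 1 \<longrightarrow> cmod t < norm z / 3 \<longrightarrow>
      cmod (op (F z e t) (G z e t)) \<le> M"
    by (rule exI[where x="opb M N"]) (use M N bd in blast)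
qed

text \<open>The polynomial continuation of |z - t e|^2 to complex t for a unit vector
  \<open>e\<close>, which is why the coefficient of t^2 is 1.\<close>

definition cquad :: "real^'n::finite \<Rightarrow> real^'n \<Rightarrow> complex \<Rightarrow> complex" where
  "cquad z e t = of_real (z \<bullet> z) - 2 * of_real (z \<bullet> e) * t + t\<^sup>2"

lemma cquad_of_real:
  assumes "norm e = 1"
  shows "cquad z e (of_real t) = of_real ((z - t *\<^sub>R e) \<bullet> (z - t *\<^sub>R e))"
proof -
  have "e \<bullet> e = 1" using assms by (simp add: norm_eq_1)
  then have "(z - t *\<^sub>R e) \<bullet> (z - t *\<^sub>R e) = z \<bullet> z - 2 * (z \<bullet> e) * t + t\<^sup>2"
    by (simp add: inner_simps power2_eq_square inner_commute algebra_simps)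
  then show ?thesis by (simp add: cquad_def)
qed

lemma cquad_bounds:
  assumes "z \<noteq> 0" "norm e = 1" "cmod t < norm z / 3"
  shows "(norm z)\<^sup>2 / 9 \<le> Re (cquad z e t)" "cmod (cquad z e t) \<le> 2 * (norm z)\<^sup>2"
proof -
  define s where "s = 2 * of_real (z \<bullet> e) * t - t\<^sup>2"
  have "\<bar>z \<bullet> e\<bar> \<le> norm z" using Cauchy_Schwarz_ineq2[of z e] assms by simp
  then have "\<bar>z \<bullet> e\<bar> * cmod t \<le> norm z * (norm z / 3)"
    using assms by (intro mult_mono) auto
  then have "cmod (2 * of_real (z \<bullet> e) * t) \<le> 2 * norm z * (norm z / 3)"
    by (simp add: norm_mult mult.commute mult.left_commute)
  moreover have "cmod (t\<^sup>2) \<le> (norm z / 3)\<^sup>2"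
    unfolding norm_power using assms by (intro power_mono) auto
  ultimately have "cmod s \<le> 2 * norm z * (norm z / 3) + (norm z / 3)\<^sup>2"
    unfolding s_def using norm_triangle_ineq4[of "2 * of_real (z \<bullet> e) * t" "t\<^sup>2"] by linarith
  \<comment> \<open>The radius |z|/3 gives 2/3 + 1/9 = 7/9 < 1, so the perturbation cannot cancel
    |z|^2; the bounds 1/9 and 2 leave some room.\<close>
  then have s: "cmod s \<le> 7/9 * (norm z)\<^sup>2" by (simp add: power2_eq_square)
  have q: "cquad z e t = of_real ((norm z)\<^sup>2) - s"
    by (simp add: cquad_def s_def power2_norm_eq_inner)
  show "(norm z)\<^sup>2 / 9 \<le> Re (cquad z e t)"
  proof -
    have "Re (cquad z e t) = (norm z)\<^sup>2 - Re s" unfolding q by (simp del: of_real_power)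
    then show ?thesis using s complex_Re_le_cmod[of s] zero_le_power2[of "norm z"] by linarith
  qed
  have "cmod (cquad z e t) \<le> cmod (of_real ((norm z)\<^sup>2)) + cmod s"
    unfolding q by (rule norm_triangle_ineq4)
  also have "cmod (of_real ((norm z)\<^sup>2)) = (norm z)\<^sup>2" by (simp add: norm_power)
  finally show "cmod (cquad z e t) \<le> 2 * (norm z)\<^sup>2"
    using s zero_le_power2[of "norm z"] by linarith
qed

lemma holomorphic_cquad: "cquad z e holomorphic_on S"
  unfolding cquad_def[abs_def] by (intro holomorphic_intros)

lemma holomorphic_Ln_cquad:
  assumes "z \<noteq> 0" "norm e = 1"
  shows "(\<lambda>t. Ln (cquad z e t)) holomorphic_on ball 0 (norm z / 3)"
proof (rule holomorphic_on_Ln')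
  fix t :: complex assume "t \<in> ball 0 (norm z / 3)"
  then have "(norm z)\<^sup>2 / 9 \<le> Re (cquad z e t)" using cquad_bounds(1)[OF assms] by simp
  moreover have "0 < (norm z)\<^sup>2 / 9" using assms by simp
  ultimately have "0 < Re (cquad z e t)" by (rule order_less_le_trans[rotated])
  then show "cquad z e t \<notin> \<real>\<^sub>\<le>\<^sub>0" by (auto simp: complex_nonpos_Reals_iff)
qed (rule holomorphic_cquad)

lemma Ln_cquad_of_real:
  assumes "z \<noteq> 0" "norm e = 1" "\<bar>t\<bar> < norm z / 3"
  shows "Ln (cquad z e (of_real t)) = of_real (ln ((z - t *\<^sub>R e) \<bullet> (z - t *\<^sub>R e)))"
    and "z - t *\<^sub>R e \<noteq> 0"
proof -
  show "z - t *\<^sub>R e \<noteq> 0" using assms by auto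
  then show "Ln (cquad z e (of_real t)) = of_real (ln ((z - t *\<^sub>R e) \<bullet> (z - t *\<^sub>R e)))"
    using assms by (simp add: cquad_of_real Ln_of_real)
qed

text \<open>The real part of \<open>Ln\<close> is the logarithm of the modulus, which lies between
  r^2/9 and 2 R^2 by the previous bounds; the imaginary part is at most pi in absolute
  value.\<close>

lemma Ln_cquad_bound:
  assumes r: "0 < r"
  shows "\<exists>M\<ge>0. \<forall>z e t. r \<le> norm z \<longrightarrow> norm (z::real^'n::finite) \<le> R \<longrightarrow> norm e = 1 \<longrightarrow> cmod t < norm z / 3 \<longrightarrow>
      cmod (Ln (cquad z e t)) \<le> M"
proof (intro exI[where x="\<bar>ln (r\<^sup>2 / 9)\<bar> + \<bar>ln (2 * R\<^sup>2)\<bar> + pi"] conjI allI impI)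
  fix z e :: "real^'n" and t
  assume *: "r \<le> norm z" "norm z \<le> R" "norm e = 1" "cmod t < norm z / 3"
  let ?q = "cquad z e t"
  have z: "z \<noteq> 0" using * r by auto
  note b = cquad_bounds[OF z *(3,4)]
  have "r\<^sup>2 / 9 \<le> cmod ?q"
    using b(1) complex_Re_le_cmod[of ?q] power_mono[OF *(1), of 2] r by linarith
  moreover have "cmod ?q \<le> 2 * R\<^sup>2" using b(2) power_mono[OF *(2), of 2] by simp
  moreover have "0 < r\<^sup>2 / 9" using r by simp
  ultimately have "ln (r\<^sup>2 / 9) \<le> ln (cmod ?q)" "ln (cmod ?q) \<le> ln (2 * R\<^sup>2)" "?q \<noteq> 0"
    by (auto simp del: ln_le_cancel_iff intro!: ln_mono)
  then have "\<bar>Re (Ln ?q)\<bar> \<le> \<bar>ln (r\<^sup>2 / 9)\<bar> + \<bar>ln (2 * R\<^sup>2)\<bar>" by simp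
  moreover have "\<bar>Im (Ln ?q)\<bar> \<le> pi"
    using Im_Ln_le_pi[OF \<open>?q \<noteq> 0\<close>] mpi_less_Im_Ln[OF \<open>?q \<noteq> 0\<close>] by simp
  ultimately show "cmod (Ln ?q) \<le> \<bar>ln (r\<^sup>2 / 9)\<bar> + \<bar>ln (2 * R\<^sup>2)\<bar> + pi"
    using cmod_le[of "Ln ?q"] by linarith
qed simp

lemma radial_line_extends: "radial 0 (f :: real^'n::finite \<Rightarrow> real) \<Longrightarrow> \<exists>F. line_extends f F"
proof (induction rule: radial.induct)
  case (const c)
  show ?case
    by (rule exI[where x="\<lambda>z e t. of_real c"]) (auto simp: line_extends_def intro!: holomorphic_intros)
next
  case (coord i)
  have "cmod (of_real (z $ i) - of_real (e $ i) * t) \<le> 2 * R"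
    if "norm z \<le> R" "norm e = 1" "cmod t < norm z / 3" for z e :: "real^'n" and t R
  proof -
    have "cmod (of_real (z $ i) - of_real (e $ i) * t) \<le> \<bar>z $ i\<bar> + \<bar>e $ i\<bar> * cmod t"
      by (rule order_trans[OF norm_triangle_ineq4]) (simp add: norm_mult)
    also have "\<bar>e $ i\<bar> * cmod t \<le> 1 * cmod t"
      using component_le_norm_cart[of e i] that by (intro mult_right_mono) auto
    finally show ?thesis using component_le_norm_cart[of z i] that by simp
  qed
  then have "\<exists>M. \<forall>z e t. r \<le> norm z \<longrightarrow> norm (z::real^'n) \<le> R \<longrightarrow> norm e = 1 \<longrightarrow> cmod t < norm z / 3 \<longrightarrow>
      cmod (of_real (z $ i) - of_real (e $ i) * t) \<le> M" for r R by blast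
  then show ?case
    by (intro exI[where x="\<lambda>z e t. of_real (z $ i) - of_real (e $ i) * t"])
      (auto simp: line_extends_def intro!: holomorphic_intros)
next
  case (powr b)
  have "\<exists>M. \<forall>z e t. r \<le> norm z \<longrightarrow> norm (z::real^'n) \<le> R \<longrightarrow> norm e = 1 \<longrightarrow> cmod t < norm z / 3 \<longrightarrow>
      cmod (exp (of_real b * Ln (cquad z e t))) \<le> M" if r: "0 < r" for r R
  proof -
    obtain M where M: "M \<ge> 0" "\<And>z e t. r \<le> norm z \<Longrightarrow> norm (z::real^'n) \<le> R \<Longrightarrow> norm e = 1 \<Longrightarrow> cmod t < norm z / 3 \<Longrightarrow>
      cmod (Ln (cquad z e t)) \<le> M" using Ln_cquad_bound[OF r, of R] by blast
    show ?thesis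
    proof (intro exI[where x="exp (\<bar>b\<bar> * M)"] allI impI)
      fix z e :: "real^'n" and t assume *: "r \<le> norm z" "norm z \<le> R" "norm e = 1" "cmod t < norm z / 3"
      have "cmod (exp (of_real b * Ln (cquad z e t))) \<le> exp (cmod (of_real b * Ln (cquad z e t)))"
        by (rule norm_exp)
      also have "\<dots> \<le> exp (\<bar>b\<bar> * M)"
        using M(2)[OF *] by (simp add: norm_mult mult_left_mono)
      finally show "cmod (exp (of_real b * Ln (cquad z e t))) \<le> exp (\<bar>b\<bar> * M)" .
    qed
  qed
  moreover have "exp (of_real b * Ln (cquad z e (of_real t))) = of_real (((z - t *\<^sub>R e) \<bullet> (z - t *\<^sub>R e)) powr b)"
    if "z \<noteq> 0" "norm e = 1" "\<bar>t\<bar> < norm z / 3" for z e :: "real^'n" and t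
    using Ln_cquad_of_real[OF that] by (simp add: powr_def flip: exp_of_real)
  ultimately show ?case
    by (intro exI[where x="\<lambda>z e t. exp (of_real b * Ln (cquad z e t))"])
      (auto simp: line_extends_def intro!: holomorphic_intros holomorphic_Ln_cquad)
next
  case ln
  have "\<exists>M. \<forall>z e t. r \<le> norm z \<longrightarrow> norm (z::real^'n) \<le> R \<longrightarrow> norm e = 1 \<longrightarrow> cmod t < norm z / 3 \<longrightarrow>
      cmod (Ln (cquad z e t)) \<le> M" if r: "0 < r" for r R
    using Ln_cquad_bound[OF r, of R] by blast
  then show ?case
    by (intro exI[where x="\<lambda>z e t. Ln (cquad z e t)"])
      (auto simp: line_extends_def Ln_cquad_of_real intro!: holomorphic_Ln_cquad)
next
  case (add f g)
  then obtain F G where "line_extends f F" "line_extends g G" by blast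
  then have "line_extends (\<lambda>z. f z + g z) (\<lambda>z e t. F z e t + G z e t)"
    by (rule line_extends_op[where opb="(+)"])
      (simp_all add: holomorphic_on_add norm_triangle_mono)
  then show ?case by blast
next
  case (mult f g)
  then obtain F G where "line_extends f F" "line_extends g G" by blast
  moreover have "cmod (u * v) \<le> M * N" if "cmod u \<le> M" "cmod v \<le> N" for u v M N
    unfolding norm_mult using that by (meson mult_mono norm_ge_zero order_trans)
  ultimately have "line_extends (\<lambda>z. f z * g z) (\<lambda>z e t. F z e t * G z e t)"
    using line_extends_op[of f F g G "(*)" "(*)" "(*)"] by (simp add: holomorphic_on_mult)
  then show ?case by blast
qed

text \<open>Cauchy's inequality on the circle of radius \<open>\<rho>\<close>, which fits into the
  disc of radius |z|/3 because 4 \<open>\<rho>\<close> is at most |z|. The essential point is that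
  \<open>M\<close> depends on neither \<open>z\<close> nor \<open>e\<close>. Real parts suffice
  since the function is real on the real axis.\<close>

lemma radial_line_series:
  assumes f: "radial 0 (f :: real^'n::finite \<Rightarrow> real)" and \<rho>: "0 < \<rho>"
  obtains M where "\<And>z e. 4 * \<rho> \<le> norm z \<Longrightarrow> norm z \<le> R \<Longrightarrow> norm e = 1 \<Longrightarrow>
    \<exists>c. (\<forall>m. \<bar>c m\<bar> \<le> M / \<rho> ^ m) \<and> (\<forall>t. \<bar>t\<bar> < \<rho> \<longrightarrow> (\<lambda>m. c m * t ^ m) sums f (z - t *\<^sub>R e))"
proof -
  obtain F where F: "line_extends f F" using radial_line_extends[OF f] by blast
  then have "\<exists>M. \<forall>z e t. 4 * \<rho> \<le> norm z \<longrightarrow> norm z \<le> R \<longrightarrow> norm e = 1 \<longrightarrow> cmod t < norm z / 3 \<longrightarrow> cmod (F z e t) \<le> M"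
    using \<rho> unfolding line_extends_def by auto
  then obtain M where M: "\<And>z e t. 4 * \<rho> \<le> norm z \<Longrightarrow> norm z \<le> R \<Longrightarrow> norm e = 1 \<Longrightarrow> cmod t < norm z / 3 \<Longrightarrow> cmod (F z e t) \<le> M"
    by blast
  show thesis
  proof (rule that)
    fix z e :: "real^'n" assume z: "4 * \<rho> \<le> norm z" "norm z \<le> R" "norm e = 1"
    then have z0: "z \<noteq> 0" and \<rho>z: "\<rho> < norm z / 3" using \<rho> by auto
    have hol: "F z e holomorphic_on ball 0 (norm z / 3)"
      and re: "\<And>t. \<bar>t\<bar> < norm z / 3 \<Longrightarrow> F z e (of_real t) = of_real (f (z - t *\<^sub>R e))"
      using F z z0 unfolding line_extends_def by blast+
    define C where "C = (\<lambda>m. (deriv ^^ m) (F z e) 0 / fact m)"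
    have bound: "cmod (C m) \<le> M / \<rho> ^ m" for m
    proof -
      have "cmod ((deriv ^^ m) (F z e) 0) \<le> fact m * M / \<rho> ^ m"
      proof (rule Cauchy_inequality)
        show "F z e holomorphic_on ball 0 \<rho>" using \<rho>z by (intro holomorphic_on_subset[OF hol] subset_ball) auto
        have "cball 0 \<rho> \<subseteq> ball (0::complex) (norm z / 3)" using \<rho>z by (simp add: cball_subset_ball_iff)
        then show "continuous_on (cball 0 \<rho>) (F z e)"
          by (rule continuous_on_subset[OF holomorphic_on_imp_continuous_on[OF hol]])
        show "cmod (F z e x) \<le> M" if "cmod (0 - x) = \<rho>" for x
          using M[OF z, of x] that \<rho>z by simp
      qed (rule \<rho>)
      then show ?thesis by (simp add: C_def norm_divide field_simps)
    qed
    have "(\<lambda>m. Re (C m) * t ^ m) sums f (z - t *\<^sub>R e)" if t: "\<bar>t\<bar> < \<rho>" for t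
    proof -
      have "(\<lambda>m. (deriv ^^ m) (F z e) 0 / fact m * (of_real t - 0) ^ m) sums F z e (of_real t)"
        by (rule holomorphic_power_series[OF hol]) (use t \<rho>z in auto)
      then have "(\<lambda>m. Re (C m * of_real t ^ m)) sums Re (F z e (of_real t))"
        by (intro sums_Re) (simp add: C_def)
      then show ?thesis using re[of t] t \<rho>z by (simp flip: of_real_power)
    qed
    then show "\<exists>c. (\<forall>m. \<bar>c m\<bar> \<le> M / \<rho> ^ m) \<and> (\<forall>t. \<bar>t\<bar> < \<rho> \<longrightarrow> (\<lambda>m. c m * t ^ m) sums f (z - t *\<^sub>R e))"
      by (intro exI[where x="\<lambda>m. Re (C m)"] conjI allI impI) (auto intro: order_trans[OF abs_Re_le_cmod bound])
  qed
qed

section \<open>Stokes kernels\<close>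

text \<open>Iterated derivatives of a member agree with members only off the origin, where their
  values are meaningful; this weaker class is literally closed under \<open>pds\<close>.\<close>

definition radial0 :: "(real^'n::finite \<Rightarrow> real) \<Rightarrow> bool" where
  "radial0 f \<longleftrightarrow> (\<exists>g. radial 0 g \<and> (\<forall>z. z \<noteq> 0 \<longrightarrow> f z = g z))"

lemma open_punctured: "open (- {0 :: real^'n::finite})"
  by (simp add: open_Compl)

lemma radial0_smooth: "radial0 f \<Longrightarrow> smooth_on f (- {0})"
proof -
  assume "radial0 f"
  then obtain g where g: "radial 0 g" "\<And>z. z \<noteq> 0 \<Longrightarrow> f z = g z" by (auto simp: radial0_def)
  show "smooth_on f (- {0})"
    by (rule smooth_on_cong[OF open_punctured _ radial_smooth_on[OF g(1), unfolded radial_dom_0]]) (simp add: g(2))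
qed

lemma radial0_pds: "radial0 f \<Longrightarrow> radial0 (pds js f)"
proof -
  assume "radial0 f"
  then obtain g where g: "radial 0 g" "\<And>z. z \<noteq> 0 \<Longrightarrow> f z = g z" by (auto simp: radial0_def)
  obtain h where h: "radial 0 h" "\<forall>z\<in>radial_dom 0. pds js g z = h z" using radial_pds[OF g(1)] by blast
  have "pds js f z = h z" if "z \<noteq> 0" for z
    using pds_cong[OF open_punctured, of z f g js] g(2) h(2) that by (simp add: radial_dom_0)
  then show ?thesis using h(1) by (auto simp: radial0_def)
qed

lemma radial0_add: "radial0 f \<Longrightarrow> radial0 g \<Longrightarrow> radial0 (\<lambda>z. f z + g z)"
proof -
  assume "radial0 f" "radial0 g"
  then obtain f' g' where "radial 0 f'" "\<forall>z. z \<noteq> 0 \<longrightarrow> f z = f' z" "radial 0 g'" "\<forall>z. z \<noteq> 0 \<longrightarrow> g z = g' z"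
    by (auto simp: radial0_def)
  then show ?thesis unfolding radial0_def by (intro exI[where x="\<lambda>z. f' z + g' z"]) (auto intro: radial.add)
qed

lemma radial0_cmult: "radial0 f \<Longrightarrow> radial0 (\<lambda>z. c * f z)"
proof -
  assume "radial0 f"
  then obtain f' where "radial 0 f'" "\<forall>z. z \<noteq> 0 \<longrightarrow> f z = f' z" by (auto simp: radial0_def)
  then show ?thesis unfolding radial0_def
    by (intro exI[where x="\<lambda>z. c * f' z"]) (auto intro: radial.mult radial.const)
qed

lemma radial0_zero: "radial0 (\<lambda>z. 0)"
  unfolding radial0_def using radial.const[of 0 0] by auto

lemma radial0_sum: "finite I \<Longrightarrow> (\<And>i. i \<in> I \<Longrightarrow> radial0 (f i)) \<Longrightarrow> radial0 (\<lambda>z. \<Sum>i\<in>I. f i z)"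
  by (induction I rule: finite_induct) (auto intro: radial0_add radial0_zero)

lemma radial0_laplacian: "radial0 f \<Longrightarrow> radial0 (laplacian f)"
  unfolding laplacian_def[abs_def] by (intro radial0_sum radial0_pds) auto

lemma radial0_line_series:
  assumes f: "radial0 (f :: real^'n::finite \<Rightarrow> real)" and \<rho>: "0 < \<rho>"
  shows "\<exists>M. \<forall>z e. 4 * \<rho> \<le> norm z \<longrightarrow> norm z \<le> R \<longrightarrow> norm e = 1 \<longrightarrow>
    (\<exists>c. (\<forall>m. \<bar>c m\<bar> \<le> M / \<rho> ^ m) \<and> (\<forall>t. \<bar>t\<bar> < \<rho> \<longrightarrow> (\<lambda>m. c m * t ^ m) sums f (z - t *\<^sub>R e)))"
proof -
  obtain g where g: "radial 0 g" "\<And>z. z \<noteq> 0 \<Longrightarrow> f z = g z" using f by (auto simp: radial0_def)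
  have eq: "f (z - t *\<^sub>R e) = g (z - t *\<^sub>R e)" if "4 * \<rho> \<le> norm z" "norm e = 1" "\<bar>t\<bar> < \<rho>" for z e :: "real^'n" and t
    by (rule g(2)) (use that \<rho> in auto)
  show ?thesis
  proof (rule radial_line_series[OF g(1) \<rho>, of R], rule exI, intro allI impI)
    fix M :: real and z e :: "real^'n"
    assume M: "\<And>z e. 4 * \<rho> \<le> norm z \<Longrightarrow> norm z \<le> R \<Longrightarrow> norm e = 1 \<Longrightarrow>
      \<exists>c. (\<forall>m. \<bar>c m\<bar> \<le> M / \<rho> ^ m) \<and> (\<forall>t. \<bar>t\<bar> < \<rho> \<longrightarrow> (\<lambda>m. c m * t ^ m) sums g (z - t *\<^sub>R e))"
    assume z: "4 * \<rho> \<le> norm z" "norm z \<le> R" "norm e = 1"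
    obtain c where "\<forall>m. \<bar>c m\<bar> \<le> M / \<rho> ^ m" "\<forall>t. \<bar>t\<bar> < \<rho> \<longrightarrow> (\<lambda>m. c m * t ^ m) sums g (z - t *\<^sub>R e)"
      using M[OF z] by blast
    then show "\<exists>c. (\<forall>m. \<bar>c m\<bar> \<le> M / \<rho> ^ m) \<and> (\<forall>t. \<bar>t\<bar> < \<rho> \<longrightarrow> (\<lambda>m. c m * t ^ m) sums f (z - t *\<^sub>R e))"
      using eq[OF z(1,3)] by (intro exI[where x=c]) simp
  qed
qed

lemma laplacian_pds:
  fixes f :: "real^'n::finite \<Rightarrow> real"
  assumes f: "smooth_on f S" and S: "open S" "x \<in> S"
  shows "laplacian (pds js f) x = pds js (laplacian f) x"
proof -
  have "pds js (laplacian f) x = (\<Sum>j\<in>UNIV. pds js (pds [j, j] f) x)"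
    unfolding laplacian_def[abs_def] by (rule pds_sum[OF S(1) _ smooth_on_pds[OF f] S(2)]) auto
  also have "\<dots> = (\<Sum>j\<in>UNIV. pds [j, j] (pds js f) x)"
    unfolding pds_append[symmetric] by (intro sum.cong pds_comm[OF f S] refl)
  finally show ?thesis by (simp add: laplacian_def)
qed

text \<open>The velocity as a family of scalar functions, so that the calculus of real-valued
  functions applies to each component.\<close>

definition stokes_comp :: "('n::finite \<Rightarrow> real^'n \<Rightarrow> real) \<Rightarrow> (real^'n \<Rightarrow> real) \<Rightarrow> (real^'n) set \<Rightarrow> bool" where
  "stokes_comp u p S \<longleftrightarrow> (\<forall>x\<in>S. (\<forall>i. - laplacian (u i) x + pd i p x = 0) \<and> (\<Sum>i\<in>UNIV. pd i (u i) x) = 0)"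

lemma stokes_on_comp: "stokes_on u p S \<longleftrightarrow> stokes_comp (\<lambda>i x. u x $ i) p S"
  unfolding stokes_on_def stokes_comp_def divergence_def by auto

lemma stokes_comp_cong:
  assumes "open S" "\<And>i x. x \<in> S \<Longrightarrow> u i x = v i x" "\<And>x. x \<in> S \<Longrightarrow> p x = q x" "stokes_comp u p S"
  shows "stokes_comp v q S"
proof -
  have "laplacian (u i) x = laplacian (v i) x" "pd i (u i) x = pd i (v i) x" "pd i p x = pd i q x" if "x \<in> S" for i x
    by (rule laplacian_cong[OF assms(1) that assms(2)] pd_cong[OF assms(1) that assms(2)]
        pd_cong[OF assms(1) that assms(3)]; assumption)+
  then show ?thesis using assms(4) by (simp add: stokes_comp_def)
qed

text \<open>The columns \<open>Some j\<close> form, up to a factor, the Stokes fundamental tensor: the response to a point force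
  in direction \<open>j\<close>. The column \<open>None\<close> is the response to a point source of mass.\<close>

fun kernel_u :: "(real^'n::finite \<Rightarrow> real) \<Rightarrow> 'n option \<Rightarrow> 'n \<Rightarrow> real^'n \<Rightarrow> real" where
  "kernel_u B (Some j) i z = pds [i, j] B z + (if i = j then - 1 else 0) * laplacian B z"
| "kernel_u B None i z = pds [i] (laplacian B) z"

fun kernel_p :: "(real^'n::finite \<Rightarrow> real) \<Rightarrow> 'n option \<Rightarrow> real^'n \<Rightarrow> real" where
  "kernel_p B (Some j) z = pds [j] (laplacian B) z"
| "kernel_p B None z = 0"

text \<open>Moving the poles uses only these two properties of the fundamental solution, so the
  cases N = 2 and N = 3 need no further distinction.\<close>

locale biharmonic =
  fixes B :: "real^'n::finite \<Rightarrow> real"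
  assumes radial_B: "radial 0 B"
    and biharmonic_B: "\<And>z. z \<noteq> 0 \<Longrightarrow> laplacian (laplacian B) z = 0"
begin

lemma radial0_B: "radial0 B"
  using radial_B by (auto simp: radial0_def)

lemma radial0_kernel_u: "radial0 (kernel_u B s i)"
proof (cases s)
  case None
  then have "kernel_u B s i = pds [i] (laplacian B)" by (simp add: fun_eq_iff)
  then show ?thesis using radial0_pds[OF radial0_laplacian[OF radial0_B]] by metis
next
  case (Some j)
  then have "kernel_u B s i = (\<lambda>z. pds [i, j] B z + (if i = j then - 1 else 0) * laplacian B z)"
    by (simp add: fun_eq_iff)
  then show ?thesis
    using radial0_add[OF radial0_pds[OF radial0_B, of "[i, j]"] radial0_cmult[OF radial0_laplacian[OF radial0_B], of "if i = j then - 1 else 0"]]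
    by metis
qed

lemma radial0_kernel_p: "radial0 (kernel_p B s)"
proof (cases s)
  case None
  then have "kernel_p B s = (\<lambda>z. 0)" by (simp add: fun_eq_iff)
  then show ?thesis using radial0_zero by metis
next
  case (Some j)
  then have "kernel_p B s = pds [j] (laplacian B)" by (simp add: fun_eq_iff)
  then show ?thesis using radial0_pds[OF radial0_laplacian[OF radial0_B]] by metis
qed

text \<open>For a force column the Laplacian of d_i d_j B - delta_ij Lap B is d_i d_j Lap B, the
  gradient of the pressure d_j Lap B, and the divergence is d_j Lap B - d_j Lap B. The column
  \<open>None\<close> is the gradient of the harmonic function Lap B, hence harmonic and divergence
  free with zero pressure.\<close>

lemma stokes_kernel: "stokes_comp (kernel_u B s) (kernel_p B s) (- {0})"
  unfolding stokes_comp_def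
proof (intro ballI conjI allI)
  fix z :: "real^'n" and i assume z: "z \<in> - {0}"
  note sB = radial0_smooth[OF radial0_B]
  note sLB = radial0_smooth[OF radial0_laplacian[OF radial0_B]]
  have LL: "laplacian (laplacian B) z = 0" using biharmonic_B z by simp
  have pLL: "pds js (laplacian (laplacian B)) z = 0" for js
    by (rule pds_eq_0[OF open_punctured z]) (simp add: biharmonic_B)
  show "- laplacian (kernel_u B s i) z + pd i (kernel_p B s) z = 0"
  proof (cases s)
    case None
    then have "kernel_u B s i = pds [i] (laplacian B)" "kernel_p B s = (\<lambda>z. 0)" by (simp_all add: fun_eq_iff)
    moreover have "laplacian (pds [i] (laplacian B)) z = 0"
      using laplacian_pds[OF sLB open_punctured z, of "[i]"] pLL by metis
    moreover have "pd i (\<lambda>z. 0::real) z = 0" using has_pd_imp_pd[OF has_pd_const] .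
    ultimately show ?thesis by simp
  next
    case (Some j)
    then have eq: "kernel_u B s i = (\<lambda>z. pds [i, j] B z + (if i = j then - 1 else 0) * laplacian B z)"
      "kernel_p B s = pds [j] (laplacian B)" by (simp_all add: fun_eq_iff)
    have "laplacian (kernel_u B s i) z = laplacian (pds [i, j] B) z + (if i = j then - 1 else 0) * laplacian (laplacian B) z"
      unfolding eq by (simp only: laplacian_add[OF open_punctured smooth_on_pds[OF sB] smooth_on_cmult[OF open_punctured sLB] z]
          laplacian_cmult[OF open_punctured sLB z])
    also have "\<dots> = pds [i, j] (laplacian B) z"
      using laplacian_pds[OF sB open_punctured z, of "[i, j]"] LL by simp
    also have "\<dots> = pd i (kernel_p B s) z" unfolding eq by simp
    finally show ?thesis by simp
  qed
  show "(\<Sum>i\<in>UNIV. pd i (kernel_u B s i) z) = 0"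
  proof (cases s)
    case None
    then have "kernel_u B s i = pds [i] (laplacian B)" for i by (simp add: fun_eq_iff)
    then have "(\<Sum>i\<in>UNIV. pd i (kernel_u B s i) z) = laplacian (laplacian B) z"
      by (simp add: laplacian_def)
    then show ?thesis using LL by simp
  next
    case (Some j)
    have "pd i (kernel_u B s i) z = pds [i, i] (pds [j] B) z + (if i = j then - pds [j] (laplacian B) z else 0)" for i
    proof -
      have "kernel_u B s i = (\<lambda>z. pds [i, j] B z + (if i = j then - 1 else 0) * laplacian B z)"
        using Some by (simp add: fun_eq_iff)
      then have "pd i (kernel_u B s i) z = pds [i] (\<lambda>z. pds [i, j] B z + (if i = j then - 1 else 0) * laplacian B z) z" by simp
      also have "\<dots> = pds [i] (pds [i, j] B) z + (if i = j then - 1 else 0) * pds [i] (laplacian B) z"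
        by (simp only: pds_add[OF open_punctured smooth_on_pds[OF sB] smooth_on_cmult[OF open_punctured sLB] z]
          pds_cmult[OF open_punctured sLB z])
      finally show ?thesis by auto
    qed
    then have "(\<Sum>i\<in>UNIV. pd i (kernel_u B s i) z) = laplacian (pds [j] B) z - pds [j] (laplacian B) z"
      by (simp add: sum.distrib laplacian_def del: pds.simps)
    then show ?thesis using laplacian_pds[OF sB open_punctured z, of "[j]"] by simp
  qed
qed

end

section \<open>Approximation by global Stokes solutions\<close>

text \<open>The target \<open>f\<close> is a bare table of numbers for derivative, point and
  component, not the jet of a function. This admits power series coefficients, chosen separately for
  each entry, as targets. Only the velocity has to be close; the pressure merely completes the
  solution.\<close>

definition approx :: "(real^'n::finite) set \<Rightarrow> (real^'n) set \<Rightarrow> nat \<Rightarrow> ('n list \<Rightarrow> real^'n \<Rightarrow> 'n \<Rightarrow> real) \<Rightarrow> bool" where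
  "approx \<Omega> K k f \<longleftrightarrow> (\<forall>\<epsilon>>0. \<exists>u p. (\<forall>i. smooth_compact_support (u i)) \<and> smooth_compact_support p \<and>
     stokes_comp u p \<Omega> \<and> (\<forall>js x i. length js \<le> k \<longrightarrow> x \<in> K \<longrightarrow> \<bar>pds js (u i) x - f js x i\<bar> \<le> \<epsilon>))"

lemma approxE:
  assumes "approx \<Omega> K k f" "\<epsilon> > 0"
  obtains u p where "\<And>i. smooth_compact_support (u i)" "smooth_compact_support p" "stokes_comp u p \<Omega>"
    "\<And>js x i. length js \<le> k \<Longrightarrow> x \<in> K \<Longrightarrow> \<bar>pds js (u i) x - f js x i\<bar> \<le> \<epsilon>"
  using assms unfolding approx_def by metis

lemma approx_limit:
  assumes "\<And>\<epsilon>. \<epsilon> > 0 \<Longrightarrow> \<exists>g. approx \<Omega> K k g \<and> (\<forall>js x i. length js \<le> k \<longrightarrow> x \<in> K \<longrightarrow> \<bar>g js x i - f js x i\<bar> \<le> \<epsilon>)"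
  shows "approx \<Omega> K k f"
  unfolding approx_def
proof (intro allI impI)
  fix \<epsilon> :: real assume "\<epsilon> > 0"
  then have e: "\<epsilon> / 2 > 0" by simp
  obtain g where g: "approx \<Omega> K k g" "\<And>js x i. length js \<le> k \<Longrightarrow> x \<in> K \<Longrightarrow> \<bar>g js x i - f js x i\<bar> \<le> \<epsilon> / 2"
    using assms[OF e] by blast
  obtain u p where u: "\<And>i. smooth_compact_support (u i)" "smooth_compact_support p" "stokes_comp u p \<Omega>"
    "\<And>js x i. length js \<le> k \<Longrightarrow> x \<in> K \<Longrightarrow> \<bar>pds js (u i) x - g js x i\<bar> \<le> \<epsilon> / 2"
    using g(1) e by (rule approxE) blast
  have "\<bar>pds js (u i) x - f js x i\<bar> \<le> \<epsilon>" if "length js \<le> k" "x \<in> K" for js x i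
    using g(2)[OF that, of i] u(4)[OF that, of i] by linarith
  then show "\<exists>u p. (\<forall>i. smooth_compact_support (u i)) \<and> smooth_compact_support p \<and>
     stokes_comp u p \<Omega> \<and> (\<forall>js x i. length js \<le> k \<longrightarrow> x \<in> K \<longrightarrow> \<bar>pds js (u i) x - f js x i\<bar> \<le> \<epsilon>)"
    using u(1-3) by blast
qed

lemma approx_cong:
  assumes "approx \<Omega> K k g" "\<And>js x i. length js \<le> k \<Longrightarrow> x \<in> K \<Longrightarrow> g js x i = f js x i"
  shows "approx \<Omega> K k f"
  by (rule approx_limit, rule exI[where x=g]) (simp add: assms)

lemma pd_add_real:
  fixes f g :: "real^'n::finite \<Rightarrow> real"
  assumes "smooth_on f UNIV" "smooth_on g UNIV"
  shows "pd i (\<lambda>x. a * f x + b * g x) x = a * pd i f x + b * pd i g x"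
  using pds_add[OF open_UNIV smooth_on_cmult[OF open_UNIV assms(1), of a] smooth_on_cmult[OF open_UNIV assms(2), of b] UNIV_I, of "[i]"]
    pds_cmult[OF open_UNIV assms(1) UNIV_I, of "[i]"] pds_cmult[OF open_UNIV assms(2) UNIV_I, of "[i]"] by simp

lemma approx_lincomb:
  assumes f: "approx \<Omega> K k f" and g: "approx \<Omega> K k g"
  shows "approx \<Omega> K k (\<lambda>js x i. a * f js x i + b * g js x i)"
  unfolding approx_def
proof (intro allI impI)
  fix \<epsilon> :: real assume e: "\<epsilon> > 0"
  define \<delta> where "\<delta> = \<epsilon> / (\<bar>a\<bar> + \<bar>b\<bar> + 1)"
  have d: "\<delta> > 0" "(\<bar>a\<bar> + \<bar>b\<bar>) * \<delta> \<le> \<epsilon>" using e by (auto simp: \<delta>_def field_simps)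
  obtain u p where u: "\<And>i. smooth_compact_support (u i)" "smooth_compact_support p" "stokes_comp u p \<Omega>"
    "\<And>js x i. length js \<le> k \<Longrightarrow> x \<in> K \<Longrightarrow> \<bar>pds js (u i) x - f js x i\<bar> \<le> \<delta>"
    using f d(1) by (rule approxE) blast
  obtain v q where v: "\<And>i. smooth_compact_support (v i)" "smooth_compact_support q" "stokes_comp v q \<Omega>"
    "\<And>js x i. length js \<le> k \<Longrightarrow> x \<in> K \<Longrightarrow> \<bar>pds js (v i) x - g js x i\<bar> \<le> \<delta>"
    using g d(1) by (rule approxE) blast
  let ?w = "\<lambda>i x. a * u i x + b * v i x" and ?r = "\<lambda>x. a * p x + b * q x"
  have su: "smooth_on (u i) UNIV" "smooth_on (v i) UNIV" for i using u(1) v(1) scs_smooth by auto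
  have sp: "smooth_on p UNIV" "smooth_on q UNIV" using u(2) v(2) scs_smooth by auto
  have pds_w: "pds js (?w i) x = a * pds js (u i) x + b * pds js (v i) x" for js i x
    using pds_add[OF open_UNIV smooth_on_cmult[OF open_UNIV su(1)] smooth_on_cmult[OF open_UNIV su(2)] UNIV_I]
      pds_cmult[OF open_UNIV su(1) UNIV_I] pds_cmult[OF open_UNIV su(2) UNIV_I] by simp
  have lap_w: "laplacian (?w i) x = a * laplacian (u i) x + b * laplacian (v i) x" for i x
    unfolding laplacian_def pds_w by (simp add: sum.distrib sum_distrib_left)
  have st: "stokes_comp ?w ?r \<Omega>"
    unfolding stokes_comp_def
  proof (intro ballI conjI allI)
    fix x i assume x: "x \<in> \<Omega>"
    have "- laplacian (?w i) x + pd i ?r x = a * (- laplacian (u i) x + pd i p x) + b * (- laplacian (v i) x + pd i q x)"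
      unfolding lap_w pd_add_real[OF sp] by (simp add: algebra_simps)
    then show "- laplacian (?w i) x + pd i ?r x = 0" using u(3) v(3) x by (simp add: stokes_comp_def)
    have "(\<Sum>i\<in>UNIV. pd i (?w i) x) = a * (\<Sum>i\<in>UNIV. pd i (u i) x) + b * (\<Sum>i\<in>UNIV. pd i (v i) x)"
      unfolding pd_add_real[OF su] by (simp add: sum.distrib sum_distrib_left)
    then show "(\<Sum>i\<in>UNIV. pd i (?w i) x) = 0" using u(3) v(3) x by (simp add: stokes_comp_def)
  qed
  have "\<bar>pds js (?w i) x - (a * f js x i + b * g js x i)\<bar> \<le> \<epsilon>" if "length js \<le> k" "x \<in> K" for js x i
  proof -
    have "pds js (?w i) x - (a * f js x i + b * g js x i) = a * (pds js (u i) x - f js x i) + b * (pds js (v i) x - g js x i)"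
      unfolding pds_w by (simp add: algebra_simps)
    also have "\<bar>\<dots>\<bar> \<le> \<bar>a\<bar> * \<bar>pds js (u i) x - f js x i\<bar> + \<bar>b\<bar> * \<bar>pds js (v i) x - g js x i\<bar>"
      by (rule order_trans[OF abs_triangle_ineq]) (simp add: abs_mult)
    also have "\<dots> \<le> \<bar>a\<bar> * \<delta> + \<bar>b\<bar> * \<delta>"
      using u(4)[OF that] v(4)[OF that] by (intro add_mono mult_left_mono) auto
    finally show ?thesis using d(2) by (simp add: algebra_simps)
  qed
  then show "\<exists>u p. (\<forall>i. smooth_compact_support (u i)) \<and> smooth_compact_support p \<and>
     stokes_comp u p \<Omega> \<and> (\<forall>js x i. length js \<le> k \<longrightarrow> x \<in> K \<longrightarrow> \<bar>pds js (u i) x - (a * f js x i + b * g js x i)\<bar> \<le> \<epsilon>)"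
    using scs_add[OF scs_cmult[OF u(1)] scs_cmult[OF v(1)]] scs_add[OF scs_cmult[OF u(2)] scs_cmult[OF v(2)]] st
    by (intro exI[where x="?w"] exI[where x="?r"]) blast
qed

lemma approx_zero: "approx \<Omega> K k (\<lambda>js x i. 0)"
proof -
  have "smooth_compact_support (\<lambda>x::real^'a. 0::real)"
    by (rule smooth_compact_supportI[where C="{}"]) (auto intro: smooth_on_const)
  moreover have "stokes_comp (\<lambda>i x. 0) (\<lambda>x::real^'a. 0) \<Omega>"
    unfolding stokes_comp_def laplacian_def
    by (simp only: pds_zero has_pd_imp_pd[OF has_pd_const]) simp
  ultimately show ?thesis
    unfolding approx_def by (intro allI impI exI[where x="\<lambda>i x. 0"] exI[where x="\<lambda>x. 0"]) auto
qed

lemma approx_sum: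
  assumes "finite I" "\<And>m. m \<in> I \<Longrightarrow> approx \<Omega> K k (f m)"
  shows "approx \<Omega> K k (\<lambda>js x i. \<Sum>m\<in>I. a m * f m js x i)"
  using assms
proof (induction I)
  case (insert m I)
  then have "approx \<Omega> K k (\<lambda>js x i. a m * f m js x i + 1 * (\<Sum>m\<in>I. a m * f m js x i))"
    by (intro approx_lincomb) auto
  then show ?case using insert by simp
qed (simp add: approx_zero)

section \<open>Power series whose values are approximable near 0\<close>

lemma geometric_tail_bound:
  fixes c :: "nat \<Rightarrow> real"
  assumes c: "\<And>m. \<bar>c m\<bar> \<le> M / \<rho> ^ m" and \<rho>: "0 < \<rho>" and t: "\<bar>t\<bar> < \<rho>" and s: "(\<lambda>m. c m * t ^ m) sums S"
  shows "\<bar>S - (\<Sum>m<n. c m * t ^ m)\<bar> \<le> M * (\<bar>t\<bar> / \<rho>) ^ n / (1 - \<bar>t\<bar> / \<rho>)"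
proof -
  let ?q = "\<bar>t\<bar> / \<rho>"
  have q: "0 \<le> ?q" "?q < 1" using \<rho> t by auto
  have b: "norm (c (m + n) * t ^ (m + n)) \<le> M * ?q ^ n * ?q ^ m" for m
  proof -
    have "norm (c (m + n) * t ^ (m + n)) \<le> M / \<rho> ^ (m + n) * \<bar>t\<bar> ^ (m + n)"
      unfolding real_norm_def abs_mult power_abs by (intro mult_right_mono c) auto
    also have "\<dots> = M * ?q ^ n * ?q ^ m" by (simp add: power_divide power_add mult_ac)
    finally show ?thesis .
  qed
  have s1: "(\<lambda>m. c (m + n) * t ^ (m + n)) sums (S - (\<Sum>m<n. c m * t ^ m))"
    by (rule sums_split_initial_segment[OF s])
  have s2: "(\<lambda>m. M * ?q ^ n * ?q ^ m) sums (M * ?q ^ n * (1 / (1 - ?q)))"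
    by (rule sums_mult[OF geometric_sums]) (use q in auto)
  have "norm (\<Sum>m. c (m + n) * t ^ (m + n)) \<le> (\<Sum>m. M * ?q ^ n * ?q ^ m)"
    by (rule norm_suminf_le[OF b sums_summable[OF s2]])
  then show ?thesis using sums_unique[OF s1] sums_unique[OF s2] by simp
qed

text \<open>The coefficients are approximable one after the other: \<open>c m\<close> is the limit as \<open>t\<close> tends to \<open>0\<close> of
  \<open>(h t - (\<Sum>j<m. c j * t ^ j)) / t ^ m\<close>.\<close>

lemma approx_power_series:
  fixes c :: "nat \<Rightarrow> 'n::finite list \<Rightarrow> real^'n \<Rightarrow> 'n \<Rightarrow> real"
  assumes c: "\<And>m js x i. length js \<le> k \<Longrightarrow> x \<in> K \<Longrightarrow> \<bar>c m js x i\<bar> \<le> M / \<rho> ^ m"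
    and h: "\<And>t js x i. length js \<le> k \<Longrightarrow> x \<in> K \<Longrightarrow> \<bar>t\<bar> < \<rho> \<Longrightarrow> (\<lambda>m. c m js x i * t ^ m) sums h t js x i"
    and \<rho>: "0 < \<rho>" and \<delta>: "0 < \<delta>" and small: "\<And>t. \<bar>t\<bar> < \<delta> \<Longrightarrow> approx \<Omega> K k (h t)"
    and t: "\<bar>t\<bar> < \<rho>"
  shows "approx \<Omega> K k (h t)"
proof -
  have coeff: "approx \<Omega> K k (c m)" for m
  proof (induction m rule: less_induct)
    case (less m)
    show ?case
    proof (rule approx_limit)
      fix \<epsilon> :: real assume e: "\<epsilon> > 0"
      \<comment> \<open>For s at most \<open>\<rho>/2\<close> the geometric tail after order m,
        divided by \<open>s ^ m\<close>, is at most
        \<open>2 * \<bar>M\<bar> / \<rho> ^ Suc m * s\<close>. Adding 1 keeps \<open>A\<close>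
        positive for the division by it.\<close>
      define A where "A = 2 * \<bar>M\<bar> / \<rho> ^ Suc m + 1"
      have A: "A > 0" using \<rho> by (auto simp: A_def intro!: add_nonneg_pos)
      define s where "s = min (min (\<rho> / 2) (\<delta> / 2)) (\<epsilon> / A)"
      have s: "0 < s" "s \<le> \<rho> / 2" "s < \<rho>" "s < \<delta>" "A * s \<le> \<epsilon>"
      proof -
        show "0 < s" using \<rho> \<delta> e A by (simp add: s_def)
        show "s \<le> \<rho> / 2" unfolding s_def by linarith
        then show "s < \<rho>" using \<rho> by linarith
        have "s \<le> \<delta> / 2" unfolding s_def by linarith
        then show "s < \<delta>" using \<delta> by linarith
        have "s \<le> \<epsilon> / A" by (simp add: s_def)
        then show "A * s \<le> \<epsilon>" using A by (simp add: field_simps)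
      qed
      let ?g = "\<lambda>js x i. (1 / s ^ m) * h s js x i + (- 1 / s ^ m) * (\<Sum>j<m. s ^ j * c j js x i)"
      have "approx \<Omega> K k ?g"
        by (intro approx_lincomb approx_sum small) (use s less in auto)
      moreover have "\<bar>?g js x i - c m js x i\<bar> \<le> \<epsilon>" if js: "length js \<le> k" "x \<in> K" for js x i
      proof -
        have "\<bar>h s js x i - (\<Sum>j<Suc m. c j js x i * s ^ j)\<bar> \<le> M * (\<bar>s\<bar> / \<rho>) ^ Suc m / (1 - \<bar>s\<bar> / \<rho>)"
          by (rule geometric_tail_bound[OF c[OF js] \<rho> _ h[OF js]]) (use s in auto)
        also have "\<dots> \<le> \<bar>M\<bar> * (s / \<rho>) ^ Suc m / (1 / 2)"
          using s \<rho> by (intro frac_le mult_right_mono) (auto simp: field_simps)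
        also have "\<dots> = s ^ m * (2 * \<bar>M\<bar> / \<rho> ^ Suc m * s)" by (simp add: power_divide)
        also have "\<dots> \<le> s ^ m * (A * s)" using s by (intro mult_left_mono mult_right_mono) (auto simp: A_def)
        also have "\<dots> \<le> s ^ m * \<epsilon>" using s by (intro mult_left_mono) auto
        finally have le: "\<bar>h s js x i - (\<Sum>j<Suc m. c j js x i * s ^ j)\<bar> \<le> s ^ m * \<epsilon>" .
        have "?g js x i - c m js x i = (h s js x i - (\<Sum>j<Suc m. c j js x i * s ^ j)) / s ^ m"
          using s by (simp add: field_simps)
        then show ?thesis using le s by (simp add: abs_divide field_simps)
      qed
      ultimately show "\<exists>g. approx \<Omega> K k g \<and> (\<forall>js x i. length js \<le> k \<longrightarrow> x \<in> K \<longrightarrow> \<bar>g js x i - c m js x i\<bar> \<le> \<epsilon>)"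
        by blast
    qed
  qed
  \<comment> \<open>The coefficients, found from small parameters alone, now give uniformly
    convergent partial sums for every parameter below \<open>\<rho>\<close>.\<close>
  show ?thesis
  proof (rule approx_limit)
    fix \<epsilon> :: real assume e: "\<epsilon> > 0"
    have "(\<lambda>n. M * (\<bar>t\<bar> / \<rho>) ^ n / (1 - \<bar>t\<bar> / \<rho>)) \<longlonglongrightarrow> M * 0 / (1 - \<bar>t\<bar> / \<rho>)"
      using t \<rho> by (intro tendsto_intros LIMSEQ_power_zero) auto
    then have "\<forall>\<^sub>F n in sequentially. M * (\<bar>t\<bar> / \<rho>) ^ n / (1 - \<bar>t\<bar> / \<rho>) < \<epsilon>"
      using e by (intro order_tendstoD) auto
    then obtain n where n: "M * (\<bar>t\<bar> / \<rho>) ^ n / (1 - \<bar>t\<bar> / \<rho>) < \<epsilon>"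
      unfolding eventually_sequentially by blast
    have "\<bar>(\<Sum>m<n. t ^ m * c m js x i) - h t js x i\<bar> \<le> \<epsilon>" if js: "length js \<le> k" "x \<in> K" for js x i
      using geometric_tail_bound[OF c[OF js] \<rho> t h[OF js t], of i n] n by (simp add: abs_minus_commute mult.commute)
    moreover have "approx \<Omega> K k (\<lambda>js x i. \<Sum>m<n. t ^ m * c m js x i)"
      by (intro approx_sum coeff) auto
    ultimately show "\<exists>g. approx \<Omega> K k g \<and> (\<forall>js x i. length js \<le> k \<longrightarrow> x \<in> K \<longrightarrow> \<bar>g js x i - h t js x i\<bar> \<le> \<epsilon>)"
      by blast
  qed
qed

lemma finite_lists_le: "finite {js :: 'n::finite list. length js \<le> k}"
  using finite_lists_length_le[of "UNIV :: 'n set" k] by simp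

section \<open>Poles outside the domain, moving poles, and superpositions of kernels\<close>

context biharmonic
begin

abbreviation kernel_jet :: "'n option \<Rightarrow> real^'n \<Rightarrow> 'n list \<Rightarrow> real^'n \<Rightarrow> 'n \<Rightarrow> real" where
  "kernel_jet s y js x i \<equiv> pds js (kernel_u B s i) (x - y)"

text \<open>Since \<open>y\<close> is an interior point of the complement, even the closure of
  \<open>\<Omega>\<close> misses it, and a cutoff can be 1 near that closure and 0 near
  \<open>y\<close>. The truncated kernel is then an exact solution on \<open>\<Omega>\<close> with
  unchanged jet on \<open>K\<close>.\<close>

lemma approx_kernel_outside:
  assumes Om: "bounded \<Omega>" "K \<subseteq> \<Omega>" and y: "y \<in> interior (- \<Omega>)"
  shows "approx \<Omega> K k (kernel_jet s y)"
proof -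
  have A: "compact (closure \<Omega>)" using Om(1) by (simp add: compact_closure)
  have yA: "closure \<Omega> \<subseteq> - {y}" using y by (auto simp: interior_complement)
  obtain \<eta> U C where c: "smooth_on \<eta> UNIV" "compact C" "C \<subseteq> - {y}" "\<And>x. x \<notin> C \<Longrightarrow> \<eta> x = (0::real)"
    "open U" "closure \<Omega> \<subseteq> U" "\<And>x. x \<in> U \<Longrightarrow> \<eta> x = 1"
    using smooth_cutoff[OF A open_Compl[OF closed_singleton] yA] by metis
  define u where "u = (\<lambda>i x. \<eta> x * kernel_u B s i (x - y))"
  define p where "p = (\<lambda>x. \<eta> x * kernel_p B s (x - y))"
  have tr: "smooth_on (\<lambda>x. f (x - y)) (- {y})" if "radial0 f" for f
    by (rule smooth_on_translate[OF radial0_smooth[OF that]]) auto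
  have "smooth_on (u i) UNIV" for i unfolding u_def
    by (rule smooth_on_cutoff_mult[OF _ tr[OF radial0_kernel_u] c(1) compact_imp_closed[OF c(2)] c(3,4)]) auto
  then have su: "smooth_compact_support (u i)" for i
    by (rule smooth_compact_supportI[OF _ c(2)]) (simp add: u_def c(4))
  have "smooth_on p UNIV" unfolding p_def
    by (rule smooth_on_cutoff_mult[OF _ tr[OF radial0_kernel_p] c(1) compact_imp_closed[OF c(2)] c(3,4)]) auto
  then have sp: "smooth_compact_support p"
    by (rule smooth_compact_supportI[OF _ c(2)]) (simp add: p_def c(4))
  have UC: "U \<subseteq> - {y}"
  proof
    fix x assume "x \<in> U"
    then have "\<eta> x \<noteq> 0" using c(7) by simp
    then show "x \<in> - {y}" using c(3,4) by blast
  qed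
  have "stokes_comp u p U"
  proof (rule stokes_comp_cong[OF c(5)])
    show "stokes_comp (\<lambda>i x. kernel_u B s i (x - y)) (\<lambda>x. kernel_p B s (x - y)) U"
      unfolding stokes_comp_def
    proof (intro ballI conjI allI)
      fix x i assume "x \<in> U"
      then have x: "x - y \<in> - {0}" using UC by auto
      have tl: "laplacian (\<lambda>x. f (x - y)) x = laplacian f (x - y)" for f :: "real^'n \<Rightarrow> real"
        unfolding laplacian_def pds_translate by simp
      have tp: "pd i (\<lambda>x. f (x - y)) x = pd i f (x - y)" for f :: "real^'n \<Rightarrow> real" and i
        using pds_translate[of "[i]"] by simp
      show "- laplacian (\<lambda>x. kernel_u B s i (x - y)) x + pd i (\<lambda>x. kernel_p B s (x - y)) x = 0"
        "(\<Sum>i\<in>UNIV. pd i (\<lambda>x. kernel_u B s i (x - y)) x) = 0"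
        using stokes_kernel[of s] x unfolding tl tp stokes_comp_def by blast+
    qed
  qed (auto simp: u_def p_def c(7))
  then have st: "stokes_comp u p \<Omega>" using c(6) closure_subset unfolding stokes_comp_def by blast
  have eq: "pds js (u i) x = kernel_jet s y js x i" if "x \<in> K" for js x i
  proof -
    have "x \<in> U" using that Om(2) c(6) closure_subset by blast
    then have "pds js (u i) x = pds js (\<lambda>x. kernel_u B s i (x - y)) x"
      by (intro pds_cong[OF c(5)]) (auto simp: u_def c(7))
    then show ?thesis by (simp add: pds_translate)
  qed
  show ?thesis
    unfolding approx_def using su sp st eq
    by (intro allI impI exI[where x=u] exI[where x=p]) auto
qed

text \<open>However small the ball of known good poles around \<open>y1\<close> is, all poles within
  \<open>\<rho>\<close> become good, and \<open>\<rho>\<close> depends only on the distance to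
  \<open>K\<close>. This independence of \<open>\<delta>\<close> is what makes the set of good poles
  relatively closed.\<close>

lemma approx_kernel_ball:
  assumes K: "compact K" and \<rho>: "0 < \<rho>" and far: "\<And>x. x \<in> K \<Longrightarrow> 4 * \<rho> \<le> dist x y1"
    and \<delta>: "0 < \<delta>" and small: "\<And>y. dist y y1 < \<delta> \<Longrightarrow> approx \<Omega> K k (kernel_jet s y)"
    and y: "dist y y1 < \<rho>"
  shows "approx \<Omega> K k (kernel_jet s y)"
proof (cases "y = y1")
  case True
  then show ?thesis using small[of y] \<delta> by simp
next
  case False
  \<comment> \<open>Moving the pole from \<open>y1\<close> to \<open>y1 + t e\<close> evaluates the
    kernel at z - t e with z = x - y1.\<close>
  define t e where "t = norm (y - y1)" and "e = (1 / t) *\<^sub>R (y - y1)"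
  have t: "t > 0" "t < \<rho>" using False y by (auto simp: t_def dist_norm)
  have e: "norm e = 1" "y1 + t *\<^sub>R e = y" using t by (auto simp: e_def t_def)
  obtain R where R: "\<And>x. x \<in> K \<Longrightarrow> norm (x - y1) \<le> R"
  proof -
    have "compact ((\<lambda>x. x - y1) ` K)" by (intro compact_continuous_image K continuous_intros)
    then have "bounded ((\<lambda>x. x - y1) ` K)" by (rule compact_imp_bounded)
    then obtain b where b: "\<forall>v\<in>(\<lambda>x. x - y1) ` K. norm v \<le> b" unfolding bounded_iff by blast
    show thesis by (rule that[of b]) (use b in blast)
  qed
  define PM where "PM js i M \<longleftrightarrow> (\<forall>z e. 4 * \<rho> \<le> norm z \<longrightarrow> norm z \<le> R \<longrightarrow> norm e = 1 \<longrightarrow>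
    (\<exists>c. (\<forall>m. \<bar>c m\<bar> \<le> M / \<rho> ^ m) \<and> (\<forall>t. \<bar>t\<bar> < \<rho> \<longrightarrow> (\<lambda>m. c m * t ^ m) sums pds js (kernel_u B s i) (z - t *\<^sub>R e))))"
    for js i M
  have "\<exists>M. PM js i M" for js i
    unfolding PM_def by (rule radial0_line_series[OF radial0_pds[OF radial0_kernel_u] \<rho>])
  then obtain M where M: "\<And>js i. PM js i (M js i)" by metis
  define Pc where "Pc js x i c \<longleftrightarrow> (\<forall>m. \<bar>c m\<bar> \<le> M js i / \<rho> ^ m) \<and>
    (\<forall>t. \<bar>t\<bar> < \<rho> \<longrightarrow> (\<lambda>m. c m * t ^ m) sums pds js (kernel_u B s i) (x - y1 - t *\<^sub>R e))" for js x i c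
  have "\<exists>c. Pc js x i c" if "x \<in> K" for js x i
    unfolding Pc_def
    by (rule M[of js i, unfolded PM_def, rule_format]) (use R far that e(1) in \<open>simp_all add: dist_norm\<close>)
  then have Pc: "x \<in> K \<Longrightarrow> Pc js x i (SOME c. Pc js x i c)" for js x i by (rule someI_ex)
  define c where "c js x i = (SOME c. Pc js x i c)" for js x i
  have c: "\<bar>c js x i m\<bar> \<le> M js i / \<rho> ^ m"
    "\<bar>t\<bar> < \<rho> \<Longrightarrow> (\<lambda>m. c js x i m * t ^ m) sums pds js (kernel_u B s i) (x - y1 - t *\<^sub>R e)"
    if "x \<in> K" for js x i m t
  proof -
    have "Pc js x i (c js x i)" unfolding c_def by (rule Pc[OF that])
    then show "\<bar>c js x i m\<bar> \<le> M js i / \<rho> ^ m"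
      "\<bar>t\<bar> < \<rho> \<Longrightarrow> (\<lambda>m. c js x i m * t ^ m) sums pds js (kernel_u B s i) (x - y1 - t *\<^sub>R e)"
      unfolding Pc_def by blast+
  qed
  \<comment> \<open>Only finitely many derivatives and components are involved, so one constant
    bounds the coefficients of all entries.\<close>
  define N where "N = (\<Sum>js\<in>{js. length js \<le> k}. \<Sum>i\<in>UNIV. \<bar>M js i\<bar>)"
  have N: "M js i \<le> N" if "length js \<le> k" for js i
  proof -
    have "\<bar>M js i\<bar> \<le> (\<Sum>i\<in>UNIV. \<bar>M js i\<bar>)" by (rule member_le_sum) auto
    also have "\<dots> \<le> N" unfolding N_def
      by (rule member_le_sum[of js _ "\<lambda>js. \<Sum>i\<in>UNIV. \<bar>M js i\<bar>"]) (use that finite_lists_le in \<open>auto intro: sum_nonneg\<close>)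
    finally show ?thesis by simp
  qed
  have "approx \<Omega> K k (kernel_jet s (y1 + t *\<^sub>R e))"
  proof (rule approx_power_series[where c="\<lambda>m js x i. c js x i m" and M=N and \<delta>=\<delta> and h="\<lambda>t. kernel_jet s (y1 + t *\<^sub>R e)"])
    show "\<bar>c js x i m\<bar> \<le> N / \<rho> ^ m" if "length js \<le> k" "x \<in> K" for m js x i
    proof -
      have "M js i / \<rho> ^ m \<le> N / \<rho> ^ m" using N[OF that(1)] \<rho> by (intro divide_right_mono) auto
      then show ?thesis using c(1)[OF that(2), of js i m] by linarith
    qed
    show "(\<lambda>m. c js x i m * t ^ m) sums kernel_jet s (y1 + t *\<^sub>R e) js x i" if "x \<in> K" "\<bar>t\<bar> < \<rho>" for t js x i
      using c(2)[OF that] by (simp add: algebra_simps)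
    show "approx \<Omega> K k (kernel_jet s (y1 + t *\<^sub>R e))" if "\<bar>t\<bar> < \<delta>" for t
      by (rule small) (use that e in \<open>simp add: dist_norm\<close>)
  qed (use \<rho> \<delta> t in auto)
  then show ?thesis using e by simp
qed

text \<open>Within the component of \<open>y\<close>, the interior of the set of good poles is open,
  relatively closed by the ball lemma, and nonempty by the assumption on components.\<close>

lemma approx_kernel:
  assumes K: "compact K" and Om: "bounded \<Omega>" "K \<subseteq> \<Omega>"
    and comps: "\<forall>x\<in>- K. \<exists>y\<in>connected_component_set (- K) x. y \<in> interior (- \<Omega>)"
    and y: "y \<notin> K"
  shows "approx \<Omega> K k (kernel_jet s y)"
proof -
  define E where "E = {y. approx \<Omega> K k (kernel_jet s y)}"
  define C where "C = connected_component_set (- K) y"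
  have opK: "open (- K)" using compact_imp_closed[OF K] by (rule open_Compl)
  have clopen: "z \<in> interior E" if z: "z \<in> C" "z \<in> closure (interior E)" for z
  proof -
    have "z \<in> - K" using z(1) connected_component_subset unfolding C_def by blast
    then obtain d where d: "d > 0" "ball z d \<subseteq> - K" using opK open_contains_ball by blast
    obtain y1 where y1: "y1 \<in> interior E" "dist y1 z < d / 10"
      using z(2) d(1) unfolding closure_approachable by (metis divide_pos_pos zero_less_numeral)
    obtain \<delta> where \<delta>: "\<delta> > 0" "ball y1 \<delta> \<subseteq> E" using y1(1) mem_interior by blast
    have "ball z (d / 10) \<subseteq> E"
    proof
      fix y assume y: "y \<in> ball z (d / 10)"
      have "approx \<Omega> K k (kernel_jet s y)"
      proof (rule approx_kernel_ball[OF K])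
        \<comment> \<open>With \<open>y1\<close> within d/10 of \<open>z\<close>, the distance from
          \<open>y1\<close> to \<open>K\<close> is at least 9d/10, hence 4 (d/5), while the ball of
          radius d/10 around \<open>z\<close> lies within d/5 of \<open>y1\<close>.\<close>
        show "0 < d / 5" using d by simp
        show "4 * (d / 5) \<le> dist x y1" if "x \<in> K" for x
        proof -
          have "d \<le> dist z x" using d(2) that by (meson ComplD linorder_not_less mem_ball subsetD)
          then show ?thesis using dist_triangle[of z x y1] y1(2) d(1) by (simp add: dist_commute)
        qed
        show "approx \<Omega> K k (kernel_jet s y)" if "dist y y1 < \<delta>" for y
          using \<delta>(2) that by (auto simp: E_def dist_commute)
        show "dist y y1 < d / 5" using dist_triangle[of y y1 z] y y1(2) by (simp add: dist_commute)
      qed (rule \<delta>)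
      then show "y \<in> E" by (simp add: E_def)
    qed
    then show ?thesis using d(1) by (meson centre_in_ball divide_pos_pos mem_interior zero_less_numeral)
  qed
  obtain y0 where y0: "y0 \<in> C" "y0 \<in> interior (- \<Omega>)" using comps y unfolding C_def by blast
  have "interior (- \<Omega>) \<subseteq> E"
    unfolding E_def using approx_kernel_outside[OF Om] by blast
  then have "y0 \<in> interior E" using y0(2) by (meson interior_maximal open_interior subsetD)
  then have ne: "interior E \<inter> C \<noteq> {}" using y0 by blast
  \<comment> \<open>By \<open>clopen\<close>, each point of \<open>C\<close> lies in the interior of
    \<open>E\<close> or off its closure; connectedness leaves only one of these two open
    sets.\<close>
  have "connected C" by (simp add: C_def)
  then have "interior E \<inter> C = {} \<or> - closure (interior E) \<inter> C = {}"
    by (rule connectedD) (use clopen closure_subset in auto)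
  then have "C \<subseteq> interior E" using ne clopen by blast
  moreover have "y \<in> C" using y by (simp add: C_def)
  ultimately show ?thesis using interior_subset unfolding E_def by blast
qed

text \<open>\<open>K\<close> and \<open>L\<close> are disjoint compact sets, so the kernel and its
  derivatives are uniformly continuous on their product. Replacing the pole by a nearby node on each
  small piece of \<open>L\<close> costs at most \<open>\<epsilon>'\<close> times the integral of
  |f|.\<close>

lemma approx_kernel_integral:
  assumes K: "compact K" and Om: "bounded \<Omega>" "K \<subseteq> \<Omega>"
    and comps: "\<forall>x\<in>- K. \<exists>y\<in>connected_component_set (- K) x. y \<in> interior (- \<Omega>)"
    and f: "smooth_on f UNIV" and L: "compact L" "\<And>y. y \<notin> L \<Longrightarrow> f y = 0" "L \<inter> K = {}"
  shows "approx \<Omega> K k (\<lambda>js x i. LINT y|lborel. kernel_jet s y js x i * f y)"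
proof (rule approx_limit)
  fix \<epsilon> :: real assume e: "\<epsilon> > 0"
  have scs_f: "smooth_compact_support f" by (rule smooth_compact_supportI[OF f L(1,2)])
  have int_f: "integrable lborel f" by (rule scs_integrable[OF scs_f])
  define I where "I = (LINT y|lborel. \<bar>f y\<bar>)"
  have I: "I \<ge> 0" unfolding I_def by (rule integral_nonneg_AE) simp
  define \<epsilon>' where "\<epsilon>' = \<epsilon> / (I + 1)"
  have e': "\<epsilon>' > 0" "\<epsilon>' * I \<le> \<epsilon>" using e I by (auto simp: \<epsilon>'_def field_simps)
  have ker_cont: "continuous_on (- {0}) (pds js (kernel_u B s i))" for js i
    by (rule smooth_on_continuous[OF radial0_smooth[OF radial0_kernel_u]])
  have "\<exists>\<eta>>0. \<forall>x\<in>K. \<forall>y\<in>L. \<forall>y'\<in>L. dist y y' < \<eta> \<longrightarrow> \<bar>kernel_jet s y js x i - kernel_jet s y' js x i\<bar> < \<epsilon>'" for js i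
  proof -
    have c: "compact (K \<times> L)" using K L(1) by (rule compact_Times)
    have "continuous_on (K \<times> L) (\<lambda>(x, y). kernel_jet s y js x i)"
      unfolding case_prod_unfold
      by (rule continuous_on_compose2[OF ker_cont]) (use L(3) in \<open>auto intro!: continuous_intros\<close>)
    from compact_uniformly_continuous[OF this c] e'(1)
    obtain \<eta> where \<eta>: "\<eta> > 0" "\<And>a b. a \<in> K \<times> L \<Longrightarrow> b \<in> K \<times> L \<Longrightarrow> dist b a < \<eta> \<Longrightarrow>
      dist ((\<lambda>(x, y). kernel_jet s y js x i) b) ((\<lambda>(x, y). kernel_jet s y js x i) a) < \<epsilon>'"
      unfolding uniformly_continuous_on_def by meson
    have "\<bar>kernel_jet s y js x i - kernel_jet s y' js x i\<bar> < \<epsilon>'" if "x \<in> K" "y \<in> L" "y' \<in> L" "dist y y' < \<eta>" for x y y'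
      using \<eta>(2)[of "(x, y')" "(x, y)"] that by (simp add: dist_Pair_Pair dist_real_def)
    then show ?thesis using \<eta>(1) by blast
  qed
  then obtain \<eta>0 where \<eta>0: "\<And>js i. \<eta>0 js i > 0"
    "\<And>js i x y y'. x \<in> K \<Longrightarrow> y \<in> L \<Longrightarrow> y' \<in> L \<Longrightarrow> dist y y' < \<eta>0 js i \<Longrightarrow> \<bar>kernel_jet s y js x i - kernel_jet s y' js x i\<bar> < \<epsilon>'"
    by metis
  define J where "J = {js :: 'n list. length js \<le> k} \<times> (UNIV :: 'n set)"
  have finJ: "finite J" unfolding J_def by (rule finite_cartesian_product[OF finite_lists_le finite])
  \<comment> \<open>The smallest modulus over all derivatives up to order \<open>k\<close> and all
    components, so that a single partition of \<open>L\<close> serves every entry.\<close>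
  define \<eta> where "\<eta> = Min ((\<lambda>(js, i). \<eta>0 js i) ` J)"
  have J0: "([], undefined) \<in> J" by (simp add: J_def)
  have \<eta>: "\<eta> > 0" unfolding \<eta>_def using finJ J0 \<eta>0(1) by (subst Min_gr_iff) auto
  have \<eta>_le: "\<eta> \<le> \<eta>0 js i" if "length js \<le> k" for js i
    unfolding \<eta>_def using finJ that by (intro Min_le) (auto simp: J_def image_iff)
  have "L \<subseteq> (\<Union>y\<in>L. ball y \<eta>)" using \<eta> by auto
  then obtain T where T: "T \<subseteq> L" "finite T" "L \<subseteq> (\<Union>y\<in>T. ball y \<eta>)"
    using compactE_image[OF L(1), of L "\<lambda>y. ball y \<eta>"] by auto
  obtain n and \<tau> :: "nat \<Rightarrow> real^'n" where \<tau>: "bij_betw \<tau> {0..<n} T"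
    using ex_bij_betw_nat_finite[OF T(2)] by blast
  \<comment> \<open>Disjoint pieces of the covering balls. A piece need not contain its node;
    closeness to the node is enough.\<close>
  define P where "P = disjointed (\<lambda>m. ball (\<tau> m) \<eta>)"
  have Pdisj: "disjoint_family P" unfolding P_def by (rule disjoint_family_disjointed)
  have Psub: "P m \<subseteq> ball (\<tau> m) \<eta>" for m unfolding P_def by (rule disjointed_subset)
  have Pmeas: "P m \<in> sets lborel" for m
    unfolding P_def disjointed_def by auto
  have Pcover: "L \<subseteq> (\<Union>m\<in>{0..<n}. P m)"
    unfolding P_def finite_UN_disjointed_eq using T(3) bij_betw_imp_surj_on[OF \<tau>] by auto
  have \<tau>L: "\<tau> m \<in> L" if "m < n" for m using bij_betw_apply[OF \<tau>, of m] T(1) that by auto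
  have ind1: "(\<Sum>m\<in>{0..<n}. indicator (P m) y) = (1::real)" if yL: "y \<in> L" for y
  proof -
    obtain m where m: "m < n" "y \<in> P m" using Pcover yL by auto
    have "indicator (P m') y = (if m' = m then 1 else 0 :: real)" for m'
      using m(2) Pdisj unfolding disjoint_family_on_def by (auto simp: indicator_def)
    then show ?thesis using m(1) by simp
  qed
  \<comment> \<open>With these weights the finite sum is the integral of \<open>f\<close> against
    the kernel whose pole is frozen at the node on each piece.\<close>
  define a where "a = (\<lambda>m. LINT y|lborel. indicator (P m) y * f y)"
  let ?g = "\<lambda>js x i. \<Sum>m\<in>{0..<n}. a m * kernel_jet s (\<tau> m) js x i"
  have "approx \<Omega> K k ?g"
  proof (rule approx_sum)
    fix m assume "m \<in> {0..<n}"
    then have "\<tau> m \<notin> K" using \<tau>L L(3) by auto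
    then show "approx \<Omega> K k (kernel_jet s (\<tau> m))" by (rule approx_kernel[OF K Om comps])
  qed simp
  moreover have "\<bar>?g js x i - (LINT y|lborel. kernel_jet s y js x i * f y)\<bar> \<le> \<epsilon>" if js: "length js \<le> k" "x \<in> K" for js x i
  proof -
    let ?k = "\<lambda>y. kernel_jet s y js x i"
    have int_kf: "integrable lborel (\<lambda>y. ?k y * f y)"
      by (rule scs_integrable[OF scs_reflect_mult[OF smooth_on_pds[OF radial0_smooth[OF radial0_kernel_u]] open_punctured f L(1,2)]])
        (use L(3) js in auto)
    have int_ind: "integrable lborel (\<lambda>y. indicator (P m) y * f y)" for m
      using integrable_mult_indicator[OF Pmeas int_f] by simp
    have int_sum: "integrable lborel (\<lambda>y. \<Sum>m\<in>{0..<n}. ?k (\<tau> m) * (indicator (P m) y * f y))"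
      using int_ind by (intro Bochner_Integration.integrable_sum integrable_mult_right) auto
    have gs: "?g js x i = (LINT y|lborel. (\<Sum>m\<in>{0..<n}. ?k (\<tau> m) * (indicator (P m) y * f y)))"
      using int_ind by (subst Bochner_Integration.integral_sum) (auto simp: a_def mult.commute)
    have "?g js x i - (LINT y|lborel. ?k y * f y) =
      (LINT y|lborel. (\<Sum>m\<in>{0..<n}. ?k (\<tau> m) * (indicator (P m) y * f y)) - ?k y * f y)"
      unfolding gs by (rule Bochner_Integration.integral_diff[OF int_sum int_kf, symmetric])
    then have "\<bar>?g js x i - (LINT y|lborel. ?k y * f y)\<bar> =
      \<bar>LINT y|lborel. (\<Sum>m\<in>{0..<n}. ?k (\<tau> m) * (indicator (P m) y * f y)) - ?k y * f y\<bar>" by (rule arg_cong)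
    also have "\<dots> \<le> (LINT y|lborel. \<epsilon>' * \<bar>f y\<bar>)"
    proof (rule integral_abs_bound_integral)
      show "integrable lborel (\<lambda>y. (\<Sum>m\<in>{0..<n}. ?k (\<tau> m) * (indicator (P m) y * f y)) - ?k y * f y)"
        by (rule Bochner_Integration.integrable_diff[OF int_sum int_kf])
      show "integrable lborel (\<lambda>y. \<epsilon>' * \<bar>f y\<bar>)" using int_f by auto
      fix y
      show "\<bar>(\<Sum>m\<in>{0..<n}. ?k (\<tau> m) * (indicator (P m) y * f y)) - ?k y * f y\<bar> \<le> \<epsilon>' * \<bar>f y\<bar>"
      proof (cases "y \<in> L")
        case True
        have "(\<Sum>m\<in>{0..<n}. ?k (\<tau> m) * (indicator (P m) y * f y)) - ?k y * f y
          = (\<Sum>m\<in>{0..<n}. ?k (\<tau> m) * (indicator (P m) y * f y)) - (\<Sum>m\<in>{0..<n}. indicator (P m) y) * (?k y * f y)"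
          unfolding ind1[OF True] by simp
        also have "\<dots> = (\<Sum>m\<in>{0..<n}. indicator (P m) y * (?k (\<tau> m) - ?k y)) * f y"
          unfolding sum_distrib_right sum_subtractf[symmetric]
          by (intro sum.cong refl) (simp add: algebra_simps)
        finally have eq: "\<bar>(\<Sum>m\<in>{0..<n}. ?k (\<tau> m) * (indicator (P m) y * f y)) - ?k y * f y\<bar>
          = \<bar>\<Sum>m\<in>{0..<n}. indicator (P m) y * (?k (\<tau> m) - ?k y)\<bar> * \<bar>f y\<bar>" by (simp only: abs_mult)
        have "\<bar>\<Sum>m\<in>{0..<n}. indicator (P m) y * (?k (\<tau> m) - ?k y)\<bar> \<le> (\<Sum>m\<in>{0..<n}. \<bar>indicator (P m) y * (?k (\<tau> m) - ?k y)\<bar>)"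
          by (rule sum_abs)
        also have "\<dots> \<le> (\<Sum>m\<in>{0..<n}. indicator (P m) y * \<epsilon>')"
        proof (rule sum_mono)
          fix m assume m: "m \<in> {0..<n}"
          show "\<bar>indicator (P m) y * (?k (\<tau> m) - ?k y)\<bar> \<le> indicator (P m) y * \<epsilon>'"
          proof (cases "y \<in> P m")
            case yP: True
            then have "y \<in> ball (\<tau> m) \<eta>" using Psub[of m] by blast
            then have "dist (\<tau> m) y < \<eta>0 js i" using \<eta>_le[OF js(1), of i] by simp
            moreover have "\<tau> m \<in> L" using \<tau>L m by simp
            ultimately have "\<bar>?k (\<tau> m) - ?k y\<bar> < \<epsilon>'" using \<eta>0(2)[OF js(2) _ True] by blast
            then show ?thesis using yP by simp
          qed simp
        qed
        also have "\<dots> = \<epsilon>'" using ind1[OF True] by (simp add: sum_distrib_right[symmetric])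
        finally show ?thesis unfolding eq by (rule mult_right_mono) simp
      qed (simp add: L(2))
    qed
    also have "\<dots> = \<epsilon>' * I" by (simp add: I_def)
    finally show ?thesis using e'(2) by simp
  qed
  ultimately show "\<exists>g. approx \<Omega> K k g \<and> (\<forall>js x i. length js \<le> k \<longrightarrow> x \<in> K \<longrightarrow>
      \<bar>g js x i - (LINT y|lborel. kernel_jet s y js x i * f y)\<bar> \<le> \<epsilon>)"
    by blast
qed

end

section \<open>Representation of a cut-off solution by its force and divergence\<close>

context biharmonic
begin

lemma kernel_parts:
  assumes f: "smooth_on f UNIV" and L: "compact L" "\<And>y. y \<notin> L \<Longrightarrow> f y = 0" and x: "x \<notin> L"
  shows "(LINT y|lborel. B (x - y) * pds ls f y) = (LINT y|lborel. pds ls B (x - y) * f y)"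
    and "integrable lborel (\<lambda>y. B (x - y) * pds ls f y)"
    and "integrable lborel (\<lambda>y. pds ls B (x - y) * f y)"
proof -
  note sB = radial0_smooth[OF radial0_B]
  have x: "x - y \<in> - {0}" if "y \<in> L" for y using x that by auto
  show "(LINT y|lborel. B (x - y) * pds ls f y) = (LINT y|lborel. pds ls B (x - y) * f y)"
    by (rule integration_by_parts_pds[OF sB open_punctured f L x])
  show "integrable lborel (\<lambda>y. B (x - y) * pds ls f y)"
    by (rule scs_integrable[OF scs_reflect_mult[OF sB open_punctured smooth_on_pds[OF f] L(1) pds_support[OF L] x]])
  show "integrable lborel (\<lambda>y. pds ls B (x - y) * f y)"
    by (rule scs_integrable[OF scs_reflect_mult[OF smooth_on_pds[OF sB] open_punctured f L x]])
qed

text \<open>Expands the kernel columns into integrals of derivatives of \<open>B\<close> alone, the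
  form that integration by parts of the bilaplacian identity produces.\<close>

lemma kernel_integrals:
  assumes f: "smooth_on f UNIV" and L: "compact L" "\<And>y. y \<notin> L \<Longrightarrow> f y = 0" and x: "x \<notin> L"
  shows "(LINT y|lborel. kernel_jet (Some j) y js x i * f y) =
      (LINT y|lborel. pds (js @ [i, j]) B (x - y) * f y) +
      (if i = j then - 1 else 0) * (\<Sum>l\<in>UNIV. (LINT y|lborel. pds (js @ [l, l]) B (x - y) * f y))"
    and "(LINT y|lborel. kernel_jet None y js x i * f y) =
      (\<Sum>l\<in>UNIV. (LINT y|lborel. pds (js @ [i, l, l]) B (x - y) * f y))"
proof -
  note sB = radial0_smooth[OF radial0_B]
  note sLB = radial0_smooth[OF radial0_laplacian[OF radial0_B]]
  note int = kernel_parts(3)[OF f L x]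
  have lapB: "pds ls (laplacian B) z = (\<Sum>l\<in>UNIV. pds (ls @ [l, l]) B z)" if "z \<noteq> 0" for ls z
    unfolding laplacian_def[abs_def] pds_append
    by (rule pds_sum[OF open_punctured _ smooth_on_pds[OF sB]]) (use that in auto)
  have "kernel_jet (Some j) y js x i * f y = pds (js @ [i, j]) B (x - y) * f y
    + (\<Sum>l\<in>UNIV. (if i = j then - 1 else 0) * (pds (js @ [l, l]) B (x - y) * f y))" for y
  proof (cases "y \<in> L")
    case True
    then have z: "x - y \<in> - {0}" using x by auto
    have "kernel_u B (Some j) i = (\<lambda>z. pds [i, j] B z + (if i = j then - 1 else 0) * laplacian B z)"
      by (simp add: fun_eq_iff)
    then have "kernel_jet (Some j) y js x i = pds js (pds [i, j] B) (x - y) + (if i = j then - 1 else 0) * pds js (laplacian B) (x - y)"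
      by (simp only: pds_add[OF open_punctured smooth_on_pds[OF sB] smooth_on_cmult[OF open_punctured sLB] z]
          pds_cmult[OF open_punctured sLB z])
    then show ?thesis using z lapB[of "x - y" js]
      by (simp only: pds_append) (simp add: algebra_simps sum_distrib_left sum_distrib_right del: pds.simps)
  qed (simp add: L(2))
  then show "(LINT y|lborel. kernel_jet (Some j) y js x i * f y) =
      (LINT y|lborel. pds (js @ [i, j]) B (x - y) * f y) +
      (if i = j then - 1 else 0) * (\<Sum>l\<in>UNIV. (LINT y|lborel. pds (js @ [l, l]) B (x - y) * f y))"
    using int by (simp only: sum_distrib_left) (subst Bochner_Integration.integral_add, auto simp del: pds.simps)
  have "kernel_jet None y js x i * f y = (\<Sum>l\<in>UNIV. pds (js @ [i, l, l]) B (x - y) * f y)" for y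
  proof (cases "y \<in> L")
    case True
    then have z: "x - y \<noteq> 0" using x by auto
    have "kernel_u B None i = pds [i] (laplacian B)" by (simp add: fun_eq_iff)
    then have "kernel_jet None y js x i = pds (js @ [i]) (laplacian B) (x - y)" by (simp only: pds_append)
    also have "\<dots> = (\<Sum>l\<in>UNIV. pds (js @ [i, l, l]) B (x - y))" using lapB[OF z, of "js @ [i]"] by simp
    finally show ?thesis by (simp add: sum_distrib_right)
  qed (simp add: L(2))
  then show "(LINT y|lborel. kernel_jet None y js x i * f y) =
      (\<Sum>l\<in>UNIV. (LINT y|lborel. pds (js @ [i, l, l]) B (x - y) * f y))"
    using int by (simp add: Bochner_Integration.integral_sum del: pds.simps)
qed

text \<open>With \<open>f\<close> the force and \<open>g\<close> the divergence of a pair \<open>(w, q)\<close>, every component of \<open>w\<close> solves an equation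
  for the bilaplacian in which \<open>q\<close> no longer appears.\<close>

lemma bilaplacian_identity:
  fixes w :: "'n \<Rightarrow> real^'n \<Rightarrow> real" and q :: "real^'n \<Rightarrow> real"
  assumes w: "\<And>i. smooth_on (w i) UNIV" and q: "smooth_on q UNIV"
    and f: "\<And>i x. f i x = (- 1) * laplacian (w i) x + pds [i] q x" and g: "\<And>x. g x = (\<Sum>m\<in>UNIV. pds [m] (w m) x)"
  shows "laplacian (laplacian (w i)) y =
    (- 1) * (\<Sum>l\<in>UNIV. pds [l, l] (f i) y) + (\<Sum>l\<in>UNIV. pds [i, l] (f l) y) + (\<Sum>l\<in>UNIV. pds [i, l, l] g y)"
proof -
  have f': "f i = (\<lambda>x. (- 1) * laplacian (w i) x + pds [i] q x)" for i using f by auto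
  have g': "g = (\<lambda>x. \<Sum>m\<in>UNIV. pds [m] (w m) x)" using g by auto
  note lw = smooth_on_laplacian[OF open_UNIV w]
  have pf: "pds js (f i) y = (- 1) * pds js (laplacian (w i)) y + pds js (pds [i] q) y" for js i
    unfolding f' by (simp only: pds_add[OF open_UNIV smooth_on_cmult[OF open_UNIV lw] smooth_on_pds[OF q] UNIV_I]
        pds_cmult[OF open_UNIV lw UNIV_I])
  have lq: "(\<Sum>l\<in>UNIV. pds [i, l] (pds [l] q) y) = pds [i] (laplacian q) y"
  proof -
    have "pds [i, l] (pds [l] q) y = pds [l, l] (pds [i] q) y" for l
      unfolding pds_append[symmetric] by (rule pds_cong_mset[OF q open_UNIV UNIV_I]) simp
    then show ?thesis using laplacian_pds[OF q open_UNIV UNIV_I, of "[i]"] unfolding laplacian_def by simp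
  qed
  have "(\<Sum>l\<in>UNIV. pds [i, l, l] g y) = (\<Sum>l\<in>UNIV. \<Sum>m\<in>UNIV. pds [i, l, l] (pds [m] (w m)) y)"
    unfolding g' by (intro sum.cong refl pds_sum[OF open_UNIV]) (auto intro: smooth_on_pds[OF w, of "[m]" for m, simplified])
  also have "\<dots> = (\<Sum>m\<in>UNIV. \<Sum>l\<in>UNIV. pds [i, l, l] (pds [m] (w m)) y)" by (rule sum.swap)
  also have "\<dots> = (\<Sum>m\<in>UNIV. \<Sum>l\<in>UNIV. pds [l, l] (pds [i, m] (w m)) y)"
    unfolding pds_append[symmetric] by (intro sum.cong refl pds_cong_mset[OF w open_UNIV UNIV_I]) simp
  also have "\<dots> = (\<Sum>m\<in>UNIV. pds [i, m] (laplacian (w m)) y)"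
    unfolding laplacian_pds[OF w open_UNIV UNIV_I, symmetric] by (simp add: laplacian_def)
  finally have lg: "(\<Sum>l\<in>UNIV. pds [i, l, l] g y) = (\<Sum>m\<in>UNIV. pds [i, m] (laplacian (w m)) y)" .
  have "(\<Sum>l\<in>UNIV. pds [l, l] (f i) y) = (- 1) * laplacian (laplacian (w i)) y + pds [i] (laplacian q) y"
    unfolding pf sum.distrib sum_distrib_left[symmetric]
    using laplacian_pds[OF q open_UNIV UNIV_I, of "[i]"] by (simp add: laplacian_def)
  moreover have "(\<Sum>l\<in>UNIV. pds [i, l] (f l) y) = (- 1) * (\<Sum>l\<in>UNIV. pds [i, l] (laplacian (w l)) y) + pds [i] (laplacian q) y"
    unfolding pf sum.distrib sum_distrib_left[symmetric] lq ..
  \<comment> \<open>The first sum, with its sign, contributes -d_i Lap q and the second +d_i Lap q,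
    so the pressure cancels. The second also contains -d_i Lap div w, which the sum over
    \<open>g\<close> cancels, leaving only the bilaplacian of \<open>w i\<close>.\<close>
  ultimately show ?thesis unfolding lg by simp
qed

end

lemma scs_vec:
  fixes v :: "'n::finite \<Rightarrow> real^'n \<Rightarrow> real"
  assumes "\<And>j. smooth_compact_support (v j)"
  shows "smooth_compact_support (\<lambda>x. \<chi> j. v j x)"
proof -
  have "smooth_compact_support (\<lambda>x. v j x *\<^sub>R axis j (1::real))" for j
  proof -
    obtain C where "smooth_on (v j) UNIV" "compact C" "\<And>x. x \<notin> C \<Longrightarrow> v j x = 0"
      using assms by (metis smooth_compact_supportE)
    then show ?thesis
      by (intro smooth_compact_supportI[where C=C] smooth_on_linear[OF open_UNIV bounded_linear_scaleR_left]) auto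
  qed
  then have "smooth_compact_support (\<lambda>x. \<Sum>j\<in>UNIV. v j x *\<^sub>R axis j (1::real))"
    by (intro scs_sum) auto
  also have "(\<lambda>x. \<Sum>j\<in>UNIV. v j x *\<^sub>R axis j (1::real)) = (\<lambda>x. \<chi> j. v j x)"
    by (auto simp: fun_eq_iff vec_eq_iff axis_def if_distrib cong: if_cong)
  finally show ?thesis .
qed

lemma smooth_on_cutoff_scs:
  fixes f :: "real^'n::finite \<Rightarrow> real"
  assumes "open W" "smooth_on f W" "smooth_on \<eta> UNIV" "compact C" "C \<subseteq> W" "\<And>x. x \<notin> C \<Longrightarrow> \<eta> x = 0"
  shows "smooth_compact_support (\<lambda>x. \<eta> x * f x)"
  by (rule smooth_compact_supportI[OF smooth_on_cutoff_mult[OF assms(1-3) compact_imp_closed[OF assms(4)] assms(5,6)] assms(4)])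
    (simp_all add: assms(6))

lemma approx_local_solution:
  fixes K V \<Omega> :: "(real^'n::finite) set" and u :: "'n \<Rightarrow> real^'n \<Rightarrow> real"
  assumes dim: "CARD('n) \<in> {2, 3}" and K: "compact K" and V: "open V" "K \<subseteq> V"
    and Om: "bounded \<Omega>" "K \<subseteq> \<Omega>"
    and comps: "\<forall>x\<in>- K. \<exists>y\<in>connected_component_set (- K) x. y \<in> interior (- \<Omega>)"
    and u: "\<And>i. smooth_on (u i) V" and p: "smooth_on p V" and stokes: "stokes_comp u p V"
  shows "approx \<Omega> K k (\<lambda>js x i. pds js (u i) x)"
proof (rule biharmonic_representation[OF dim])
  fix B :: "real^'n \<Rightarrow> real" and c :: real
  assume c: "c \<noteq> 0" and B: "radial 0 B" "\<And>z. z \<noteq> 0 \<Longrightarrow> laplacian (laplacian B) z = 0"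
    and rep: "\<And>w x. smooth_compact_support w \<Longrightarrow> laplacian (laplacian w) x = 0 \<Longrightarrow>
       c * w x = (LINT y|lborel. B (x - y) * laplacian (laplacian w) y)"
  interpret biharmonic B by unfold_locales (use B in auto)
  obtain \<eta> U C where cut: "smooth_on \<eta> UNIV" "compact C" "C \<subseteq> V" "\<And>x. x \<notin> C \<Longrightarrow> \<eta> x = (0::real)"
    "open U" "K \<subseteq> U" "\<And>x. x \<in> U \<Longrightarrow> \<eta> x = 1"
    using smooth_cutoff[OF K V] by metis
  define w where "w i x = \<eta> x * u i x" for i x
  define q where "q x = \<eta> x * p x" for x
  define f where "f i x = (- 1) * laplacian (w i) x + pds [i] q x" for i x
  define g where "g x = (\<Sum>m\<in>UNIV. pds [m] (w m) x)" for x
  have scs_w: "smooth_compact_support (w i)" for i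
    unfolding w_def[abs_def] by (rule smooth_on_cutoff_scs[OF V(1) u cut(1-4)])
  have scs_q: "smooth_compact_support q"
    unfolding q_def[abs_def] by (rule smooth_on_cutoff_scs[OF V(1) p cut(1-4)])
  have scs_f: "smooth_compact_support (f i)" for i
    unfolding f_def[abs_def] by (intro scs_add scs_cmult scs_laplacian scs_pds scs_w scs_q)
  have scs_g: "smooth_compact_support g"
    unfolding g_def[abs_def] by (intro scs_sum scs_pds scs_w) auto
  have UV: "U \<subseteq> V" using cut(3,4,7) by force
  have wU: "w i x = u i x" "q x = p x" if "x \<in> U" for i x using cut(7)[OF that] by (auto simp: w_def q_def)
  have fgU: "f i x = 0" "g x = 0" if x: "x \<in> U" for i x
  proof -
    have "laplacian (w i) x = laplacian (u i) x" by (rule laplacian_cong[OF cut(5) x wU(1)])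
    moreover have "pds [j] q x = pds [j] p x" for j by (rule pds_cong[OF cut(5) x wU(2)])
    moreover have "pds [j] (w j) x = pds [j] (u j) x" for j by (rule pds_cong[OF cut(5) x wU(1)])
    moreover have "- laplacian (u i) x + pd i p x = 0" "(\<Sum>i\<in>UNIV. pd i (u i) x) = 0"
      using stokes x UV unfolding stokes_comp_def by blast+
    ultimately show "f i x = 0" "g x = 0" by (simp_all add: f_def g_def)
  qed
  have wC: "w i x = 0" "q x = 0" if "x \<notin> C" for i x using cut(4)[OF that] by (auto simp: w_def q_def)
  have fgC: "f i x = 0" "g x = 0" if x: "x \<notin> C" for i x
  proof -
    have "pds js (w i) x = 0" "pds js q x = 0" for js i
      by (rule pds_support[OF cut(2) wC(1) x] pds_support[OF cut(2) wC(2) x]; assumption)+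
    then show "f i x = 0" "g x = 0" by (simp_all add: f_def g_def laplacian_def del: pds.simps)
  qed
  \<comment> \<open>Off \<open>C\<close> the cut-off pair vanishes, and on \<open>U\<close> it is
    the original solution; force and divergence are therefore supported in between, away from
    \<open>K\<close>.\<close>
  define L where "L = C - U"
  have L: "compact L" "L \<inter> K = {}" unfolding L_def using cut(2,5,6) by (auto intro: compact_diff)
  have fgL: "f i x = 0" "g x = 0" if "x \<notin> L" for i x
    using that fgU fgC by (auto simp: L_def)
  have sw: "smooth_on (w i) UNIV" and sf: "smooth_on (f i) UNIV" and sg: "smooth_on g UNIV" for i
    using scs_w scs_f scs_g scs_smooth by blast+
  have H: "laplacian (laplacian (w i)) y =
    (- 1) * (\<Sum>l\<in>UNIV. pds [l, l] (f i) y) + (\<Sum>l\<in>UNIV. pds [i, l] (f l) y) + (\<Sum>l\<in>UNIV. pds [i, l, l] g y)" for i y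
    by (rule bilaplacian_identity[OF sw scs_smooth[OF scs_q] f_def g_def])
  have LL: "laplacian (laplacian (pds js (w i))) y = (- 1) * (\<Sum>l\<in>UNIV. pds (js @ [l, l]) (f i) y)
    + (\<Sum>l\<in>UNIV. pds (js @ [i, l]) (f l) y) + (\<Sum>l\<in>UNIV. pds (js @ [i, l, l]) g y)" for js i y
  proof -
    have "laplacian (pds js (w i)) = pds js (laplacian (w i))"
      using laplacian_pds[OF sw open_UNIV UNIV_I] by blast
    then have "laplacian (laplacian (pds js (w i))) y = pds js (laplacian (laplacian (w i))) y"
      using laplacian_pds[OF smooth_on_laplacian[OF open_UNIV sw] open_UNIV UNIV_I] by simp
    also have "laplacian (laplacian (w i)) = (\<lambda>y. (- 1) * (\<Sum>l\<in>UNIV. pds [l, l] (f i) y)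
      + (\<Sum>l\<in>UNIV. pds [i, l] (f l) y) + (\<Sum>l\<in>UNIV. pds [i, l, l] g y))" using H by blast
    also have "pds js \<dots> y = (- 1) * pds js (\<lambda>y. \<Sum>l\<in>UNIV. pds [l, l] (f i) y) y
      + pds js (\<lambda>y. \<Sum>l\<in>UNIV. pds [i, l] (f l) y) y + pds js (\<lambda>y. \<Sum>l\<in>UNIV. pds [i, l, l] g y) y"
    proof -
      have s: "smooth_on (\<lambda>y. \<Sum>l\<in>UNIV. pds [l, l] (f i) y) UNIV" "smooth_on (\<lambda>y. \<Sum>l\<in>UNIV. pds [i, l] (f l) y) UNIV"
        "smooth_on (\<lambda>y. \<Sum>l\<in>UNIV. pds [i, l, l] g y) UNIV"
        by (rule smooth_on_sum[OF open_UNIV finite smooth_on_pds[OF sf]] smooth_on_sum[OF open_UNIV finite smooth_on_pds[OF sg]])+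
      show ?thesis
        by (simp only: pds_add[OF open_UNIV smooth_on_add[OF open_UNIV smooth_on_cmult[OF open_UNIV s(1)] s(2)] s(3) UNIV_I]
          pds_add[OF open_UNIV smooth_on_cmult[OF open_UNIV s(1)] s(2) UNIV_I] pds_cmult[OF open_UNIV s(1) UNIV_I])
    qed
    also have "\<dots> = (- 1) * (\<Sum>l\<in>UNIV. pds (js @ [l, l]) (f i) y)
      + (\<Sum>l\<in>UNIV. pds (js @ [i, l]) (f l) y) + (\<Sum>l\<in>UNIV. pds (js @ [i, l, l]) g y)"
      unfolding pds_append
      by (simp only: pds_sum[OF open_UNIV finite smooth_on_pds[OF sf] UNIV_I] pds_sum[OF open_UNIV finite smooth_on_pds[OF sg] UNIV_I])
    finally show ?thesis .
  qed
  \<comment> \<open>The formula is applied to the derivative \<open>pds js (w i)\<close>, itself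
    smooth with compact support; integration by parts then moves \<open>js\<close> onto
    \<open>B\<close>. The factor \<open>1 *\<close> matches the shape of
    \<open>approx_sum\<close>.\<close>
  have rep_w: "(1 / c) * (\<Sum>j\<in>UNIV. 1 * (LINT y|lborel. kernel_jet (Some j) y js x i * f j y))
    + (1 / c) * (LINT y|lborel. kernel_jet None y js x i * g y) = pds js (w i) x" if x: "x \<in> K" for js x i
  proof -
    have xL: "x \<notin> L" using x L(2) by blast
    have xU: "x \<in> U" using x cut(6) by blast
    define A where "A ls F = (LINT y|lborel. pds ls B (x - y) * F y)" for ls F
    note pf = kernel_parts[OF sf L(1) fgL(1) xL]
    note pg = kernel_parts[OF sg L(1) fgL(2) xL]
    have z: "pds ls (f l) x = 0" "pds ls g x = 0" for ls l
      by (rule pds_eq_0[OF cut(5) xU fgU(1)] pds_eq_0[OF cut(5) xU fgU(2)]; assumption)+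
    \<comment> \<open>The sources vanish on the open set \<open>U\<close> containing
      \<open>x\<close>, hence so do all their derivatives at \<open>x\<close>; this is the side
      condition of \<open>rep\<close>.\<close>
    have "laplacian (laplacian (pds js (w i))) x = 0" unfolding LL z by simp
    then have "c * pds js (w i) x = (LINT y|lborel. B (x - y) * laplacian (laplacian (pds js (w i))) y)"
      by (rule rep[OF scs_pds[OF scs_w]])
    also have "\<dots> = (LINT y|lborel. (- 1) * (\<Sum>l\<in>UNIV. B (x - y) * pds (js @ [l, l]) (f i) y)
      + (\<Sum>l\<in>UNIV. B (x - y) * pds (js @ [i, l]) (f l) y) + (\<Sum>l\<in>UNIV. B (x - y) * pds (js @ [i, l, l]) g y))"
      unfolding LL by (simp add: algebra_simps sum_distrib_left)
    also have "\<dots> = (- 1) * (\<Sum>l\<in>UNIV. A (js @ [l, l]) (f i)) + (\<Sum>l\<in>UNIV. A (js @ [i, l]) (f l)) + (\<Sum>l\<in>UNIV. A (js @ [i, l, l]) g)"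
    proof -
      have i1: "integrable lborel (\<lambda>y. B (x - y) * pds ls (f l) y)" for ls l by (rule pf(2))
      have i2: "integrable lborel (\<lambda>y. B (x - y) * pds ls g y)" for ls by (rule pg(2))
      have s: "integrable lborel (\<lambda>y. \<Sum>l\<in>UNIV. B (x - y) * pds (js @ [l, l]) (f i) y)"
        "integrable lborel (\<lambda>y. \<Sum>l\<in>UNIV. B (x - y) * pds (js @ [i, l]) (f l) y)"
        "integrable lborel (\<lambda>y. \<Sum>l\<in>UNIV. B (x - y) * pds (js @ [i, l, l]) g y)"
        using i1 i2 by (auto intro!: Bochner_Integration.integrable_sum simp del: pds.simps)
      have p1: "(LINT y|lborel. B (x - y) * pds ls (f l) y) = A ls (f l)" for ls l
        unfolding A_def by (rule pf(1))
      have p2: "(LINT y|lborel. B (x - y) * pds ls g y) = A ls g" for ls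
        unfolding A_def by (rule pg(1))
      have e1: "(LINT y|lborel. (\<Sum>l\<in>UNIV. B (x - y) * pds (ls l) (f (m l)) y)) = (\<Sum>l\<in>UNIV. A (ls l) (f (m l)))" for ls m
        unfolding p1[symmetric] by (rule Bochner_Integration.integral_sum) (rule i1)
      have e2: "(LINT y|lborel. (\<Sum>l\<in>UNIV. B (x - y) * pds (ls l) g y)) = (\<Sum>l\<in>UNIV. A (ls l) g)" for ls
        unfolding p2[symmetric] by (rule Bochner_Integration.integral_sum) (rule i2)
      show ?thesis
        by (simp only: Bochner_Integration.integral_add[OF Bochner_Integration.integrable_add[OF integrable_mult_right[OF s(1)] s(2)] s(3)]
            Bochner_Integration.integral_add[OF integrable_mult_right[OF s(1)] s(2)] Bochner_Integration.integral_mult_right_zero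
            e1[of "\<lambda>l. js @ [l, l]" "\<lambda>_. i"] e1[of "\<lambda>l. js @ [i, l]" "\<lambda>l. l"] e2)
    qed
    \<comment> \<open>Summing the force columns over \<open>j\<close>, the Kronecker delta keeps
      only j = i in the Laplacian term, which is the term in \<open>f i\<close>.\<close>
    also have "\<dots> = (\<Sum>j\<in>UNIV. (LINT y|lborel. kernel_jet (Some j) y js x i * f j y)) + (LINT y|lborel. kernel_jet None y js x i * g y)"
    proof -
      have k1: "(LINT y|lborel. kernel_jet (Some j) y js x i * f j y) =
        A (js @ [i, j]) (f j) + (if i = j then - 1 else 0) * (\<Sum>l\<in>UNIV. A (js @ [l, l]) (f j))" for j
        unfolding A_def by (rule kernel_integrals(1)[OF sf L(1) fgL(1) xL])
      have k2: "(LINT y|lborel. kernel_jet None y js x i * g y) = (\<Sum>l\<in>UNIV. A (js @ [i, l, l]) g)"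
        unfolding A_def by (rule kernel_integrals(2)[OF sg L(1) fgL(2) xL])
      show ?thesis unfolding k1 k2
      by (simp add: sum.distrib if_distrib[where f="\<lambda>t. t * _"] cong: if_cong)
    qed
    finally show ?thesis using c by (simp add: field_simps)
  qed
  have app: "approx \<Omega> K k (\<lambda>js x i. (1 / c) * (\<Sum>j\<in>UNIV. 1 * (LINT y|lborel. kernel_jet (Some j) y js x i * f j y))
    + (1 / c) * (LINT y|lborel. kernel_jet None y js x i * g y))"
    by (rule approx_lincomb[OF approx_sum[OF finite] ])
      (rule approx_kernel_integral[OF K Om comps sf L(1) fgL(1) L(2)] approx_kernel_integral[OF K Om comps sg L(1) fgL(2) L(2)]; assumption)+
  show "approx \<Omega> K k (\<lambda>js x i. pds js (u i) x)"
  proof (rule approx_cong[OF app])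
    fix js :: "'n list" and x i assume x: "x \<in> K"
    then have xU: "x \<in> U" using cut(6) by blast
    have "pds js (w i) x = pds js (u i) x" by (rule pds_cong[OF cut(5) xU]) (rule wU(1))
    then show "(1 / c) * (\<Sum>j\<in>UNIV. 1 * (LINT y|lborel. kernel_jet (Some j) y js x i * f j y))
      + (1 / c) * (LINT y|lborel. kernel_jet None y js x i * g y) = pds js (u i) x"
      using rep_w[OF x] by simp
  qed
qed

theorem theorem2:
  fixes K V \<Omega> :: "(real^'n::finite) set"
    and u :: "real^'n \<Rightarrow> real^'n" and p :: "real^'n \<Rightarrow> real"
    and k :: nat and \<epsilon> :: real
  assumes dim: "CARD('n) \<in> {2, 3}"
    and K: "compact K"
    and V: "open V" "bounded V"
    and Om: "open \<Omega>" "bounded \<Omega>"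
    and KV: "K \<subseteq> V" and VOm: "closure V \<subseteq> \<Omega>"
    and comps: "\<forall>x\<in>- K. \<exists>y\<in>connected_component_set (- K) x. y \<in> interior (- \<Omega>)"
    and smooth_u: "smooth_on u V" and smooth_p: "smooth_on p V"
    and stokes: "stokes_on u p V"
    and eps: "\<epsilon> > 0"
  shows "\<exists>ub pb. smooth_compact_support ub \<and> smooth_compact_support pb \<and>
                stokes_on ub pb \<Omega> \<and>
                Ck_norm k K (\<lambda>x. ub x - u x) \<le> \<epsilon>"
proof -
  note su = smooth_on_linear[OF V(1) bounded_linear_vec_nth smooth_u]
  have KOm: "K \<subseteq> \<Omega>" using KV VOm closure_subset by blast
  have app: "approx \<Omega> K k (\<lambda>js x i. pds js (\<lambda>y. u y $ i) x)"
    by (rule approx_local_solution[OF dim K V(1) KV Om(2) KOm comps su smooth_p stokes[unfolded stokes_on_comp]])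
  \<comment> \<open>Componentwise errors add up, since the Euclidean norm is bounded by the sum of
    the absolute values of the N components.\<close>
  define e where "e = \<epsilon> / CARD('n)"
  have e: "e > 0" "CARD('n) * e = \<epsilon>" using eps by (simp_all add: e_def)
  obtain v pb where v: "\<And>i. smooth_compact_support (v i)" "smooth_compact_support pb" "stokes_comp v pb \<Omega>"
    "\<And>js x i. length js \<le> k \<Longrightarrow> x \<in> K \<Longrightarrow> \<bar>pds js (v i) x - pds js (\<lambda>y. u y $ i) x\<bar> \<le> e"
    using app e(1) by (rule approxE) blast
  define ub where "ub x = (\<chi> i. v i x)" for x
  have sub: "smooth_compact_support ub" unfolding ub_def[abs_def] by (rule scs_vec[OF v(1)])
  have "norm (pds js (\<lambda>x. ub x - u x) x) \<le> \<epsilon>" if js: "length js \<le> k" and x: "x \<in> K" for js x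
  proof -
    have xV: "x \<in> V" using x KV by blast
    have sd: "smooth_on (\<lambda>x. ub x + - u x) V"
      by (intro smooth_on_add smooth_on_minus V(1) smooth_u smooth_on_subset[OF scs_smooth[OF sub]]) auto
    have comp: "pds js (\<lambda>x. ub x - u x) x $ i = pds js (v i) x - pds js (\<lambda>y. u y $ i) x" for i
    proof -
      have sv: "smooth_on (v i) V" by (rule smooth_on_subset[OF scs_smooth[OF v(1)]]) simp
      have "pds js (\<lambda>x. ub x - u x) x $ i = pds js (\<lambda>x. v i x + - (u x $ i)) x"
        using pds_linear[OF V(1) bounded_linear_vec_nth[of i] sd xV, of js] by (simp add: ub_def)
      also have "\<dots> = pds js (v i) x + - pds js (\<lambda>y. u y $ i) x"
        by (simp only: pds_add[OF V(1) sv smooth_on_minus[OF V(1) su] xV] pds_minus[OF V(1) su xV])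
      finally show ?thesis by simp
    qed
    have "norm (pds js (\<lambda>x. ub x - u x) x) \<le> (\<Sum>i\<in>UNIV. \<bar>pds js (\<lambda>x. ub x - u x) x $ i\<bar>)"
      by (rule norm_le_l1_cart)
    also have "\<dots> \<le> (\<Sum>i\<in>(UNIV::'n set). e)" unfolding comp by (intro sum_mono v(4) js x)
    finally show ?thesis using e(2) by simp
  qed
  \<comment> \<open>The element 0 in the definition keeps the set nonempty when \<open>K\<close> is
    empty, so the supremum is governed by upper bounds in every case.\<close>
  then have "Ck_norm k K (\<lambda>x. ub x - u x) \<le> \<epsilon>"
    unfolding Ck_norm_def by (intro cSup_least) (use eps in auto)
  moreover have "stokes_on ub pb \<Omega>" using v(3) by (simp add: stokes_on_comp ub_def)
  ultimately show ?thesis using sub v(2) by blast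
qed

end
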